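(* Let $\mathcal{C}$ be a rigid ACU tensor category with unit $\mathbb{I}$, let $S,X,Y\in\mathcal{C}$ and let $\varphi_{S,X}:S\otimes X\to Y$, $\varphi_{X,S}:X\otimes S\to Y$, $\varphi_{S^\vee,X^\vee}:S^\vee\otimes X^\vee\to Y^\vee$, $\varphi_{X^\vee,S^\vee}:X^\vee\otimes S^\vee\to Y^\vee$ be morphisms. In what follows all $\mu$'s and $\lambda$'s are elements of $\mathrm{End}(\mathbb{I})$. (A) Suppose $(Cas)_{\mu_{S,X}}$ and $(Com)_{\lambda_{[S],[X]}}$ hold, and put $F:=(1_S\otimes\mathrm{ev}_{Y^\vee}^\tau)\circ(D_{X^\vee,S}\otimes1_{Y^{\vee\vee}})\circ D_{S,X^\vee}:S\to S$. Then: - if $(Com)_{\lambda_{X^\vee,S^\vee}}$ holds, $\lambda_{[S],[X]}\lambda_{X^\vee,S^\vee}\cdot F=\mu_{S,X}\cdot 1_S$; - if $(Com)_{\lambda_{S^\vee,X^\vee}}$ holds, $\lambda_{[S],[X]}\cdot F=\mu_{S,X}\lambda_{S^\vee,X^\vee}\cdot 1_S$. (B) Suppose $(Cas)_{\mu_{X,S}}$ and $(Com)_{\lambda_{[X],[S]}}$ hold, and put $G:=(1_{X^\vee}\otimes\mathrm{ev}_{Y^\vee})\circ(D_{S,X^\vee}\otimes1_{Y^{\vee}})\circ D_{X^\vee,S}:X^\vee\to X^\vee$. Then: - if $(Com)_{\lambda_{S,X}}$ holds, $\lambda_{[X],[S]}\lambda_{S,X}\cdot G=\mu_{X,S}\cdot1_{X^\vee}$;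 - if $(Com)_{\lambda_{X,S}}$ holds, $\lambda_{[X],[S]}\cdot G=\mu_{X,S}\lambda_{X,S}\cdot1_{X^\vee}$. The statements obtained from (A) and (B) by exchanging the roles of $S$ and $X$ throughout (hypotheses and conclusions) hold as well.
   Context: ACU tensor category: additive symmetric monoidal category with biadditive $\otimes$ (associativity and unit constraints suppressed), symmetry $\tau_{X,Y}$, internal homs $\hom(X,Y)$ with $\mathrm{ev}_{X,Y}:\hom(X,Y)\otimes X\to Y$; $X^\vee=\hom(X,\mathbb{I})$, $\mathrm{ev}_X:X^\vee\otimes X\to\mathbb{I}$, $\mathrm{ev}_X^\tau=\mathrm{ev}_X\circ\tau_{X,X^\vee}$, $i_X:X\to X^{\vee\vee}$ the canonical map. Rigid: $i_X$ and the canonical maps $\bigotimes\hom(X_i,Y_i)\to\hom(\bigotimes X_i,\bigotimes Y_i)$ are isomorphisms. $\alpha_{X,Y}:Y\otimes X^\vee\to\hom(X,Y)$ is the canonical isomorphism corresponding to $1_Y\otimes\mathrm{ev}_X$. $C_X:\mathbb{I}\to X\otimes X^\vee$ is the coevaluation (Casimir element). $\mathrm{End}(\mathbb{I})$ acts on every object. A morphism $\varphi:P\otimes Q\to R$ is identified with $f:P\to\hom(Q,R)$. Internal multiplication: for $\varphi:P\otimes Q\to R$, $\varphi_{\iota}:P\otimes R^\vee\to Q^\vee$ is the unique morphism with $\mathrm{ev}_Q^\tau\circ(1_Q\otimes\varphi_\iota)\circ(\tau_{P,Q}\otimes1_{R^\vee})=\mathrm{ev}_R^\tau\circ(\varphi\otimes1_{R^\vee})$,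 and $\iota:P\to\hom(R^\vee,Q^\vee)$ is the corresponding morphism. For $\psi:P\otimes Q^\vee\to R^\vee$, with internal multiplication $\varphi_\iota:P\otimes R^{\vee\vee}\to Q^{\vee\vee}$, put $\varphi_{\iota^*}=i_Q^{-1}\circ\varphi_\iota\circ(1_P\otimes i_R):P\otimes R\to Q$, corresponding to $\iota^*:P\to\hom(R,Q)$. Let $\iota_{S,X},\iota_{X,S}$ be the internal multiplications of $\varphi_{S,X},\varphi_{X,S}$, and $\iota^*_{S^\vee,X^\vee},\iota^*_{X^\vee,S^\vee}$ the starred ones of $\varphi_{S^\vee,X^\vee},\varphi_{X^\vee,S^\vee}$. Set $D_{S,X^\vee}=\alpha^{-1}\circ\iota_{S,X}:S\to X^\vee\otimes Y^{\vee\vee}$, $D_{X,S^\vee}=\alpha^{-1}\circ\iota_{X,S}:X\to S^\vee\otimes Y^{\vee\vee}$, $D_{S^\vee,X}=\alpha^{-1}\circ\iota^*_{S^\vee,X^\vee}:S^\vee\to X\otimes Y^\vee$, $D_{X^\vee,S}=\alpha^{-1}\circ\iota^*_{X^\vee,S^\vee}:X^\vee\to S\otimes Y^\vee$. Conditions, for $(P,Q)=(S,X)$ or $(X,S)$: - $(Cas)_{\mu_{P,Q}}$: $\mu_{P,Q}\cdot C_P=(\varphi_{\iota^*_{Q^\vee,P^\vee}}\otimes\varphi_{\iota_{Q,P}})\circ\tau'\circ(C_Q\otimes C_Y)$ as morphisms $\mathbb{I}\to P\otimes P^\vee$, where $\tau':Q\otimes Q^\vee\otimes Y\otimes Y^\vee\to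 Q^\vee\otimes Y\otimes Q\otimes Y^\vee$ moves the first factor to the third place. - $(Com)_{\lambda_{P,Q}}$: $\varphi_{Q,P}\circ\tau_{P,Q}=\lambda_{P,Q}\cdot\varphi_{P,Q}$; $(Com)_{\lambda_{P^\vee,Q^\vee}}$: $\varphi_{Q^\vee,P^\vee}\circ\tau_{P^\vee,Q^\vee}=\lambda_{P^\vee,Q^\vee}\cdot\varphi_{P^\vee,Q^\vee}$. - $(Com)_{\lambda_{[P],[Q]}}$: with $[W]=W\otimes W^\vee$ and $\varphi_{[P],[Q]}=(\varphi_{P,Q}\otimes\varphi_{P^\vee,Q^\vee})\circ(1_P\otimes\tau_{P^\vee,Q}\otimes1_{Q^\vee}):[P]\otimes[Q]\to[Y]$, one has $\varphi_{[Q],[P]}\circ\tau_{[P],[Q]}=\lambda_{[P],[Q]}\cdot\varphi_{[P],[Q]}$. *)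

theory Defs
  imports "HOL-Algebra.Group"
begin

section \<open>Data of an ACU tensor category with internal homs\<close>

text \<open>
  Nothing is assumed to be strict: the associativity and unit constraints are part of the data,
  and wherever they are usually suppressed they are written out below.
\<close>

record ('o, 'a) tensor_cat =
  Obj   :: "'o set"
  Arr   :: "'a set"
  Dom   :: "'a \<Rightarrow> 'o"
  Cod   :: "'a \<Rightarrow> 'o"
  Idm   :: "'o \<Rightarrow> 'a"
  Comp  :: "'a \<Rightarrow> 'a \<Rightarrow> 'a"  (infixr \<open>\<cdot>\<index>\<close> 55)
  AddM  :: "'a \<Rightarrow> 'a \<Rightarrow> 'a"  (infixl \<open>\<oplus>\<^sub>m\<index>\<close> 60)
  ZeroM :: "'o \<Rightarrow> 'o \<Rightarrow> 'a"
  TensO :: "'o \<Rightarrow> 'o \<Rightarrow> 'o"  (infix \<open>\<otimes>\<^sub>o\<index>\<close> 70)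
  TensM :: "'a \<Rightarrow> 'a \<Rightarrow> 'a"  (infix \<open>\<otimes>\<^sub>m\<index>\<close> 70)
  Unit  :: "'o"  (\<open>\<I>\<index>\<close>)
  Asc   :: "'o \<Rightarrow> 'o \<Rightarrow> 'o \<Rightarrow> 'a"
    \<comment> \<open>\<open>(X \<otimes> Y) \<otimes> Z \<rightarrow> X \<otimes> (Y \<otimes> Z)\<close>\<close>
  Lun   :: "'o \<Rightarrow> 'a"  \<comment> \<open>\<open>\<I> \<otimes> X \<rightarrow> X\<close>\<close>
  Run   :: "'o \<Rightarrow> 'a"  \<comment> \<open>\<open>X \<otimes> \<I> \<rightarrow> X\<close>\<close>
  Sym   :: "'o \<Rightarrow> 'o \<Rightarrow> 'a"  (\<open>\<tau>\<index>\<close>)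
  IHom  :: "'o \<Rightarrow> 'o \<Rightarrow> 'o"
  Ev    :: "'o \<Rightarrow> 'o \<Rightarrow> 'a"  \<comment> \<open>\<open>hom(X,Y) \<otimes> X \<rightarrow> Y\<close>\<close>

definition Hom :: "('o, 'a) tensor_cat \<Rightarrow> 'o \<Rightarrow> 'o \<Rightarrow> 'a set"
  where "Hom C X Y = {f \<in> Arr C. Dom C f = X \<and> Cod C f = Y}"

definition is_inverse :: "('o, 'a) tensor_cat \<Rightarrow> 'a \<Rightarrow> 'a \<Rightarrow> bool"
  where "is_inverse C f g \<longleftrightarrow> g \<in> Hom C (Cod C f) (Dom C f)
           \<and> g \<cdot> f = Idm C (Dom C f) \<and> f \<cdot> g = Idm C (Cod C f)"
  for C (structure)

definition iso_arr :: "('o, 'a) tensor_cat \<Rightarrow> 'a \<Rightarrow> bool"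
  where "iso_arr C f \<longleftrightarrow> f \<in> Arr C \<and> (\<exists>g. is_inverse C f g)"

definition inv_arr :: "('o, 'a) tensor_cat \<Rightarrow> 'a \<Rightarrow> 'a"
  where "inv_arr C f = (THE g. is_inverse C f g)"

definition Hom_group :: "('o, 'a) tensor_cat \<Rightarrow> 'o \<Rightarrow> 'o \<Rightarrow> 'a monoid"
  where "Hom_group C X Y =
    \<lparr>carrier = Hom C X Y, monoid.mult = AddM C, one = ZeroM C X Y\<rparr>"


section \<open>Additive categories\<close>

locale category =
  fixes C :: "('o, 'a) tensor_cat" (structure)
  assumes Dom_Obj: "f \<in> Arr C \<Longrightarrow> Dom C f \<in> Obj C"
    and Cod_Obj: "f \<in> Arr C \<Longrightarrow> Cod C f \<in> Obj C"
    and Id_Hom: "X \<in> Obj C \<Longrightarrow> Idm C X \<in> Hom C X X"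
    and Comp_Hom: "\<lbrakk>f \<in> Hom C X Y; g \<in> Hom C Y Z\<rbrakk> \<Longrightarrow> g \<cdot> f \<in> Hom C X Z"
    and Comp_Id_left: "f \<in> Hom C X Y \<Longrightarrow> Idm C Y \<cdot> f = f"
    and Comp_Id_right: "f \<in> Hom C X Y \<Longrightarrow> f \<cdot> Idm C X = f"
    and Comp_assoc: "\<lbrakk>f \<in> Hom C W X; g \<in> Hom C X Y; h \<in> Hom C Y Z\<rbrakk>
          \<Longrightarrow> (h \<cdot> g) \<cdot> f = h \<cdot> (g \<cdot> f)"

locale additive_category = category +
  assumes Hom_comm_group: "\<lbrakk>X \<in> Obj C; Y \<in> Obj C\<rbrakk> \<Longrightarrow> comm_group (Hom_group C X Y)"
    and Comp_add_left: "\<lbrakk>f \<in> Hom C X Y; g \<in> Hom C Y Z; h \<in> Hom C Y Z\<rbrakk>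
          \<Longrightarrow> (g \<oplus>\<^sub>m h) \<cdot> f = (g \<cdot> f) \<oplus>\<^sub>m (h \<cdot> f)"
    and Comp_add_right: "\<lbrakk>f \<in> Hom C X Y; g \<in> Hom C X Y; h \<in> Hom C Y Z\<rbrakk>
          \<Longrightarrow> h \<cdot> (f \<oplus>\<^sub>m g) = (h \<cdot> f) \<oplus>\<^sub>m (h \<cdot> g)"
    and zero_object: "\<exists>Z \<in> Obj C. \<forall>X \<in> Obj C.
          (\<exists>!f. f \<in> Hom C X Z) \<and> (\<exists>!f. f \<in> Hom C Z X)"
    and biproduct: "\<lbrakk>X \<in> Obj C; Y \<in> Obj C\<rbrakk> \<Longrightarrow>
          \<exists>B \<in> Obj C. \<exists>i \<in> Hom C X B. \<exists>j \<in> Hom C Y B.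
            \<exists>p \<in> Hom C B X. \<exists>q \<in> Hom C B Y.
              p \<cdot> i = Idm C X \<and> q \<cdot> j = Idm C Y
              \<and> q \<cdot> i = ZeroM C X Y \<and> p \<cdot> j = ZeroM C Y X
              \<and> (i \<cdot> p) \<oplus>\<^sub>m (j \<cdot> q) = Idm C B"


section \<open>Symmetric monoidal structure\<close>

locale monoidal_category = category +
  assumes Unit_Obj: "\<I> \<in> Obj C"
    and TensO_Obj: "\<lbrakk>X \<in> Obj C; Y \<in> Obj C\<rbrakk> \<Longrightarrow> X \<otimes>\<^sub>o Y \<in> Obj C"
    and TensM_Hom: "\<lbrakk>f \<in> Hom C X X'; g \<in> Hom C Y Y'\<rbrakk>
          \<Longrightarrow> f \<otimes>\<^sub>m g \<in> Hom C (X \<otimes>\<^sub>o Y) (X' \<otimes>\<^sub>o Y')"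
    and TensM_Id: "\<lbrakk>X \<in> Obj C; Y \<in> Obj C\<rbrakk>
          \<Longrightarrow> Idm C X \<otimes>\<^sub>m Idm C Y = Idm C (X \<otimes>\<^sub>o Y)"
    and TensM_Comp: "\<lbrakk>f \<in> Hom C X X'; f' \<in> Hom C X' X''; g \<in> Hom C Y Y'; g' \<in> Hom C Y' Y''\<rbrakk>
          \<Longrightarrow> (f' \<cdot> f) \<otimes>\<^sub>m (g' \<cdot> g) = (f' \<otimes>\<^sub>m g') \<cdot> (f \<otimes>\<^sub>m g)"
    and Asc_Hom: "\<lbrakk>X \<in> Obj C; Y \<in> Obj C; Z \<in> Obj C\<rbrakk>
          \<Longrightarrow> Asc C X Y Z \<in> Hom C ((X \<otimes>\<^sub>o Y) \<otimes>\<^sub>o Z) (X \<otimes>\<^sub>o (Y \<otimes>\<^sub>o Z))"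
    and Asc_iso: "\<lbrakk>X \<in> Obj C; Y \<in> Obj C; Z \<in> Obj C\<rbrakk> \<Longrightarrow> iso_arr C (Asc C X Y Z)"
    and Asc_natural: "\<lbrakk>f \<in> Hom C X X'; g \<in> Hom C Y Y'; h \<in> Hom C Z Z'\<rbrakk>
          \<Longrightarrow> Asc C X' Y' Z' \<cdot> ((f \<otimes>\<^sub>m g) \<otimes>\<^sub>m h) = (f \<otimes>\<^sub>m (g \<otimes>\<^sub>m h)) \<cdot> Asc C X Y Z"
    and Lun_Hom: "X \<in> Obj C \<Longrightarrow> Lun C X \<in> Hom C (\<I> \<otimes>\<^sub>o X) X"
    and Lun_iso: "X \<in> Obj C \<Longrightarrow> iso_arr C (Lun C X)"
    and Lun_natural: "f \<in> Hom C X Y \<Longrightarrow> Lun C Y \<cdot> (Idm C \<I> \<otimes>\<^sub>m f) = f \<cdot> Lun C X"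
    and Run_Hom: "X \<in> Obj C \<Longrightarrow> Run C X \<in> Hom C (X \<otimes>\<^sub>o \<I>) X"
    and Run_iso: "X \<in> Obj C \<Longrightarrow> iso_arr C (Run C X)"
    and Run_natural: "f \<in> Hom C X Y \<Longrightarrow> Run C Y \<cdot> (f \<otimes>\<^sub>m Idm C \<I>) = f \<cdot> Run C X"
    and pentagon: "\<lbrakk>W \<in> Obj C; X \<in> Obj C; Y \<in> Obj C; Z \<in> Obj C\<rbrakk> \<Longrightarrow>
          Asc C W X (Y \<otimes>\<^sub>o Z) \<cdot> Asc C (W \<otimes>\<^sub>o X) Y Z
          = (Idm C W \<otimes>\<^sub>m Asc C X Y Z) \<cdot> Asc C W (X \<otimes>\<^sub>o Y) Z \<cdot> (Asc C W X Y \<otimes>\<^sub>m Idm C Z)"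
    and triangle: "\<lbrakk>X \<in> Obj C; Y \<in> Obj C\<rbrakk> \<Longrightarrow>
          (Idm C X \<otimes>\<^sub>m Lun C Y) \<cdot> Asc C X \<I> Y = Run C X \<otimes>\<^sub>m Idm C Y"

locale symmetric_monoidal_category = monoidal_category +
  assumes Sym_Hom: "\<lbrakk>X \<in> Obj C; Y \<in> Obj C\<rbrakk> \<Longrightarrow> \<tau> X Y \<in> Hom C (X \<otimes>\<^sub>o Y) (Y \<otimes>\<^sub>o X)"
    and Sym_natural: "\<lbrakk>f \<in> Hom C X X'; g \<in> Hom C Y Y'\<rbrakk>
          \<Longrightarrow> \<tau> X' Y' \<cdot> (f \<otimes>\<^sub>m g) = (g \<otimes>\<^sub>m f) \<cdot> \<tau> X Y"
    and Sym_Sym: "\<lbrakk>X \<in> Obj C; Y \<in> Obj C\<rbrakk> \<Longrightarrow> \<tau> Y X \<cdot> \<tau> X Y = Idm C (X \<otimes>\<^sub>o Y)"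
    and hexagon: "\<lbrakk>X \<in> Obj C; Y \<in> Obj C; Z \<in> Obj C\<rbrakk> \<Longrightarrow>
          Asc C Y Z X \<cdot> \<tau> X (Y \<otimes>\<^sub>o Z) \<cdot> Asc C X Y Z
          = (Idm C Y \<otimes>\<^sub>m \<tau> X Z) \<cdot> Asc C Y X Z \<cdot> (\<tau> X Y \<otimes>\<^sub>m Idm C Z)"

text \<open>
  The two permutations of four factors that are needed, with their associativity constraints:
  \<open>mid_swap\<close> exchanges the two middle factors, \<open>first_to_third\<close> moves the first factor to the
  third place.
\<close>

definition mid_swap :: "('o, 'a) tensor_cat \<Rightarrow> 'o \<Rightarrow> 'o \<Rightarrow> 'o \<Rightarrow> 'o \<Rightarrow> 'a"
    \<comment> \<open>\<open>(V \<otimes> W) \<otimes> (X \<otimes> Y) \<rightarrow> (V \<otimes> X) \<otimes> (W \<otimes> Y)\<close>\<close>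
  where "mid_swap C V W X Y =
    inv_arr C (Asc C V X (W \<otimes>\<^sub>o Y))
    \<cdot> (Idm C V \<otimes>\<^sub>m (Asc C X W Y \<cdot> (\<tau> W X \<otimes>\<^sub>m Idm C Y) \<cdot> inv_arr C (Asc C W X Y)))
    \<cdot> Asc C V W (X \<otimes>\<^sub>o Y)"
  for C (structure)

definition first_to_third :: "('o, 'a) tensor_cat \<Rightarrow> 'o \<Rightarrow> 'o \<Rightarrow> 'o \<Rightarrow> 'o \<Rightarrow> 'a"
    \<comment> \<open>\<open>(V \<otimes> W) \<otimes> (X \<otimes> Y) \<rightarrow> (W \<otimes> X) \<otimes> (V \<otimes> Y)\<close>\<close>
  where "first_to_third C V W X Y =
    Asc C (W \<otimes>\<^sub>o X) V Y
    \<cdot> (\<tau> V (W \<otimes>\<^sub>o X) \<otimes>\<^sub>m Idm C Y)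
    \<cdot> (Asc C V W X \<otimes>\<^sub>m Idm C Y)
    \<cdot> inv_arr C (Asc C (V \<otimes>\<^sub>o W) X Y)"
  for C (structure)

text \<open>
  \<open>\<mu> \<in> End(\<I>)\<close> acts on \<open>X\<close> by \<open>X \<cong> \<I> \<otimes> X \<rightarrow> \<I> \<otimes> X \<cong> X\<close>, and on a morphism by composition
  with its action on the target.
\<close>

definition unit_act :: "('o, 'a) tensor_cat \<Rightarrow> 'a \<Rightarrow> 'o \<Rightarrow> 'a"
  where "unit_act C \<mu> X = Lun C X \<cdot> (\<mu> \<otimes>\<^sub>m Idm C X) \<cdot> inv_arr C (Lun C X)"
  for C (structure)

definition scal :: "('o, 'a) tensor_cat \<Rightarrow> 'a \<Rightarrow> 'a \<Rightarrow> 'a"  (infixr \<open>\<odot>\<index>\<close> 52)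
  where "\<mu> \<odot> f = unit_act C \<mu> (Cod C f) \<cdot> f"
  for C (structure)


section \<open>Internal homs, duals and rigidity\<close>

definition curry_arr :: "('o, 'a) tensor_cat \<Rightarrow> 'o \<Rightarrow> 'o \<Rightarrow> 'o \<Rightarrow> 'a \<Rightarrow> 'a"
    \<comment> \<open>the morphism \<open>P \<rightarrow> hom(Q,R)\<close> corresponding to \<open>\<phi> : P \<otimes> Q \<rightarrow> R\<close>\<close>
  where "curry_arr C P Q R \<phi> =
    (THE f. f \<in> Hom C P (IHom C Q R) \<and> Ev C Q R \<cdot> (f \<otimes>\<^sub>m Idm C Q) = \<phi>)"
  for C (structure)

definition dual :: "('o, 'a) tensor_cat \<Rightarrow> 'o \<Rightarrow> 'o"  (\<open>_\<^sup>\<or>\<index>\<close> [1000] 1000)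
  where "X\<^sup>\<or> = IHom C X \<I>"
  for C (structure)

definition ev :: "('o, 'a) tensor_cat \<Rightarrow> 'o \<Rightarrow> 'a"  \<comment> \<open>\<open>X\<^sup>\<or> \<otimes> X \<rightarrow> \<I>\<close>\<close>
  where "ev C X = Ev C X \<I>"
  for C (structure)

definition evt :: "('o, 'a) tensor_cat \<Rightarrow> 'o \<Rightarrow> 'a"  \<comment> \<open>\<open>X \<otimes> X\<^sup>\<or> \<rightarrow> \<I>\<close>\<close>
  where "evt C X = ev C X \<cdot> \<tau> X (X\<^sup>\<or>)"
  for C (structure)

definition bidual_map :: "('o, 'a) tensor_cat \<Rightarrow> 'o \<Rightarrow> 'a"
    \<comment> \<open>\<open>i_X : X \<rightarrow> X\<^sup>\<or>\<^sup>\<or>\<close>\<close>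
  where "bidual_map C X = curry_arr C X (X\<^sup>\<or>) \<I> (evt C X)"
  for C (structure)

text \<open>
  Tensor products of finite families are bracketed to the right.  \<open>ev_list\<close> is the composite
  \<open>(\<Otimes> hom(X\<^sub>i,Y\<^sub>i)) \<otimes> (\<Otimes> X\<^sub>i) \<cong> \<Otimes> (hom(X\<^sub>i,Y\<^sub>i) \<otimes> X\<^sub>i) \<rightarrow> \<Otimes> Y\<^sub>i\<close>.
\<close>

fun tens_list :: "('o, 'a) tensor_cat \<Rightarrow> 'o list \<Rightarrow> 'o"
  where
    "tens_list C [] = \<I>\<^bsub>C\<^esub>"
  | "tens_list C [X] = X"
  | "tens_list C (X # Y # Zs) = X \<otimes>\<^sub>o\<^bsub>C\<^esub> tens_list C (Y # Zs)"

definition ihom_list :: "('o, 'a) tensor_cat \<Rightarrow> ('o \<times> 'o) list \<Rightarrow> 'o"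
  where "ihom_list C XYs = tens_list C (map (\<lambda>(X, Y). IHom C X Y) XYs)"

fun ev_list :: "('o, 'a) tensor_cat \<Rightarrow> ('o \<times> 'o) list \<Rightarrow> 'a"
  where
    "ev_list C [] = Lun C \<I>\<^bsub>C\<^esub>"
  | "ev_list C [(X, Y)] = Ev C X Y"
  | "ev_list C ((X, Y) # p # ps) =
      (Ev C X Y \<otimes>\<^sub>m\<^bsub>C\<^esub> ev_list C (p # ps))
      \<cdot>\<^bsub>C\<^esub> mid_swap C (IHom C X Y) (ihom_list C (p # ps)) X (tens_list C (map fst (p # ps)))"

definition ihom_tens_map :: "('o, 'a) tensor_cat \<Rightarrow> ('o \<times> 'o) list \<Rightarrow> 'a"
    \<comment> \<open>\<open>\<Otimes> hom(X\<^sub>i,Y\<^sub>i) \<rightarrow> hom(\<Otimes> X\<^sub>i, \<Otimes> Y\<^sub>i)\<close>\<close>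
  where "ihom_tens_map C XYs =
    curry_arr C (ihom_list C XYs) (tens_list C (map fst XYs)) (tens_list C (map snd XYs))
      (ev_list C XYs)"

locale ACU_tensor_category = additive_category + symmetric_monoidal_category +
  assumes TensM_add_left: "\<lbrakk>f \<in> Hom C X X'; g \<in> Hom C X X'; h \<in> Hom C Y Y'\<rbrakk>
          \<Longrightarrow> (f \<oplus>\<^sub>m g) \<otimes>\<^sub>m h = (f \<otimes>\<^sub>m h) \<oplus>\<^sub>m (g \<otimes>\<^sub>m h)"
    and TensM_add_right: "\<lbrakk>f \<in> Hom C X X'; g \<in> Hom C Y Y'; h \<in> Hom C Y Y'\<rbrakk>
          \<Longrightarrow> f \<otimes>\<^sub>m (g \<oplus>\<^sub>m h) = (f \<otimes>\<^sub>m g) \<oplus>\<^sub>m (f \<otimes>\<^sub>m h)"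
    and IHom_Obj: "\<lbrakk>X \<in> Obj C; Y \<in> Obj C\<rbrakk> \<Longrightarrow> IHom C X Y \<in> Obj C"
    and Ev_Hom: "\<lbrakk>X \<in> Obj C; Y \<in> Obj C\<rbrakk> \<Longrightarrow> Ev C X Y \<in> Hom C (IHom C X Y \<otimes>\<^sub>o X) Y"
    and Ev_universal: "\<lbrakk>T \<in> Obj C; X \<in> Obj C; Y \<in> Obj C; \<phi> \<in> Hom C (T \<otimes>\<^sub>o X) Y\<rbrakk>
          \<Longrightarrow> \<exists>!f. f \<in> Hom C T (IHom C X Y) \<and> Ev C X Y \<cdot> (f \<otimes>\<^sub>m Idm C X) = \<phi>"

locale rigid_ACU_tensor_category = ACU_tensor_category +
  assumes bidual_map_iso: "X \<in> Obj C \<Longrightarrow> iso_arr C (bidual_map C X)"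
    and ihom_tens_map_iso:
      "set XYs \<subseteq> Obj C \<times> Obj C \<Longrightarrow> iso_arr C (ihom_tens_map C XYs)"


section \<open>Casimir elements and internal multiplication\<close>

definition alpha :: "('o, 'a) tensor_cat \<Rightarrow> 'o \<Rightarrow> 'o \<Rightarrow> 'a"
    \<comment> \<open>\<open>Y \<otimes> X\<^sup>\<or> \<rightarrow> hom(X,Y)\<close>, corresponding to \<open>1\<^sub>Y \<otimes> ev\<^sub>X\<close>\<close>
  where "alpha C X Y =
    curry_arr C (Y \<otimes>\<^sub>o X\<^sup>\<or>) X Y (Run C Y \<cdot> (Idm C Y \<otimes>\<^sub>m ev C X) \<cdot> Asc C Y (X\<^sup>\<or>) X)"
  for C (structure)

definition casimir :: "('o, 'a) tensor_cat \<Rightarrow> 'o \<Rightarrow> 'a"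
    \<comment> \<open>\<open>\<I> \<rightarrow> hom(X,X) \<cong> X \<otimes> X\<^sup>\<or>\<close>, the first map corresponding to \<open>\<I> \<otimes> X \<cong> X\<close>\<close>
  where "casimir C X = inv_arr C (alpha C X X) \<cdot> curry_arr C \<I> X X (Lun C X)"
  for C (structure)

definition imult :: "('o, 'a) tensor_cat \<Rightarrow> 'o \<Rightarrow> 'o \<Rightarrow> 'o \<Rightarrow> 'a \<Rightarrow> 'a"
    \<comment> \<open>\<open>\<phi>\<^sub>\<iota> : P \<otimes> R\<^sup>\<or> \<rightarrow> Q\<^sup>\<or>\<close> for \<open>\<phi> : P \<otimes> Q \<rightarrow> R\<close>\<close>
  where "imult C P Q R \<phi> =
    (THE \<psi>. \<psi> \<in> Hom C (P \<otimes>\<^sub>o R\<^sup>\<or>) (Q\<^sup>\<or>) \<and>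
      evt C Q \<cdot> (Idm C Q \<otimes>\<^sub>m \<psi>) \<cdot> Asc C Q P (R\<^sup>\<or>) \<cdot> (\<tau> P Q \<otimes>\<^sub>m Idm C (R\<^sup>\<or>))
      = evt C R \<cdot> (\<phi> \<otimes>\<^sub>m Idm C (R\<^sup>\<or>)))"
  for C (structure)

definition imult_star :: "('o, 'a) tensor_cat \<Rightarrow> 'o \<Rightarrow> 'o \<Rightarrow> 'o \<Rightarrow> 'a \<Rightarrow> 'a"
    \<comment> \<open>\<open>P \<otimes> R \<rightarrow> Q\<close> for \<open>\<psi> : P \<otimes> Q\<^sup>\<or> \<rightarrow> R\<^sup>\<or>\<close>\<close>
  where "imult_star C P Q R \<psi> =
    inv_arr C (bidual_map C Q) \<cdot> imult C P (Q\<^sup>\<or>) (R\<^sup>\<or>) \<psi> \<cdot> (Idm C P \<otimes>\<^sub>m bidual_map C R)"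
  for C (structure)

text \<open>
  \<open>D_map C P Q R \<phi>\<close> is \<open>D\<^bsub>P,Q\<^sup>\<or>\<^esub>\<close> for \<open>\<phi> : P \<otimes> Q \<rightarrow> R\<close>, and \<open>D_star C P Q R \<psi>\<close> is
  \<open>D\<^bsub>P,Q\<^esub>\<close> for \<open>\<psi> : P \<otimes> Q\<^sup>\<or> \<rightarrow> R\<^sup>\<or>\<close>.
\<close>

definition D_map :: "('o, 'a) tensor_cat \<Rightarrow> 'o \<Rightarrow> 'o \<Rightarrow> 'o \<Rightarrow> 'a \<Rightarrow> 'a"
    \<comment> \<open>\<open>P \<rightarrow> Q\<^sup>\<or> \<otimes> R\<^sup>\<or>\<^sup>\<or>\<close>\<close>
  where "D_map C P Q R \<phi> =
    inv_arr C (alpha C (R\<^sup>\<or>) (Q\<^sup>\<or>)) \<cdot> curry_arr C P (R\<^sup>\<or>) (Q\<^sup>\<or>) (imult C P Q R \<phi>)"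
  for C (structure)

definition D_star :: "('o, 'a) tensor_cat \<Rightarrow> 'o \<Rightarrow> 'o \<Rightarrow> 'o \<Rightarrow> 'a \<Rightarrow> 'a"
    \<comment> \<open>\<open>P \<rightarrow> Q \<otimes> R\<^sup>\<or>\<close>\<close>
  where "D_star C P Q R \<psi> =
    inv_arr C (alpha C R Q) \<cdot> curry_arr C P R Q (imult_star C P Q R \<psi>)"
  for C (structure)


section \<open>The conditions (Cas) and (Com)\<close>

text \<open>
  In \<open>Cas\<close>, \<open>\<phi> = \<phi>\<^bsub>Q,P\<^esub> : Q \<otimes> P \<rightarrow> Y\<close> and
  \<open>\<psi> = \<phi>\<^bsub>Q\<^sup>\<or>,P\<^sup>\<or>\<^esub> : Q\<^sup>\<or> \<otimes> P\<^sup>\<or> \<rightarrow> Y\<^sup>\<or>\<close>; note the order of \<open>P\<close> and \<open>Q\<close>.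
\<close>

definition Cas :: "('o, 'a) tensor_cat \<Rightarrow> 'o \<Rightarrow> 'o \<Rightarrow> 'o \<Rightarrow> 'a \<Rightarrow> 'a \<Rightarrow> 'a \<Rightarrow> bool"
  where "Cas C P Q Y \<phi> \<psi> \<mu> \<longleftrightarrow>
    \<mu> \<odot> casimir C P =
      (imult_star C (Q\<^sup>\<or>) P Y \<psi> \<otimes>\<^sub>m imult C Q P Y \<phi>)
      \<cdot> first_to_third C Q (Q\<^sup>\<or>) Y (Y\<^sup>\<or>)
      \<cdot> (casimir C Q \<otimes>\<^sub>m casimir C Y)
      \<cdot> inv_arr C (Lun C \<I>)"
  for C (structure)

definition Com :: "('o, 'a) tensor_cat \<Rightarrow> 'o \<Rightarrow> 'o \<Rightarrow> 'a \<Rightarrow> 'a \<Rightarrow> 'a \<Rightarrow> bool"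
    \<comment> \<open>for \<open>\<phi> : P \<otimes> Q \<rightarrow> R\<close> and \<open>\<phi>' : Q \<otimes> P \<rightarrow> R\<close>\<close>
  where "Com C P Q \<phi> \<phi>' l \<longleftrightarrow> \<phi>' \<cdot> \<tau> P Q = l \<odot> \<phi>"
  for C (structure)

definition bracket :: "('o, 'a) tensor_cat \<Rightarrow> 'o \<Rightarrow> 'o"
  where "bracket C W = W \<otimes>\<^sub>o W\<^sup>\<or>"
  for C (structure)

definition bracket_map :: "('o, 'a) tensor_cat \<Rightarrow> 'o \<Rightarrow> 'o \<Rightarrow> 'a \<Rightarrow> 'a \<Rightarrow> 'a"
    \<comment> \<open>\<open>\<phi>\<^bsub>[P],[Q]\<^esub> : [P] \<otimes> [Q] \<rightarrow> [Y]\<close> from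
        \<open>\<phi> : P \<otimes> Q \<rightarrow> Y\<close> and \<open>\<psi> : P\<^sup>\<or> \<otimes> Q\<^sup>\<or> \<rightarrow> Y\<^sup>\<or>\<close>\<close>
  where "bracket_map C P Q \<phi> \<psi> = (\<phi> \<otimes>\<^sub>m \<psi>) \<cdot> mid_swap C P (P\<^sup>\<or>) Q (Q\<^sup>\<or>)"
  for C (structure)

end

(*
  In index notation, write a, b, c, d for the structure constants of phi_SX, phi_XS, phi_SvXv and
  phi_XvSv.  Then F is the matrix  sum_{x,y} a_{s'x}^y d_y^{xs},  and (Cas)_{mu_SX} says that
  sum_{x,y} b_{xs'}^y d_y^{xs} = mu_SX delta.  Contracting (Com)_{lambda_[S],[X]}, which reads
  b d = lambda a c, along Y and X replaces the second sum by lambda sum a c, and (Com) for the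
  dual pair exchanges c and d.  Part (B) is the same computation, with (Com) for the pair (S,X)
  exchanging a and b.

  Since the category is not strict, every diagram is brought to a form where all tensor products
  are bracketed to the right: pairings, copairings and transpositions act on the first factors of
  such a product (cap, cup, front_swap), and the coherence needed is that these are natural in,
  and compatible with tensoring, the remaining factor.
*)

theory Submission
  imports Defs
begin

text \<open>Casimir elements and the maps D are defined through inverses of \<open>alpha\<close> and
  of the bidual maps, none of which is explicit. \<open>dual_transpose_unique\<close>,
  \<open>D_map_eq\<close> and \<open>D_star_eq\<close> replace them by formulas that can be checked
  by evaluation. Rigidity enters through the invertibility of \<open>bidual_map\<close>, which makes
  \<open>evt\<close> nondegenerate, and through that of \<open>alpha\<close>. Endomorphisms of S and
  of its dual are compared as pairings of S with its dual, through the single expression W =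
  \<open>contraction S X Y\<close>. With b' and c' for b and c precomposed with \<tau>, the pair
  (a,d) gives the operator of (A), (b',c') the operator of the exchanged (B), (b',d) is computed by
  (Cas), and the bracketed (Com) relates it to (a,c'). The resulting equation \<lambda> W(a,c') =
  \<mu> evt serves both operators, so (A) and the exchanged (B) are proved together and the other
  two claims follow by exchanging S and X. No scalar is ever cancelled; this is why scalars remain
  on both sides of the conclusions.\<close>

context category
begin

section \<open>Typing, composition and inverses in a category\<close>

lemma arr_Hom: "f \<in> Arr C \<Longrightarrow> f \<in> Hom C (Dom C f) (Cod C f)"
  by (simp add: Hom_def)

lemma HomD:
  assumes "f \<in> Hom C X Y"
  shows "f \<in> Arr C" "Dom C f = X" "Cod C f = Y"
  using assms by (simp_all add: Hom_def)

lemma HomI: "f \<in> Arr C \<Longrightarrow> Dom C f = X \<Longrightarrow> Cod C f = Y \<Longrightarrow> f \<in> Hom C X Y"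
  by (simp add: Hom_def)

lemmas Dom_Cod_Obj [simp] = Dom_Obj Cod_Obj

lemma Idm_arr [simp]:
  assumes "X \<in> Obj C"
  shows "Idm C X \<in> Arr C" "Dom C (Idm C X) = X" "Cod C (Idm C X) = X"
  using Id_Hom[OF assms] by (simp_all add: Hom_def)

lemma comp_arr [simp]:
  assumes "f \<in> Arr C" "g \<in> Arr C" "Dom C g = Cod C f"
  shows "g \<cdot> f \<in> Arr C" "Dom C (g \<cdot> f) = Dom C f" "Cod C (g \<cdot> f) = Cod C g"
  using Comp_Hom[of f "Dom C f" "Cod C f" g "Cod C g"] assms by (simp_all add: Hom_def)

lemma comp_id_left [simp]: "f \<in> Arr C \<Longrightarrow> Cod C f = Y \<Longrightarrow> Idm C Y \<cdot> f = f"
  using Comp_Id_left by (auto simp: Hom_def)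

lemma comp_id_right [simp]: "f \<in> Arr C \<Longrightarrow> Dom C f = X \<Longrightarrow> f \<cdot> Idm C X = f"
  using Comp_Id_right by (auto simp: Hom_def)

lemma comp_assoc [simp]:
  "\<lbrakk>f \<in> Arr C; g \<in> Arr C; h \<in> Arr C; Dom C g = Cod C f; Dom C h = Cod C g\<rbrakk>
    \<Longrightarrow> (h \<cdot> g) \<cdot> f = h \<cdot> (g \<cdot> f)"
  using Comp_assoc[of f _ _ g _ h] by (simp add: Hom_def)

text \<open>Simplification nests all composites to the right, so the left side of an equation
  \<open>g \<cdot> f = k\<close> usually occurs with a tail \<open>h\<close>. This form rewrites it
  there; \<open>reassoc3\<close> does the same for three factors.\<close>

lemma reassoc:
  assumes "g \<cdot> f = k" "f \<in> Arr C" "g \<in> Arr C" "Dom C g = Cod C f" "h \<in> Arr C" "Cod C h = Dom C f"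
  shows "g \<cdot> f \<cdot> h = k \<cdot> h"
  using assms comp_assoc[of h f g] by simp

lemma reassoc3:
  assumes "g \<cdot> f \<cdot> e = k" "e \<in> Arr C" "f \<in> Arr C" "g \<in> Arr C"
    "Dom C g = Cod C f" "Dom C f = Cod C e" "h \<in> Arr C" "Cod C h = Dom C e"
  shows "g \<cdot> f \<cdot> e \<cdot> h = k \<cdot> h"
  using assms by (simp flip: assms(1))

lemma is_inverse_unique:
  assumes "f \<in> Arr C" "is_inverse C f g" "is_inverse C f h"
  shows "g = h"
proof -
  have g: "g \<in> Arr C" "Dom C g = Cod C f" "Cod C g = Dom C f" "g \<cdot> f = Idm C (Dom C f)"
    and h: "h \<in> Arr C" "Dom C h = Cod C f" "Cod C h = Dom C f" "f \<cdot> h = Idm C (Cod C f)"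
    using assms by (simp_all add: is_inverse_def Hom_def)
  have "g = g \<cdot> (f \<cdot> h)" using g h(4) by simp
  also have "\<dots> = (g \<cdot> f) \<cdot> h" by (rule comp_assoc[symmetric]) (use assms(1) g h in auto)
  also have "\<dots> = h" using g(4) h assms(1) by (simp del: comp_assoc)
  finally show ?thesis .
qed

lemma iso_arrI:
  assumes "f \<in> Arr C" "g \<in> Arr C" "Dom C g = Cod C f" "Cod C g = Dom C f"
    "g \<cdot> f = Idm C (Dom C f)" "f \<cdot> g = Idm C (Cod C f)"
  shows "iso_arr C f" "inv_arr C f = g"
proof -
  have "is_inverse C f g" using assms by (simp add: is_inverse_def Hom_def)
  then show "iso_arr C f" "inv_arr C f = g"
    using assms(1) is_inverse_unique by (auto simp: iso_arr_def inv_arr_def)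
qed

lemma inv_arr_inverse:
  assumes "iso_arr C f"
  shows "is_inverse C f (inv_arr C f)"
  using assms iso_arrI(2) is_inverse_unique theI'[of "is_inverse C f"]
  unfolding iso_arr_def inv_arr_def by blast

lemma iso_arr_arr: "iso_arr C f \<Longrightarrow> f \<in> Arr C"
  by (simp add: iso_arr_def)

lemma inv_arr_arr [simp]:
  assumes "iso_arr C f"
  shows "inv_arr C f \<in> Arr C" "Dom C (inv_arr C f) = Cod C f" "Cod C (inv_arr C f) = Dom C f"
    "inv_arr C f \<cdot> f = Idm C (Dom C f)" "f \<cdot> inv_arr C f = Idm C (Cod C f)"
  using inv_arr_inverse[OF assms] by (simp_all add: is_inverse_def Hom_def)

lemma inv_cancel [simp]:
  assumes "iso_arr C f" "h \<in> Arr C"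
  shows "Cod C h = Dom C f \<Longrightarrow> inv_arr C f \<cdot> f \<cdot> h = h"
    and "Cod C h = Cod C f \<Longrightarrow> f \<cdot> inv_arr C f \<cdot> h = h"
  using assms iso_arr_arr[OF assms(1)] by (simp_all flip: comp_assoc)

lemma inv_arr_iso [simp]:
  assumes "iso_arr C f"
  shows "iso_arr C (inv_arr C f)" "inv_arr C (inv_arr C f) = f"
  using iso_arrI[of "inv_arr C f" f] assms iso_arr_arr[OF assms] by auto

lemma iso_comp:
  assumes "iso_arr C f" "iso_arr C g" "Dom C g = Cod C f"
  shows "iso_arr C (g \<cdot> f)"
  by (rule iso_arrI(1)[of _ "inv_arr C f \<cdot> inv_arr C g"])
    (use assms iso_arr_arr[OF assms(1)] iso_arr_arr[OF assms(2)] in simp_all)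

lemma iso_cancel_right:
  assumes "g \<cdot> f = h \<cdot> f" "iso_arr C f" "g \<in> Arr C" "h \<in> Arr C" "Dom C g = Cod C f" "Dom C h = Cod C f"
  shows "g = h"
proof -
  have "(g \<cdot> f) \<cdot> inv_arr C f = (h \<cdot> f) \<cdot> inv_arr C f" using assms(1) by simp
  then show ?thesis using assms(2-) iso_arr_arr[OF assms(2)] by simp
qed

lemma iso_cancel_left:
  assumes "f \<cdot> g = f \<cdot> h" "iso_arr C f" "g \<in> Arr C" "h \<in> Arr C" "Cod C g = Dom C f" "Cod C h = Dom C f"
  shows "g = h"
proof -
  have "inv_arr C f \<cdot> (f \<cdot> g) = inv_arr C f \<cdot> (f \<cdot> h)" using assms(1) by simp
  then show ?thesis using assms(2-) by simp
qed

lemma iso_arr_Idm [simp]: "X \<in> Obj C \<Longrightarrow> iso_arr C (Idm C X)"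
  by (rule iso_arrI(1)[of _ "Idm C X"]) simp_all

end

section \<open>Coherence in monoidal categories\<close>

context monoidal_category
begin

lemmas monoidal_Obj [simp] = Unit_Obj TensO_Obj

lemma tens_arr [simp]:
  assumes "f \<in> Arr C" "g \<in> Arr C"
  shows "f \<otimes>\<^sub>m g \<in> Arr C" "Dom C (f \<otimes>\<^sub>m g) = Dom C f \<otimes>\<^sub>o Dom C g"
    "Cod C (f \<otimes>\<^sub>m g) = Cod C f \<otimes>\<^sub>o Cod C g"
  using TensM_Hom[OF arr_Hom arr_Hom] assms by (simp_all add: Hom_def)

lemmas tens_Idm [simp] = TensM_Id

text \<open>Oriented so that stacked tensor products merge into one tensor product of composites.
  Steps that only use the interchange law are then left to simplification.\<close>

lemma tens_comp [simp]:
  "\<lbrakk>f \<in> Arr C; f' \<in> Arr C; g \<in> Arr C; g' \<in> Arr C; Dom C f' = Cod C f; Dom C g' = Cod C g\<rbrakk>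
    \<Longrightarrow> (f' \<otimes>\<^sub>m g') \<cdot> (f \<otimes>\<^sub>m g) = (f' \<cdot> f) \<otimes>\<^sub>m (g' \<cdot> g)"
  using TensM_Comp[of f "Dom C f" "Cod C f" f' "Cod C f'" g "Dom C g" "Cod C g" g' "Cod C g'"]
  by (simp add: Hom_def)

lemma tens_comp_reassoc [simp]:
  "\<lbrakk>f \<in> Arr C; f' \<in> Arr C; g \<in> Arr C; g' \<in> Arr C; Dom C f' = Cod C f; Dom C g' = Cod C g;
    h \<in> Arr C; Cod C h = Dom C f \<otimes>\<^sub>o Dom C g\<rbrakk>
    \<Longrightarrow> (f' \<otimes>\<^sub>m g') \<cdot> (f \<otimes>\<^sub>m g) \<cdot> h = ((f' \<cdot> f) \<otimes>\<^sub>m (g' \<cdot> g)) \<cdot> h"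
  by (rule reassoc) simp_all

lemma tens_iso [simp]:
  assumes "iso_arr C f" "iso_arr C g"
  shows "iso_arr C (f \<otimes>\<^sub>m g)" "inv_arr C (f \<otimes>\<^sub>m g) = inv_arr C f \<otimes>\<^sub>m inv_arr C g"
  using iso_arrI[of "f \<otimes>\<^sub>m g" "inv_arr C f \<otimes>\<^sub>m inv_arr C g"] assms
    iso_arr_arr[OF assms(1)] iso_arr_arr[OF assms(2)] by simp_all

lemma structure_arr [simp]:
  assumes "X \<in> Obj C"
  shows "Lun C X \<in> Arr C" "Dom C (Lun C X) = \<I> \<otimes>\<^sub>o X" "Cod C (Lun C X) = X"
    "Run C X \<in> Arr C" "Dom C (Run C X) = X \<otimes>\<^sub>o \<I>" "Cod C (Run C X) = X"
    "iso_arr C (Lun C X)" "iso_arr C (Run C X)"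
  using Lun_Hom Run_Hom Lun_iso Run_iso assms by (simp_all add: Hom_def)

lemma Asc_arr [simp]:
  assumes "X \<in> Obj C" "Y \<in> Obj C" "Z \<in> Obj C"
  shows "Asc C X Y Z \<in> Arr C" "Dom C (Asc C X Y Z) = (X \<otimes>\<^sub>o Y) \<otimes>\<^sub>o Z"
    "Cod C (Asc C X Y Z) = X \<otimes>\<^sub>o (Y \<otimes>\<^sub>o Z)" "iso_arr C (Asc C X Y Z)"
  using Asc_Hom Asc_iso assms by (simp_all add: Hom_def)

lemma Asc_nat:
  assumes "f \<in> Arr C" "g \<in> Arr C" "h \<in> Arr C" "Cod C f = X'" "Cod C g = Y'" "Cod C h = Z'"
  shows "Asc C X' Y' Z' \<cdot> ((f \<otimes>\<^sub>m g) \<otimes>\<^sub>m h) = (f \<otimes>\<^sub>m (g \<otimes>\<^sub>m h)) \<cdot> Asc C (Dom C f) (Dom C g) (Dom C h)"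
  using Asc_natural assms by (auto simp: Hom_def)

abbreviation "Asc_inv X Y Z \<equiv> inv_arr C (Asc C X Y Z)"
abbreviation "Lun_inv X \<equiv> inv_arr C (Lun C X)"
abbreviation "Run_inv X \<equiv> inv_arr C (Run C X)"

text \<open>Inverting two opposite sides of a commuting square gives a commuting square; the
  naturality of all inverse constraints comes from here.\<close>

lemma inverse_square:
  assumes "a \<cdot> f = g \<cdot> b" "iso_arr C a" "iso_arr C b" "f \<in> Arr C" "g \<in> Arr C"
    "Cod C f = Dom C a" "Dom C f = Dom C b" "Dom C g = Cod C b"
  shows "f \<cdot> inv_arr C b = inv_arr C a \<cdot> g"
proof -
  have ar: "a \<in> Arr C" "b \<in> Arr C" using assms iso_arr_arr by auto
  have cod: "Cod C g = Cod C a"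
    using arg_cong[OF assms(1), of "Cod C"] assms(2-) ar by simp
  have "a \<cdot> f \<cdot> inv_arr C b = (g \<cdot> b) \<cdot> inv_arr C b"
    by (rule reassoc[OF assms(1)]) (use assms(2-) ar in simp_all)
  also have "\<dots> = a \<cdot> inv_arr C a \<cdot> g" using assms(2-) ar cod by simp
  finally show ?thesis by (rule iso_cancel_left) (use assms(2-) ar cod in simp_all)
qed

lemma Asc_inv_nat:
  assumes "f \<in> Arr C" "g \<in> Arr C" "h \<in> Arr C" "Cod C f = X'" "Cod C g = Y'" "Cod C h = Z'"
  shows "Asc_inv X' Y' Z' \<cdot> (f \<otimes>\<^sub>m (g \<otimes>\<^sub>m h)) = ((f \<otimes>\<^sub>m g) \<otimes>\<^sub>m h) \<cdot> Asc_inv (Dom C f) (Dom C g) (Dom C h)"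
  by (rule inverse_square[symmetric, OF Asc_nat]) (use assms in auto)

lemma Lun_nat: "f \<in> Arr C \<Longrightarrow> Cod C f = Y \<Longrightarrow> Lun C Y \<cdot> (Idm C \<I> \<otimes>\<^sub>m f) = f \<cdot> Lun C (Dom C f)"
  using Lun_natural by (auto simp: Hom_def)

lemma Run_nat: "f \<in> Arr C \<Longrightarrow> Cod C f = Y \<Longrightarrow> Run C Y \<cdot> (f \<otimes>\<^sub>m Idm C \<I>) = f \<cdot> Run C (Dom C f)"
  using Run_natural by (auto simp: Hom_def)

lemma Lun_inv_nat:
  "f \<in> Arr C \<Longrightarrow> Cod C f = Y \<Longrightarrow> Lun_inv Y \<cdot> f = (Idm C \<I> \<otimes>\<^sub>m f) \<cdot> Lun_inv (Dom C f)"
  by (rule inverse_square[symmetric, OF Lun_nat]) auto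

lemma Run_inv_nat:
  "f \<in> Arr C \<Longrightarrow> Cod C f = Y \<Longrightarrow> Run_inv Y \<cdot> f = (f \<otimes>\<^sub>m Idm C \<I>) \<cdot> Run_inv (Dom C f)"
  by (rule inverse_square[symmetric, OF Run_nat]) auto

text \<open>Naturality of \<open>Lun\<close> identifies tensoring with the unit with the identity
  functor. Identities between constraints may thus be proved after tensoring with \<I>, where
  pentagon and triangle apply.\<close>

lemma Unit_tens_faithful:
  assumes "Idm C \<I> \<otimes>\<^sub>m f = Idm C \<I> \<otimes>\<^sub>m g" "f \<in> Arr C" "g \<in> Arr C" "Dom C f = Dom C g" "Cod C f = Cod C g"
  shows "f = g"
proof (rule iso_cancel_right[where f = "Lun C (Dom C f)"])
  show "f \<cdot> Lun C (Dom C f) = g \<cdot> Lun C (Dom C f)"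
    using Lun_nat[of f] Lun_nat[of g] assms by metis
qed (use assms in auto)

lemma tens_Unit_faithful:
  assumes "f \<otimes>\<^sub>m Idm C \<I> = g \<otimes>\<^sub>m Idm C \<I>" "f \<in> Arr C" "g \<in> Arr C" "Dom C f = Dom C g" "Cod C f = Cod C g"
  shows "f = g"
proof (rule iso_cancel_right[where f = "Run C (Dom C f)"])
  show "f \<cdot> Run C (Dom C f) = g \<cdot> Run C (Dom C f)"
    using Run_nat[of f] Run_nat[of g] assms by metis
qed (use assms in auto)

text \<open>Kelly's argument: tensored with \<I> on the left, the claim is the pentagon on \<I>,
  \<I>, X, Y with the triangle axiom applied on both sides. The invertible remainder
  \<open>?a\<close> of the pentagon is cancelled at the end.\<close>

lemma Lun_tens:
  assumes [simp]: "X \<in> Obj C" "Y \<in> Obj C"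
  shows "Lun C (X \<otimes>\<^sub>o Y) \<cdot> Asc C \<I> X Y = Lun C X \<otimes>\<^sub>m Idm C Y"
proof (rule Unit_tens_faithful)
  let ?I = "Idm C \<I>"
  let ?a = "Asc C \<I> (\<I> \<otimes>\<^sub>o X) Y \<cdot> (Asc C \<I> \<I> X \<otimes>\<^sub>m Idm C Y)"
  have iso: "iso_arr C ?a" by (rule iso_comp) simp_all
  have "(?I \<otimes>\<^sub>m Lun C (X \<otimes>\<^sub>o Y)) \<cdot> (?I \<otimes>\<^sub>m Asc C \<I> X Y) \<cdot> ?a
      = (?I \<otimes>\<^sub>m Lun C (X \<otimes>\<^sub>o Y)) \<cdot> Asc C \<I> \<I> (X \<otimes>\<^sub>o Y) \<cdot> Asc C (\<I> \<otimes>\<^sub>o \<I>) X Y"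
    by (simp only: pentagon assms Unit_Obj)
  also have "\<dots> = (Run C \<I> \<otimes>\<^sub>m Idm C (X \<otimes>\<^sub>o Y)) \<cdot> Asc C (\<I> \<otimes>\<^sub>o \<I>) X Y"
    by (rule reassoc[OF triangle]) simp_all
  also have "\<dots> = Asc C \<I> X Y \<cdot> ((Run C \<I> \<otimes>\<^sub>m Idm C X) \<otimes>\<^sub>m Idm C Y)"
    using Asc_nat[of "Run C \<I>" "Idm C X" "Idm C Y"] by simp
  also have "\<dots> = Asc C \<I> X Y \<cdot> ((?I \<otimes>\<^sub>m Lun C X) \<otimes>\<^sub>m Idm C Y) \<cdot> (Asc C \<I> \<I> X \<otimes>\<^sub>m Idm C Y)"
    by (simp flip: triangle)
  also have "\<dots> = (?I \<otimes>\<^sub>m (Lun C X \<otimes>\<^sub>m Idm C Y)) \<cdot> ?a"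
    by (subst reassoc[OF Asc_nat]) simp_all
  finally have "(?I \<otimes>\<^sub>m (Lun C (X \<otimes>\<^sub>o Y) \<cdot> Asc C \<I> X Y)) \<cdot> ?a = (?I \<otimes>\<^sub>m (Lun C X \<otimes>\<^sub>m Idm C Y)) \<cdot> ?a"
    by simp
  then show "?I \<otimes>\<^sub>m (Lun C (X \<otimes>\<^sub>o Y) \<cdot> Asc C \<I> X Y) = ?I \<otimes>\<^sub>m (Lun C X \<otimes>\<^sub>m Idm C Y)"
    by (rule iso_cancel_right[OF _ iso]) simp_all
qed simp_all

text \<open>Mirror image of \<open>Lun_tens\<close>: the pentagon on X, Y, \<I>, \<I>, with the unit
  tensored on the right.\<close>

lemma Run_tens:
  assumes [simp]: "X \<in> Obj C" "Y \<in> Obj C"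
  shows "(Idm C X \<otimes>\<^sub>m Run C Y) \<cdot> Asc C X Y \<I> = Run C (X \<otimes>\<^sub>o Y)"
proof (rule tens_Unit_faithful)
  let ?I = "Idm C \<I>"
  have "Asc C X Y \<I> \<cdot> (((Idm C X \<otimes>\<^sub>m Run C Y) \<cdot> Asc C X Y \<I>) \<otimes>\<^sub>m ?I)
     = Asc C X Y \<I> \<cdot> ((Idm C X \<otimes>\<^sub>m Run C Y) \<otimes>\<^sub>m ?I) \<cdot> (Asc C X Y \<I> \<otimes>\<^sub>m ?I)"
    by simp
  also have "\<dots> = (Idm C X \<otimes>\<^sub>m (Run C Y \<otimes>\<^sub>m ?I)) \<cdot> Asc C X (Y \<otimes>\<^sub>o \<I>) \<I> \<cdot> (Asc C X Y \<I> \<otimes>\<^sub>m ?I)"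
    by (subst reassoc[OF Asc_nat]) simp_all
  also have "\<dots> = (Idm C X \<otimes>\<^sub>m (Idm C Y \<otimes>\<^sub>m Lun C \<I>)) \<cdot> (Idm C X \<otimes>\<^sub>m Asc C Y \<I> \<I>)
                    \<cdot> Asc C X (Y \<otimes>\<^sub>o \<I>) \<I> \<cdot> (Asc C X Y \<I> \<otimes>\<^sub>m ?I)"
    by (simp flip: triangle)
  also have "\<dots> = (Idm C X \<otimes>\<^sub>m (Idm C Y \<otimes>\<^sub>m Lun C \<I>)) \<cdot> Asc C X Y (\<I> \<otimes>\<^sub>o \<I>) \<cdot> Asc C (X \<otimes>\<^sub>o Y) \<I> \<I>"
    by (simp only: pentagon assms Unit_Obj)
  also have "\<dots> = Asc C X Y \<I> \<cdot> ((Idm C X \<otimes>\<^sub>m Idm C Y) \<otimes>\<^sub>m Lun C \<I>) \<cdot> Asc C (X \<otimes>\<^sub>o Y) \<I> \<I>"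
    by (subst reassoc[OF Asc_nat]) simp_all
  also have "\<dots> = Asc C X Y \<I> \<cdot> (Run C (X \<otimes>\<^sub>o Y) \<otimes>\<^sub>m ?I)"
    by (simp add: triangle)
  finally show "((Idm C X \<otimes>\<^sub>m Run C Y) \<cdot> Asc C X Y \<I>) \<otimes>\<^sub>m ?I = Run C (X \<otimes>\<^sub>o Y) \<otimes>\<^sub>m ?I"
    by (rule iso_cancel_left) simp_all
qed simp_all

text \<open>Naturality of \<open>Lun\<close> at the morphism \<open>Lun C \<I>\<close> shows that
  \<open>Lun\<close> at \<I> \<otimes> \<I> is the identity tensored with \<open>Lun C \<I>\<close>.
  After that, \<open>Lun_tens\<close> and the triangle axiom describe the same composite in two
  ways.\<close>

lemma Lun_Unit: "Lun C \<I> = Run C \<I>"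
proof (rule tens_Unit_faithful)
  have "Lun C (\<I> \<otimes>\<^sub>o \<I>) = Idm C \<I> \<otimes>\<^sub>m Lun C \<I>"
    by (rule iso_cancel_left[of "Lun C \<I>"]) (simp_all add: Lun_nat)
  then show "Lun C \<I> \<otimes>\<^sub>m Idm C \<I> = Run C \<I> \<otimes>\<^sub>m Idm C \<I>"
    using Lun_tens[of \<I> \<I>] triangle[of \<I> \<I>] by simp
qed simp_all

text \<open>The pentagon solved for the shape that arises when a map acting on A and B is carried
  past a factor on the right, as in \<open>cap_tens\<close>, \<open>front_swap_tens\<close> and
  \<open>cup_tens_front\<close>.\<close>

lemma pentagon_inv:
  assumes [simp]: "A \<in> Obj C" "B \<in> Obj C" "U \<in> Obj C" "R \<in> Obj C"
  shows "Asc_inv A B (U \<otimes>\<^sub>o R) \<cdot> (Idm C A \<otimes>\<^sub>m Asc C B U R) \<cdot> Asc C A (B \<otimes>\<^sub>o U) R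
      = Asc C (A \<otimes>\<^sub>o B) U R \<cdot> (Asc_inv A B U \<otimes>\<^sub>m Idm C R)"
proof (rule iso_cancel_right)
  show "(Asc_inv A B (U \<otimes>\<^sub>o R) \<cdot> (Idm C A \<otimes>\<^sub>m Asc C B U R) \<cdot> Asc C A (B \<otimes>\<^sub>o U) R) \<cdot> (Asc C A B U \<otimes>\<^sub>m Idm C R)
      = (Asc C (A \<otimes>\<^sub>o B) U R \<cdot> (Asc_inv A B U \<otimes>\<^sub>m Idm C R)) \<cdot> (Asc C A B U \<otimes>\<^sub>m Idm C R)"
    by (simp flip: pentagon)
qed simp_all

lemma Lun_inv_tens:
  assumes [simp]: "X \<in> Obj C" "Y \<in> Obj C"
  shows "Asc C \<I> X Y \<cdot> (Lun_inv X \<otimes>\<^sub>m Idm C Y) = Lun_inv (X \<otimes>\<^sub>o Y)"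
  by (rule iso_cancel_left[of "Lun C (X \<otimes>\<^sub>o Y)"]) (simp_all add: reassoc[OF Lun_tens])

lemma Run_inv_tens:
  assumes [simp]: "X \<in> Obj C" "Y \<in> Obj C"
  shows "Asc C X Y \<I> \<cdot> Run_inv (X \<otimes>\<^sub>o Y) = Idm C X \<otimes>\<^sub>m Run_inv Y"
  by (rule iso_cancel_left[of "Idm C X \<otimes>\<^sub>m Run C Y"]) (simp_all add: reassoc[OF Run_tens])

lemma triangle_inv:
  assumes [simp]: "X \<in> Obj C" "Y \<in> Obj C"
  shows "Asc C X \<I> Y \<cdot> (Run_inv X \<otimes>\<^sub>m Idm C Y) = Idm C X \<otimes>\<^sub>m Lun_inv Y"
  by (rule iso_cancel_left[of "Idm C X \<otimes>\<^sub>m Lun C Y"]) (simp_all add: reassoc[OF triangle])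

section \<open>Pairings and copairings on the first two factors\<close>

definition cap
  where "cap p A B R = Lun C R \<cdot> (p \<otimes>\<^sub>m Idm C R) \<cdot> Asc_inv A B R"

definition cup
  where "cup q A B R = Asc C A B R \<cdot> (q \<otimes>\<^sub>m Idm C R) \<cdot> Lun_inv R"

lemma cap_arr [simp]:
  assumes "p \<in> Arr C" "Dom C p = A \<otimes>\<^sub>o B" "Cod C p = \<I>" "A \<in> Obj C" "B \<in> Obj C" "R \<in> Obj C"
  shows "cap p A B R \<in> Arr C" "Dom C (cap p A B R) = A \<otimes>\<^sub>o (B \<otimes>\<^sub>o R)" "Cod C (cap p A B R) = R"
  using assms by (simp_all add: cap_def)

lemma cup_arr [simp]:
  assumes "q \<in> Arr C" "Dom C q = \<I>" "Cod C q = A \<otimes>\<^sub>o B" "A \<in> Obj C" "B \<in> Obj C" "R \<in> Obj C"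
  shows "cup q A B R \<in> Arr C" "Dom C (cup q A B R) = R" "Cod C (cup q A B R) = A \<otimes>\<^sub>o (B \<otimes>\<^sub>o R)"
  using assms by (simp_all add: cup_def)

lemma cap_nat:
  assumes [simp]: "p \<in> Arr C" "Dom C p = A \<otimes>\<^sub>o B" "Cod C p = \<I>" "A \<in> Obj C" "B \<in> Obj C"
    "g \<in> Arr C" "Cod C g = R'"
  shows "cap p A B R' \<cdot> (Idm C A \<otimes>\<^sub>m (Idm C B \<otimes>\<^sub>m g)) = g \<cdot> cap p A B (Dom C g)"
proof -
  have [simp]: "R' \<in> Obj C" using Cod_Obj[OF assms(6)] by simp
  have "cap p A B R' \<cdot> (Idm C A \<otimes>\<^sub>m (Idm C B \<otimes>\<^sub>m g))
      = Lun C R' \<cdot> (p \<otimes>\<^sub>m g) \<cdot> Asc_inv A B (Dom C g)"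
    using Asc_inv_nat[of "Idm C A" "Idm C B" g] by (simp add: cap_def)
  also have "\<dots> = Lun C R' \<cdot> (Idm C \<I> \<otimes>\<^sub>m g) \<cdot> (p \<otimes>\<^sub>m Idm C (Dom C g)) \<cdot> Asc_inv A B (Dom C g)"
    by simp
  also have "\<dots> = g \<cdot> cap p A B (Dom C g)"
    by (subst reassoc[OF Lun_nat]) (simp_all add: cap_def)
  finally show ?thesis .
qed

lemma cup_nat:
  assumes [simp]: "q \<in> Arr C" "Dom C q = \<I>" "Cod C q = A \<otimes>\<^sub>o B" "A \<in> Obj C" "B \<in> Obj C"
    "g \<in> Arr C" "Cod C g = R'"
  shows "cup q A B R' \<cdot> g = (Idm C A \<otimes>\<^sub>m (Idm C B \<otimes>\<^sub>m g)) \<cdot> cup q A B (Dom C g)"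
proof -
  have [simp]: "R' \<in> Obj C" using Cod_Obj[OF assms(6)] by simp
  have "cup q A B R' \<cdot> g = Asc C A B R' \<cdot> (q \<otimes>\<^sub>m g) \<cdot> Lun_inv (Dom C g)"
    by (simp add: cup_def Lun_inv_nat)
  also have "\<dots> = Asc C A B R' \<cdot> ((Idm C A \<otimes>\<^sub>m Idm C B) \<otimes>\<^sub>m g) \<cdot> (q \<otimes>\<^sub>m Idm C (Dom C g)) \<cdot> Lun_inv (Dom C g)"
    by simp
  also have "\<dots> = (Idm C A \<otimes>\<^sub>m (Idm C B \<otimes>\<^sub>m g)) \<cdot> cup q A B (Dom C g)"
    by (subst reassoc[OF Asc_nat]) (simp_all add: cup_def)
  finally show ?thesis .
qed

text \<open>\<open>pentagon_inv\<close> carries the brackets past \<open>p\<close>, and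
  \<open>Lun_tens\<close> removes the unit that \<open>p\<close> leaves behind. A factor standing
  outside on the right is thereby absorbed into the last argument of \<open>cap\<close>.\<close>

lemma cap_tens:
  assumes [simp]: "p \<in> Arr C" "Dom C p = A \<otimes>\<^sub>o B" "Cod C p = \<I>"
    "A \<in> Obj C" "B \<in> Obj C" "U \<in> Obj C" "R \<in> Obj C"
  shows "cap p A B (U \<otimes>\<^sub>o R) \<cdot> (Idm C A \<otimes>\<^sub>m Asc C B U R) \<cdot> Asc C A (B \<otimes>\<^sub>o U) R = cap p A B U \<otimes>\<^sub>m Idm C R"
proof -
  have "cap p A B (U \<otimes>\<^sub>o R) \<cdot> (Idm C A \<otimes>\<^sub>m Asc C B U R) \<cdot> Asc C A (B \<otimes>\<^sub>o U) R
     = Lun C (U \<otimes>\<^sub>o R) \<cdot> (p \<otimes>\<^sub>m (Idm C U \<otimes>\<^sub>m Idm C R)) \<cdot> Asc C (A \<otimes>\<^sub>o B) U R \<cdot> (Asc_inv A B U \<otimes>\<^sub>m Idm C R)"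
    by (simp add: cap_def pentagon_inv)
  also have "\<dots> = Lun C (U \<otimes>\<^sub>o R) \<cdot> Asc C \<I> U R \<cdot> ((p \<otimes>\<^sub>m Idm C U) \<otimes>\<^sub>m Idm C R) \<cdot> (Asc_inv A B U \<otimes>\<^sub>m Idm C R)"
    using reassoc[OF Asc_nat[of p "Idm C U" "Idm C R" \<I> U R], of "Asc_inv A B U \<otimes>\<^sub>m Idm C R"] by simp
  also have "\<dots> = cap p A B U \<otimes>\<^sub>m Idm C R"
    by (subst reassoc[OF Lun_tens]) (simp_all add: cap_def)
  finally show ?thesis .
qed

text \<open>Dual to \<open>cap_tens\<close>: the pentagon itself carries the brackets, and
  \<open>Lun_inv_tens\<close> supplies the unit into which \<open>q\<close> is inserted.\<close>

lemma cup_tens: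
  assumes [simp]: "q \<in> Arr C" "Dom C q = \<I>" "Cod C q = A \<otimes>\<^sub>o B"
    "A \<in> Obj C" "B \<in> Obj C" "U \<in> Obj C" "R \<in> Obj C"
  shows "(Idm C A \<otimes>\<^sub>m Asc C B U R) \<cdot> Asc C A (B \<otimes>\<^sub>o U) R \<cdot> (cup q A B U \<otimes>\<^sub>m Idm C R) = cup q A B (U \<otimes>\<^sub>o R)"
proof -
  have "(Idm C A \<otimes>\<^sub>m Asc C B U R) \<cdot> Asc C A (B \<otimes>\<^sub>o U) R \<cdot> (cup q A B U \<otimes>\<^sub>m Idm C R)
     = (Idm C A \<otimes>\<^sub>m Asc C B U R) \<cdot> Asc C A (B \<otimes>\<^sub>o U) R \<cdot> (Asc C A B U \<otimes>\<^sub>m Idm C R)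
         \<cdot> ((q \<otimes>\<^sub>m Idm C U) \<otimes>\<^sub>m Idm C R) \<cdot> (Lun_inv U \<otimes>\<^sub>m Idm C R)"
    by (simp add: cup_def)
  also have "\<dots> = (Asc C A B (U \<otimes>\<^sub>o R) \<cdot> Asc C (A \<otimes>\<^sub>o B) U R)
         \<cdot> ((q \<otimes>\<^sub>m Idm C U) \<otimes>\<^sub>m Idm C R) \<cdot> (Lun_inv U \<otimes>\<^sub>m Idm C R)"
    by (rule reassoc3[OF pentagon[symmetric]]) simp_all
  also have "\<dots> = Asc C A B (U \<otimes>\<^sub>o R) \<cdot> Asc C (A \<otimes>\<^sub>o B) U R
         \<cdot> ((q \<otimes>\<^sub>m Idm C U) \<otimes>\<^sub>m Idm C R) \<cdot> (Lun_inv U \<otimes>\<^sub>m Idm C R)"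
    by simp
  also have "\<dots> = Asc C A B (U \<otimes>\<^sub>o R) \<cdot> (q \<otimes>\<^sub>m Idm C (U \<otimes>\<^sub>o R)) \<cdot> Asc C \<I> U R \<cdot> (Lun_inv U \<otimes>\<^sub>m Idm C R)"
    by (subst reassoc[OF Asc_nat[of q "Idm C U" "Idm C R"]]) simp_all
  also have "\<dots> = cup q A B (U \<otimes>\<^sub>o R)"
    by (simp add: Lun_inv_tens cup_def)
  finally show ?thesis .
qed

text \<open>\<open>cap\<close> removes the unit with \<open>Lun\<close>, whereas
  \<open>alpha\<close> removes it with \<open>Run\<close>; \<open>Lun_Unit\<close> reconciles the
  two.\<close>

lemma cap_Unit:
  assumes [simp]: "p \<in> Arr C" "Dom C p = A \<otimes>\<^sub>o B" "Cod C p = \<I>" "A \<in> Obj C" "B \<in> Obj C"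
  shows "cap p A B \<I> = p \<cdot> (Idm C A \<otimes>\<^sub>m Run C B)"
proof -
  have "cap p A B \<I> = p \<cdot> Run C (A \<otimes>\<^sub>o B) \<cdot> Asc_inv A B \<I>"
    using reassoc[OF Run_nat[of p \<I>], of "Asc_inv A B \<I>"] by (simp add: cap_def Lun_Unit)
  also have "\<dots> = p \<cdot> (Idm C A \<otimes>\<^sub>m Run C B)"
    by (simp flip: Run_tens)
  finally show ?thesis .
qed

lemma cup_Unit:
  assumes [simp]: "q \<in> Arr C" "Dom C q = \<I>" "Cod C q = A \<otimes>\<^sub>o B" "A \<in> Obj C" "B \<in> Obj C"
  shows "cup q A B \<I> = (Idm C A \<otimes>\<^sub>m Run_inv B) \<cdot> q"
proof -
  have "cup q A B \<I> = Asc C A B \<I> \<cdot> Run_inv (A \<otimes>\<^sub>o B) \<cdot> q"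
    by (simp add: cup_def Lun_Unit Run_inv_nat)
  also have "\<dots> = (Idm C A \<otimes>\<^sub>m Run_inv B) \<cdot> q"
    by (simp add: reassoc[OF Run_inv_tens])
  finally show ?thesis .
qed

end

section \<open>Coherence in symmetric monoidal categories\<close>

context symmetric_monoidal_category
begin

lemma Sym_arr [simp]:
  assumes "X \<in> Obj C" "Y \<in> Obj C"
  shows "\<tau> X Y \<in> Arr C" "Dom C (\<tau> X Y) = X \<otimes>\<^sub>o Y" "Cod C (\<tau> X Y) = Y \<otimes>\<^sub>o X"
    "\<tau> Y X \<cdot> \<tau> X Y = Idm C (X \<otimes>\<^sub>o Y)"
  using Sym_Hom[OF assms] Sym_Sym[OF assms] by (simp_all add: Hom_def)

lemma Sym_cancel [simp]:
  assumes "X \<in> Obj C" "Y \<in> Obj C" "h \<in> Arr C" "Cod C h = X \<otimes>\<^sub>o Y"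
  shows "\<tau> Y X \<cdot> \<tau> X Y \<cdot> h = h"
  using assms by (simp add: reassoc[OF Sym_arr(4)])

lemma Sym_iso [simp]:
  assumes "X \<in> Obj C" "Y \<in> Obj C"
  shows "iso_arr C (\<tau> X Y)" "inv_arr C (\<tau> X Y) = \<tau> Y X"
  using iso_arrI[of "\<tau> X Y" "\<tau> Y X"] assms by simp_all

lemma Sym_nat:
  "\<lbrakk>f \<in> Arr C; g \<in> Arr C; Cod C f = X; Cod C g = Y\<rbrakk>
    \<Longrightarrow> \<tau> X Y \<cdot> (f \<otimes>\<^sub>m g) = (g \<otimes>\<^sub>m f) \<cdot> \<tau> (Dom C f) (Dom C g)"
  using Sym_natural by (auto simp: Hom_def)

text \<open>From the hexagon on X, \<I>, \<I>: naturality brings \<open>\<tau> X \<I>\<close> to the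
  front of both sides, and once it is cancelled the claim remains, tensored with the unit.\<close>

lemma Lun_Sym:
  assumes [simp]: "X \<in> Obj C"
  shows "Lun C X \<cdot> \<tau> X \<I> = Run C X"
proof (rule tens_Unit_faithful)
  have "\<tau> X \<I> \<cdot> (Run C X \<otimes>\<^sub>m Idm C \<I>) = \<tau> X \<I> \<cdot> (Idm C X \<otimes>\<^sub>m Lun C \<I>) \<cdot> Asc C X \<I> \<I>"
    by (simp add: triangle)
  also have "\<dots> = (Lun C \<I> \<otimes>\<^sub>m Idm C X) \<cdot> \<tau> X (\<I> \<otimes>\<^sub>o \<I>) \<cdot> Asc C X \<I> \<I>"
    by (subst reassoc[OF Sym_nat]) simp_all
  also have "\<dots> = Lun C (\<I> \<otimes>\<^sub>o X) \<cdot> Asc C \<I> \<I> X \<cdot> \<tau> X (\<I> \<otimes>\<^sub>o \<I>) \<cdot> Asc C X \<I> \<I>"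
    by (subst reassoc[OF Lun_tens]) simp_all
  also have "\<dots> = Lun C (\<I> \<otimes>\<^sub>o X) \<cdot> (Idm C \<I> \<otimes>\<^sub>m \<tau> X \<I>) \<cdot> Asc C \<I> X \<I> \<cdot> (\<tau> X \<I> \<otimes>\<^sub>m Idm C \<I>)"
    by (simp add: hexagon)
  also have "\<dots> = \<tau> X \<I> \<cdot> Lun C (X \<otimes>\<^sub>o \<I>) \<cdot> Asc C \<I> X \<I> \<cdot> (\<tau> X \<I> \<otimes>\<^sub>m Idm C \<I>)"
    by (subst reassoc[OF Lun_nat]) simp_all
  also have "\<dots> = \<tau> X \<I> \<cdot> (Lun C X \<otimes>\<^sub>m Idm C \<I>) \<cdot> (\<tau> X \<I> \<otimes>\<^sub>m Idm C \<I>)"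
    by (subst reassoc[OF Lun_tens]) simp_all
  finally have "\<tau> X \<I> \<cdot> (Run C X \<otimes>\<^sub>m Idm C \<I>) = \<tau> X \<I> \<cdot> ((Lun C X \<cdot> \<tau> X \<I>) \<otimes>\<^sub>m Idm C \<I>)"
    by simp
  then show "(Lun C X \<cdot> \<tau> X \<I>) \<otimes>\<^sub>m Idm C \<I> = Run C X \<otimes>\<^sub>m Idm C \<I>"
    by (rule iso_cancel_left[symmetric]) simp_all
qed simp_all

lemma Sym_Run_inv:
  assumes [simp]: "X \<in> Obj C"
  shows "\<tau> X \<I> \<cdot> Run_inv X = Lun_inv X"
  by (rule iso_cancel_left[of "Lun C X"]) (simp_all add: reassoc[OF Lun_Sym])

text \<open>The second hexagon follows from the first because \<tau> is inverse to itself: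
  precomposed with \<open>?a\<close>, the left side becomes an instance of \<open>hexagon\<close>
  followed by its inverse steps.\<close>

lemma hexagon_inv:
  assumes [simp]: "A \<in> Obj C" "B \<in> Obj C" "D \<in> Obj C"
  shows "Asc C D B A \<cdot> (\<tau> B D \<otimes>\<^sub>m Idm C A) \<cdot> Asc_inv B D A \<cdot> (Idm C B \<otimes>\<^sub>m \<tau> A D) \<cdot> Asc C B A D
      = \<tau> (B \<otimes>\<^sub>o A) D"
proof (rule iso_cancel_right)
  let ?a = "\<tau> D (B \<otimes>\<^sub>o A) \<cdot> Asc C D B A"
  show "iso_arr C ?a" by (rule iso_comp) simp_all
  show "(Asc C D B A \<cdot> (\<tau> B D \<otimes>\<^sub>m Idm C A) \<cdot> Asc_inv B D A \<cdot> (Idm C B \<otimes>\<^sub>m \<tau> A D) \<cdot> Asc C B A D) \<cdot> ?a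
      = \<tau> (B \<otimes>\<^sub>o A) D \<cdot> ?a"
    by (simp add: hexagon)
qed simp_all

text \<open>Both sides reverse the order of A, B, D. The two hexagons split their block
  transpositions into the same three elementary transpositions, taken in the same order.\<close>

lemma reversal:
  assumes [simp]: "A \<in> Obj C" "B \<in> Obj C" "D \<in> Obj C"
  shows "Asc C D B A \<cdot> (\<tau> B D \<otimes>\<^sub>m Idm C A) \<cdot> \<tau> A (B \<otimes>\<^sub>o D) \<cdot> Asc C A B D
      = \<tau> (B \<otimes>\<^sub>o A) D \<cdot> (\<tau> A B \<otimes>\<^sub>m Idm C D)"
proof -
  have "\<tau> A (B \<otimes>\<^sub>o D) \<cdot> Asc C A B D
      = Asc_inv B D A \<cdot> (Idm C B \<otimes>\<^sub>m \<tau> A D) \<cdot> Asc C B A D \<cdot> (\<tau> A B \<otimes>\<^sub>m Idm C D)"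
    by (simp flip: hexagon)
  then have "Asc C D B A \<cdot> (\<tau> B D \<otimes>\<^sub>m Idm C A) \<cdot> \<tau> A (B \<otimes>\<^sub>o D) \<cdot> Asc C A B D
      = (Asc C D B A \<cdot> (\<tau> B D \<otimes>\<^sub>m Idm C A) \<cdot> Asc_inv B D A \<cdot> (Idm C B \<otimes>\<^sub>m \<tau> A D) \<cdot> Asc C B A D)
          \<cdot> (\<tau> A B \<otimes>\<^sub>m Idm C D)"
    by simp
  then show ?thesis by (simp only: hexagon_inv assms)
qed

section \<open>Transposing the first two factors\<close>

definition front_swap
  where "front_swap A B R = Asc C B A R \<cdot> (\<tau> A B \<otimes>\<^sub>m Idm C R) \<cdot> Asc_inv A B R"

lemma front_swap_arr [simp]:
  assumes "A \<in> Obj C" "B \<in> Obj C" "R \<in> Obj C"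
  shows "front_swap A B R \<in> Arr C" "Dom C (front_swap A B R) = A \<otimes>\<^sub>o (B \<otimes>\<^sub>o R)"
    "Cod C (front_swap A B R) = B \<otimes>\<^sub>o (A \<otimes>\<^sub>o R)"
    "front_swap B A R \<cdot> front_swap A B R = Idm C (A \<otimes>\<^sub>o (B \<otimes>\<^sub>o R))"
  using assms by (simp_all add: front_swap_def)

lemma front_swap_cancel [simp]:
  assumes "A \<in> Obj C" "B \<in> Obj C" "R \<in> Obj C" "h \<in> Arr C" "Cod C h = A \<otimes>\<^sub>o (B \<otimes>\<^sub>o R)"
  shows "front_swap B A R \<cdot> front_swap A B R \<cdot> h = h"
  using assms by (simp add: reassoc[OF front_swap_arr(4)])

lemma front_swap_iso [simp]:
  assumes "A \<in> Obj C" "B \<in> Obj C" "R \<in> Obj C"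
  shows "iso_arr C (front_swap A B R)" "inv_arr C (front_swap A B R) = front_swap B A R"
  using iso_arrI[of "front_swap A B R" "front_swap B A R"] assms by simp_all

lemma front_swap_nat:
  assumes [simp]: "f \<in> Arr C" "g \<in> Arr C" "h \<in> Arr C" "Cod C f = A" "Cod C g = B" "Cod C h = R"
  shows "front_swap A B R \<cdot> (f \<otimes>\<^sub>m (g \<otimes>\<^sub>m h))
       = (g \<otimes>\<^sub>m (f \<otimes>\<^sub>m h)) \<cdot> front_swap (Dom C f) (Dom C g) (Dom C h)"
proof -
  have [simp]: "A \<in> Obj C" "B \<in> Obj C" "R \<in> Obj C"
    using assms(1-3)[THEN Cod_Obj] by simp_all
  have "front_swap A B R \<cdot> (f \<otimes>\<^sub>m (g \<otimes>\<^sub>m h))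
      = Asc C B A R \<cdot> ((g \<otimes>\<^sub>m f) \<otimes>\<^sub>m h) \<cdot> (\<tau> (Dom C f) (Dom C g) \<otimes>\<^sub>m Idm C (Dom C h))
         \<cdot> Asc_inv (Dom C f) (Dom C g) (Dom C h)"
    by (simp add: front_swap_def Asc_inv_nat Sym_nat)
  also have "\<dots> = (g \<otimes>\<^sub>m (f \<otimes>\<^sub>m h)) \<cdot> front_swap (Dom C f) (Dom C g) (Dom C h)"
    by (subst reassoc[OF Asc_nat]) (simp_all add: front_swap_def)
  finally show ?thesis .
qed

lemma Asc_Sym_tens:
  assumes [simp]: "A \<in> Obj C" "B \<in> Obj C" "D \<in> Obj C"
  shows "Asc C A B D \<cdot> \<tau> D (A \<otimes>\<^sub>o B) = (Idm C A \<otimes>\<^sub>m \<tau> D B) \<cdot> front_swap D A B"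
proof (rule iso_cancel_right)
  show "(Asc C A B D \<cdot> \<tau> D (A \<otimes>\<^sub>o B)) \<cdot> Asc C D A B
      = ((Idm C A \<otimes>\<^sub>m \<tau> D B) \<cdot> front_swap D A B) \<cdot> Asc C D A B"
    by (simp add: hexagon front_swap_def)
qed simp_all

lemma front_swap_tens:
  assumes [simp]: "A \<in> Obj C" "B \<in> Obj C" "D \<in> Obj C" "R \<in> Obj C"
  shows "front_swap D A (B \<otimes>\<^sub>o R) \<cdot> (Idm C D \<otimes>\<^sub>m Asc C A B R) \<cdot> Asc C D (A \<otimes>\<^sub>o B) R
      = (Idm C A \<otimes>\<^sub>m Asc C D B R) \<cdot> Asc C A (D \<otimes>\<^sub>o B) R \<cdot> (front_swap D A B \<otimes>\<^sub>m Idm C R)"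
proof -
  have "front_swap D A (B \<otimes>\<^sub>o R) \<cdot> (Idm C D \<otimes>\<^sub>m Asc C A B R) \<cdot> Asc C D (A \<otimes>\<^sub>o B) R
      = Asc C A D (B \<otimes>\<^sub>o R) \<cdot> (\<tau> D A \<otimes>\<^sub>m (Idm C B \<otimes>\<^sub>m Idm C R)) \<cdot> Asc C (D \<otimes>\<^sub>o A) B R
         \<cdot> (Asc_inv D A B \<otimes>\<^sub>m Idm C R)"
    by (simp add: front_swap_def pentagon_inv)
  also have "\<dots> = Asc C A D (B \<otimes>\<^sub>o R) \<cdot> Asc C (A \<otimes>\<^sub>o D) B R \<cdot> ((\<tau> D A \<otimes>\<^sub>m Idm C B) \<otimes>\<^sub>m Idm C R)
         \<cdot> (Asc_inv D A B \<otimes>\<^sub>m Idm C R)"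
    by (subst reassoc[OF Asc_nat]) simp_all
  also have "\<dots> = ((Idm C A \<otimes>\<^sub>m Asc C D B R) \<cdot> Asc C A (D \<otimes>\<^sub>o B) R \<cdot> (Asc C A D B \<otimes>\<^sub>m Idm C R))
         \<cdot> ((\<tau> D A \<otimes>\<^sub>m Idm C B) \<otimes>\<^sub>m Idm C R) \<cdot> (Asc_inv D A B \<otimes>\<^sub>m Idm C R)"
    by (rule reassoc[OF pentagon]) simp_all
  also have "\<dots> = (Idm C A \<otimes>\<^sub>m Asc C D B R) \<cdot> Asc C A (D \<otimes>\<^sub>o B) R \<cdot> (front_swap D A B \<otimes>\<^sub>m Idm C R)"
    by (simp add: front_swap_def)
  finally show ?thesis .
qed

text \<open>By naturality D may cross before the pair A \<otimes> B is created, when there is only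
  the unit to cross, and \<open>Sym_Run_inv\<close> makes that crossing trivial.\<close>

lemma cup_slide:
  assumes [simp]: "q \<in> Arr C" "Dom C q = \<I>" "Cod C q = A \<otimes>\<^sub>o B" "A \<in> Obj C" "B \<in> Obj C" "D \<in> Obj C"
  shows "(Idm C A \<otimes>\<^sub>m \<tau> D B) \<cdot> front_swap D A B \<cdot> (Idm C D \<otimes>\<^sub>m q) \<cdot> Run_inv D = cup q A B D"
proof -
  have "(Idm C A \<otimes>\<^sub>m \<tau> D B) \<cdot> front_swap D A B \<cdot> (Idm C D \<otimes>\<^sub>m q) \<cdot> Run_inv D
      = Asc C A B D \<cdot> \<tau> D (A \<otimes>\<^sub>o B) \<cdot> (Idm C D \<otimes>\<^sub>m q) \<cdot> Run_inv D"
    using reassoc[OF Asc_Sym_tens[of A B D], of "(Idm C D \<otimes>\<^sub>m q) \<cdot> Run_inv D"] by simp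
  also have "\<dots> = Asc C A B D \<cdot> (q \<otimes>\<^sub>m Idm C D) \<cdot> \<tau> D \<I> \<cdot> Run_inv D"
    by (subst reassoc[OF Sym_nat]) simp_all
  also have "\<dots> = cup q A B D"
    by (simp add: Sym_Run_inv cup_def)
  finally show ?thesis .
qed

text \<open>\<open>cup_slide\<close> in the presence of a further factor R, needed in
  \<open>bracket_Sym_contraction\<close> to move S across the Casimir element of X while the dual of
  S stands on the right.\<close>

lemma cup_slide_tens:
  assumes [simp]: "q \<in> Arr C" "Dom C q = \<I>" "Cod C q = A \<otimes>\<^sub>o B" "A \<in> Obj C" "B \<in> Obj C"
    "D \<in> Obj C" "R \<in> Obj C"
  shows "(Idm C A \<otimes>\<^sub>m front_swap D B R) \<cdot> front_swap D A (B \<otimes>\<^sub>o R) \<cdot> (Idm C D \<otimes>\<^sub>m cup q A B R)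
       = cup q A B (D \<otimes>\<^sub>o R)"
proof -
  let ?R = "Idm C R"
  have "cup q A B (D \<otimes>\<^sub>o R)
      = (Idm C A \<otimes>\<^sub>m Asc C B D R) \<cdot> Asc C A (B \<otimes>\<^sub>o D) R \<cdot> ((Idm C A \<otimes>\<^sub>m \<tau> D B) \<otimes>\<^sub>m ?R)
          \<cdot> (front_swap D A B \<otimes>\<^sub>m ?R) \<cdot> (((Idm C D \<otimes>\<^sub>m q) \<cdot> Run_inv D) \<otimes>\<^sub>m ?R)"
    by (simp flip: cup_tens[of q A B D R] cup_slide[of q A B D])
  also have "\<dots> = (Idm C A \<otimes>\<^sub>m (Asc C B D R \<cdot> (\<tau> D B \<otimes>\<^sub>m ?R))) \<cdot> Asc C A (D \<otimes>\<^sub>o B) R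
          \<cdot> (front_swap D A B \<otimes>\<^sub>m ?R) \<cdot> (((Idm C D \<otimes>\<^sub>m q) \<cdot> Run_inv D) \<otimes>\<^sub>m ?R)"
    by (subst reassoc[OF Asc_nat]) simp_all
  also have "\<dots> = (Idm C A \<otimes>\<^sub>m front_swap D B R) \<cdot> (Idm C A \<otimes>\<^sub>m Asc C D B R) \<cdot> Asc C A (D \<otimes>\<^sub>o B) R
          \<cdot> (front_swap D A B \<otimes>\<^sub>m ?R) \<cdot> (((Idm C D \<otimes>\<^sub>m q) \<cdot> Run_inv D) \<otimes>\<^sub>m ?R)"
    by (simp add: front_swap_def)
  also have "\<dots> = (Idm C A \<otimes>\<^sub>m front_swap D B R) \<cdot> (front_swap D A (B \<otimes>\<^sub>o R) \<cdot> (Idm C D \<otimes>\<^sub>m Asc C A B R)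
          \<cdot> Asc C D (A \<otimes>\<^sub>o B) R) \<cdot> (((Idm C D \<otimes>\<^sub>m q) \<cdot> Run_inv D) \<otimes>\<^sub>m ?R)"
    by (subst reassoc3[OF front_swap_tens[symmetric]]) simp_all
  also have "\<dots> = (Idm C A \<otimes>\<^sub>m front_swap D B R) \<cdot> front_swap D A (B \<otimes>\<^sub>o R) \<cdot> (Idm C D \<otimes>\<^sub>m Asc C A B R)
          \<cdot> Asc C D (A \<otimes>\<^sub>o B) R \<cdot> ((Idm C D \<otimes>\<^sub>m q) \<otimes>\<^sub>m ?R) \<cdot> (Run_inv D \<otimes>\<^sub>m ?R)"
    by simp
  also have "\<dots> = (Idm C A \<otimes>\<^sub>m front_swap D B R) \<cdot> front_swap D A (B \<otimes>\<^sub>o R) \<cdot> (Idm C D \<otimes>\<^sub>m Asc C A B R)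
          \<cdot> (Idm C D \<otimes>\<^sub>m (q \<otimes>\<^sub>m ?R)) \<cdot> Asc C D \<I> R \<cdot> (Run_inv D \<otimes>\<^sub>m ?R)"
    by (subst reassoc[OF Asc_nat]) simp_all
  also have "\<dots> = (Idm C A \<otimes>\<^sub>m front_swap D B R) \<cdot> front_swap D A (B \<otimes>\<^sub>o R) \<cdot> (Idm C D \<otimes>\<^sub>m cup q A B R)"
    by (simp add: triangle_inv cup_def)
  finally show ?thesis by simp
qed

lemma mid_swap_eq:
  assumes [simp]: "V \<in> Obj C" "W \<in> Obj C" "X \<in> Obj C" "Y \<in> Obj C"
  shows "mid_swap C V W X Y = Asc_inv V X (W \<otimes>\<^sub>o Y) \<cdot> (Idm C V \<otimes>\<^sub>m front_swap W X Y) \<cdot> Asc C V W (X \<otimes>\<^sub>o Y)"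
  by (simp add: mid_swap_def front_swap_def)

lemma first_to_third_eq:
  assumes [simp]: "V \<in> Obj C" "W \<in> Obj C" "X \<in> Obj C" "Y \<in> Obj C"
  shows "first_to_third C V W X Y
    = Asc_inv W X (V \<otimes>\<^sub>o Y) \<cdot> (Idm C W \<otimes>\<^sub>m front_swap V X Y) \<cdot> Asc C W V (X \<otimes>\<^sub>o Y) \<cdot> (\<tau> V W \<otimes>\<^sub>m Idm C (X \<otimes>\<^sub>o Y))"
proof (rule iso_cancel_left[of "Asc C W X (V \<otimes>\<^sub>o Y)"])
  let ?Y = "Idm C Y"
  have "Asc C W X (V \<otimes>\<^sub>o Y) \<cdot> first_to_third C V W X Y
     = ((Idm C W \<otimes>\<^sub>m Asc C X V Y) \<cdot> Asc C W (X \<otimes>\<^sub>o V) Y \<cdot> (Asc C W X V \<otimes>\<^sub>m ?Y))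
         \<cdot> ((\<tau> V (W \<otimes>\<^sub>o X) \<cdot> Asc C V W X) \<otimes>\<^sub>m ?Y) \<cdot> Asc_inv (V \<otimes>\<^sub>o W) X Y"
    unfolding first_to_third_def by (subst reassoc[OF pentagon]) simp_all
  also have "\<dots> = (Idm C W \<otimes>\<^sub>m Asc C X V Y) \<cdot> Asc C W (X \<otimes>\<^sub>o V) Y
         \<cdot> ((Idm C W \<otimes>\<^sub>m \<tau> V X) \<otimes>\<^sub>m ?Y) \<cdot> (Asc C W V X \<otimes>\<^sub>m ?Y) \<cdot> ((\<tau> V W \<otimes>\<^sub>m Idm C X) \<otimes>\<^sub>m ?Y) \<cdot> Asc_inv (V \<otimes>\<^sub>o W) X Y"
    by (simp add: hexagon)
  also have "\<dots> = (Idm C W \<otimes>\<^sub>m (Asc C X V Y \<cdot> (\<tau> V X \<otimes>\<^sub>m ?Y))) \<cdot> Asc C W (V \<otimes>\<^sub>o X) Y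
         \<cdot> (Asc C W V X \<otimes>\<^sub>m ?Y) \<cdot> ((\<tau> V W \<otimes>\<^sub>m Idm C X) \<otimes>\<^sub>m ?Y) \<cdot> Asc_inv (V \<otimes>\<^sub>o W) X Y"
    by (subst reassoc[OF Asc_nat]) simp_all
  also have "\<dots> = (Idm C W \<otimes>\<^sub>m (Asc C X V Y \<cdot> (\<tau> V X \<otimes>\<^sub>m ?Y))) \<cdot> Asc C W (V \<otimes>\<^sub>o X) Y
         \<cdot> (Asc C W V X \<otimes>\<^sub>m ?Y) \<cdot> Asc_inv (W \<otimes>\<^sub>o V) X Y \<cdot> (\<tau> V W \<otimes>\<^sub>m (Idm C X \<otimes>\<^sub>m ?Y))"
    by (subst Asc_inv_nat) simp_all
  also have "\<dots> = (Idm C W \<otimes>\<^sub>m front_swap V X Y) \<cdot> ((Idm C W \<otimes>\<^sub>m Asc C V X Y) \<cdot> Asc C W (V \<otimes>\<^sub>o X) Y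
         \<cdot> (Asc C W V X \<otimes>\<^sub>m ?Y)) \<cdot> Asc_inv (W \<otimes>\<^sub>o V) X Y \<cdot> (\<tau> V W \<otimes>\<^sub>m Idm C (X \<otimes>\<^sub>o Y))"
    by (simp add: front_swap_def)
  also have "\<dots> = (Idm C W \<otimes>\<^sub>m front_swap V X Y) \<cdot> (Asc C W V (X \<otimes>\<^sub>o Y) \<cdot> Asc C (W \<otimes>\<^sub>o V) X Y)
         \<cdot> Asc_inv (W \<otimes>\<^sub>o V) X Y \<cdot> (\<tau> V W \<otimes>\<^sub>m Idm C (X \<otimes>\<^sub>o Y))"
    by (simp only: pentagon assms)
  also have "\<dots> = Asc C W X (V \<otimes>\<^sub>o Y) \<cdot> Asc_inv W X (V \<otimes>\<^sub>o Y) \<cdot> (Idm C W \<otimes>\<^sub>m front_swap V X Y)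
         \<cdot> Asc C W V (X \<otimes>\<^sub>o Y) \<cdot> (\<tau> V W \<otimes>\<^sub>m Idm C (X \<otimes>\<^sub>o Y))"
    by simp
  finally show "Asc C W X (V \<otimes>\<^sub>o Y) \<cdot> first_to_third C V W X Y
    = Asc C W X (V \<otimes>\<^sub>o Y) \<cdot> Asc_inv W X (V \<otimes>\<^sub>o Y) \<cdot> (Idm C W \<otimes>\<^sub>m front_swap V X Y)
         \<cdot> Asc C W V (X \<otimes>\<^sub>o Y) \<cdot> (\<tau> V W \<otimes>\<^sub>m Idm C (X \<otimes>\<^sub>o Y))" .
qed (simp_all add: first_to_third_def)

lemma front_swap_Unit:
  assumes [simp]: "A \<in> Obj C" "R \<in> Obj C"
  shows "front_swap A \<I> R \<cdot> (Idm C A \<otimes>\<^sub>m Lun_inv R) = Lun_inv (A \<otimes>\<^sub>o R)"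
  by (simp add: front_swap_def Sym_Run_inv Lun_inv_tens flip: triangle_inv)

section \<open>The action of endomorphisms of the unit\<close>

lemma unit_act_arr [simp]:
  assumes "\<mu> \<in> Arr C" "Dom C \<mu> = \<I>" "Cod C \<mu> = \<I>" "X \<in> Obj C"
  shows "unit_act C \<mu> X \<in> Arr C" "Dom C (unit_act C \<mu> X) = X" "Cod C (unit_act C \<mu> X) = X"
  using assms by (simp_all add: unit_act_def)

text \<open>The action of \<mu> is a natural endomorphism of the identity functor. This lets scalars
  pass through composites and, applied to another scalar, makes the two commute.\<close>

lemma unit_act_nat:
  assumes [simp]: "\<mu> \<in> Arr C" "Dom C \<mu> = \<I>" "Cod C \<mu> = \<I>" "f \<in> Arr C" "Dom C f = X" "Cod C f = Y"
  shows "unit_act C \<mu> Y \<cdot> f = f \<cdot> unit_act C \<mu> X"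
proof -
  have [simp]: "X \<in> Obj C" "Y \<in> Obj C" using assms(4)[THEN Dom_Obj] assms(4)[THEN Cod_Obj] by simp_all
  have "unit_act C \<mu> Y \<cdot> f = Lun C Y \<cdot> (Idm C \<I> \<otimes>\<^sub>m f) \<cdot> (\<mu> \<otimes>\<^sub>m Idm C X) \<cdot> Lun_inv X"
    by (simp add: unit_act_def Lun_inv_nat)
  also have "\<dots> = f \<cdot> unit_act C \<mu> X"
    by (subst reassoc[OF Lun_nat]) (simp_all add: unit_act_def)
  finally show ?thesis .
qed

lemma unit_act_tens_left:
  assumes [simp]: "\<mu> \<in> Arr C" "Dom C \<mu> = \<I>" "Cod C \<mu> = \<I>" "X \<in> Obj C" "Y \<in> Obj C"
  shows "unit_act C \<mu> X \<otimes>\<^sub>m Idm C Y = unit_act C \<mu> (X \<otimes>\<^sub>o Y)"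
proof -
  have "unit_act C \<mu> X \<otimes>\<^sub>m Idm C Y
     = (Lun C X \<otimes>\<^sub>m Idm C Y) \<cdot> ((\<mu> \<otimes>\<^sub>m Idm C X) \<otimes>\<^sub>m Idm C Y) \<cdot> (Lun_inv X \<otimes>\<^sub>m Idm C Y)"
    by (simp add: unit_act_def)
  also have "\<dots> = Lun C (X \<otimes>\<^sub>o Y) \<cdot> Asc C \<I> X Y \<cdot> ((\<mu> \<otimes>\<^sub>m Idm C X) \<otimes>\<^sub>m Idm C Y) \<cdot> (Lun_inv X \<otimes>\<^sub>m Idm C Y)"
    by (subst reassoc[OF Lun_tens]) simp_all
  also have "\<dots> = Lun C (X \<otimes>\<^sub>o Y) \<cdot> (\<mu> \<otimes>\<^sub>m (Idm C X \<otimes>\<^sub>m Idm C Y)) \<cdot> Asc C \<I> X Y \<cdot> (Lun_inv X \<otimes>\<^sub>m Idm C Y)"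
    by (subst reassoc[OF Asc_nat]) simp_all
  also have "\<dots> = unit_act C \<mu> (X \<otimes>\<^sub>o Y)"
    by (simp add: Lun_inv_tens unit_act_def)
  finally show ?thesis .
qed

text \<open>The action is defined with the unit on the left, so \<open>unit_act_tens_left\<close>
  comes from the constraints alone; the symmetry transports it to the other factor.\<close>

lemma unit_act_tens_right:
  assumes [simp]: "\<mu> \<in> Arr C" "Dom C \<mu> = \<I>" "Cod C \<mu> = \<I>" "X \<in> Obj C" "Y \<in> Obj C"
  shows "Idm C X \<otimes>\<^sub>m unit_act C \<mu> Y = unit_act C \<mu> (X \<otimes>\<^sub>o Y)"
proof (rule iso_cancel_left[of "\<tau> X Y"])
  show "\<tau> X Y \<cdot> (Idm C X \<otimes>\<^sub>m unit_act C \<mu> Y) = \<tau> X Y \<cdot> unit_act C \<mu> (X \<otimes>\<^sub>o Y)"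
    by (simp add: Sym_nat unit_act_tens_left unit_act_nat[of _ "\<tau> X Y"])
qed simp_all

lemma unit_act_comp:
  assumes [simp]: "\<mu> \<in> Arr C" "Dom C \<mu> = \<I>" "Cod C \<mu> = \<I>" "l \<in> Arr C" "Dom C l = \<I>" "Cod C l = \<I>" "X \<in> Obj C"
  shows "unit_act C (\<mu> \<cdot> l) X = unit_act C \<mu> X \<cdot> unit_act C l X"
  by (simp add: unit_act_def)

end

section \<open>Pairings and internal multiplication\<close>

context ACU_tensor_category
begin

lemma IHom_arr [simp]:
  assumes "X \<in> Obj C" "Y \<in> Obj C"
  shows "IHom C X Y \<in> Obj C" "Ev C X Y \<in> Arr C" "Dom C (Ev C X Y) = IHom C X Y \<otimes>\<^sub>o X"
    "Cod C (Ev C X Y) = Y"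
  using IHom_Obj[OF assms] Ev_Hom[OF assms] by (simp_all add: Hom_def)

lemma dual_arr [simp]:
  assumes "X \<in> Obj C"
  shows "X\<^sup>\<or> \<in> Obj C" "ev C X \<in> Arr C" "Dom C (ev C X) = X\<^sup>\<or> \<otimes>\<^sub>o X" "Cod C (ev C X) = \<I>"
    "evt C X \<in> Arr C" "Dom C (evt C X) = X \<otimes>\<^sub>o X\<^sup>\<or>" "Cod C (evt C X) = \<I>"
proof -
  show [simp]: "X\<^sup>\<or> \<in> Obj C" "ev C X \<in> Arr C" "Dom C (ev C X) = X\<^sup>\<or> \<otimes>\<^sub>o X" "Cod C (ev C X) = \<I>"
    using assms by (simp_all add: dual_def ev_def)
  show "evt C X \<in> Arr C" "Dom C (evt C X) = X \<otimes>\<^sub>o X\<^sup>\<or>" "Cod C (evt C X) = \<I>"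
    using assms by (simp_all add: evt_def)
qed

lemma curry_ex1:
  assumes "\<phi> \<in> Arr C" "Dom C \<phi> = P \<otimes>\<^sub>o Q" "Cod C \<phi> = R" "P \<in> Obj C" "Q \<in> Obj C"
  shows "\<exists>!f. f \<in> Hom C P (IHom C Q R) \<and> Ev C Q R \<cdot> (f \<otimes>\<^sub>m Idm C Q) = \<phi>"
proof (rule Ev_universal)
  show "R \<in> Obj C" using Cod_Obj[OF assms(1)] assms(3) by simp
  show "\<phi> \<in> Hom C (P \<otimes>\<^sub>o Q) R" using assms by (intro HomI)
qed (fact assms)+

lemma curry_arr [simp]:
  assumes "\<phi> \<in> Arr C" "Dom C \<phi> = P \<otimes>\<^sub>o Q" "Cod C \<phi> = R" "P \<in> Obj C" "Q \<in> Obj C"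
  shows "curry_arr C P Q R \<phi> \<in> Arr C" "Dom C (curry_arr C P Q R \<phi>) = P"
    "Cod C (curry_arr C P Q R \<phi>) = IHom C Q R"
    "Ev C Q R \<cdot> (curry_arr C P Q R \<phi> \<otimes>\<^sub>m Idm C Q) = \<phi>"
  using theI'[OF curry_ex1[OF assms]] by (simp_all add: curry_arr_def Hom_def)

lemma Ev_inject:
  assumes "Ev C Q R \<cdot> (f \<otimes>\<^sub>m Idm C Q) = Ev C Q R \<cdot> (g \<otimes>\<^sub>m Idm C Q)"
    "f \<in> Arr C" "g \<in> Arr C" "Dom C f = Dom C g" "Cod C f = IHom C Q R" "Cod C g = IHom C Q R"
    "Q \<in> Obj C" "R \<in> Obj C"
  shows "f = g"
proof -
  have "\<exists>!h. h \<in> Hom C (Dom C g) (IHom C Q R) \<and> Ev C Q R \<cdot> (h \<otimes>\<^sub>m Idm C Q) = Ev C Q R \<cdot> (g \<otimes>\<^sub>m Idm C Q)"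
    by (rule curry_ex1) (use assms(2-) in simp_all)
  moreover have "f \<in> Hom C (Dom C g) (IHom C Q R)" "g \<in> Hom C (Dom C g) (IHom C Q R)"
    using assms(2-) by (simp_all add: Hom_def)
  ultimately show ?thesis using assms(1) by blast
qed

lemma ev_inject:
  assumes "ev C X \<cdot> (f \<otimes>\<^sub>m Idm C X) = ev C X \<cdot> (g \<otimes>\<^sub>m Idm C X)"
    "f \<in> Arr C" "g \<in> Arr C" "Dom C f = Dom C g" "Cod C f = X\<^sup>\<or>" "Cod C g = X\<^sup>\<or>" "X \<in> Obj C"
  shows "f = g"
  using Ev_inject[of X \<I> f g] assms by (simp add: ev_def dual_def)

lemma curry_unique:
  assumes "Ev C Q R \<cdot> (f \<otimes>\<^sub>m Idm C Q) = \<phi>" "f \<in> Arr C" "Dom C f = P" "Cod C f = IHom C Q R"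
    "Q \<in> Obj C" "R \<in> Obj C"
  shows "curry_arr C P Q R \<phi> = f"
proof (rule Ev_inject)
  have P: "P \<in> Obj C" using assms(2,3) by auto
  have \<phi>: "\<phi> \<in> Arr C" "Dom C \<phi> = P \<otimes>\<^sub>o Q" "Cod C \<phi> = R"
    using assms by (auto simp flip: assms(1))
  note curry_arr[OF \<phi> P assms(5), simp]
  show "Ev C Q R \<cdot> (curry_arr C P Q R \<phi> \<otimes>\<^sub>m Idm C Q) = Ev C Q R \<cdot> (f \<otimes>\<^sub>m Idm C Q)"
    by (simp add: assms(1))
  show "curry_arr C P Q R \<phi> \<in> Arr C" "Dom C (curry_arr C P Q R \<phi>) = Dom C f"
    "Cod C (curry_arr C P Q R \<phi>) = IHom C Q R"
    by (simp_all add: assms)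
qed (use assms in auto)

lemma ev_Sym: "X \<in> Obj C \<Longrightarrow> evt C X \<cdot> \<tau> (X\<^sup>\<or>) X = ev C X"
  by (simp add: evt_def)

lemma bidual_map_arr [simp]:
  assumes [simp]: "X \<in> Obj C"
  shows "bidual_map C X \<in> Arr C" "Dom C (bidual_map C X) = X" "Cod C (bidual_map C X) = (X\<^sup>\<or>)\<^sup>\<or>"
    "ev C (X\<^sup>\<or>) \<cdot> (bidual_map C X \<otimes>\<^sub>m Idm C (X\<^sup>\<or>)) = evt C X"
proof -
  note curry_arr[of "evt C X" X "X\<^sup>\<or>" \<I>, simplified]
  then show "bidual_map C X \<in> Arr C" "Dom C (bidual_map C X) = X" "Cod C (bidual_map C X) = (X\<^sup>\<or>)\<^sup>\<or>"
    "ev C (X\<^sup>\<or>) \<cdot> (bidual_map C X \<otimes>\<^sub>m Idm C (X\<^sup>\<or>)) = evt C X"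
    unfolding bidual_map_def ev_def[of C "X\<^sup>\<or>"] dual_def[of C "X\<^sup>\<or>"] by auto
qed

lemma evt_bidual_map:
  assumes [simp]: "X \<in> Obj C"
  shows "evt C (X\<^sup>\<or>) \<cdot> (Idm C (X\<^sup>\<or>) \<otimes>\<^sub>m bidual_map C X) = ev C X"
proof -
  have "evt C (X\<^sup>\<or>) \<cdot> (Idm C (X\<^sup>\<or>) \<otimes>\<^sub>m bidual_map C X)
     = ev C (X\<^sup>\<or>) \<cdot> (bidual_map C X \<otimes>\<^sub>m Idm C (X\<^sup>\<or>)) \<cdot> \<tau> (X\<^sup>\<or>) X"
    unfolding evt_def by (simp add: Sym_nat)
  also have "\<dots> = ev C X"
    by (subst reassoc[OF bidual_map_arr(4)]) (simp_all add: ev_Sym)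
  finally show ?thesis .
qed

text \<open>Existence and uniqueness come from the universal property of \<open>Ev\<close>, once the
  defining equation of \<open>imult\<close> has been rewritten with \<open>ev C Q\<close> and the
  unknown on the left. The equation \<open>eq\<close> in between has its tensor products bracketed
  to the right and is the form used from here on.\<close>

lemma
  assumes "\<phi> \<in> Arr C" "Dom C \<phi> = P \<otimes>\<^sub>o Q" "Cod C \<phi> = R" "P \<in> Obj C" "Q \<in> Obj C"
  shows imult_arr [simp]: "imult C P Q R \<phi> \<in> Arr C" "Dom C (imult C P Q R \<phi>) = P \<otimes>\<^sub>o R\<^sup>\<or>"
      "Cod C (imult C P Q R \<phi>) = Q\<^sup>\<or>"
    and evt_imult: "evt C Q \<cdot> (Idm C Q \<otimes>\<^sub>m imult C P Q R \<phi>) \<cdot> front_swap P Q (R\<^sup>\<or>)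
      = evt C R \<cdot> (\<phi> \<otimes>\<^sub>m Idm C (R\<^sup>\<or>)) \<cdot> Asc_inv P Q (R\<^sup>\<or>)"
proof -
  note [simp] = assms
  have [simp]: "R \<in> Obj C" using Cod_Obj[OF assms(1)] by simp
  let ?R = "R\<^sup>\<or>"
  define eq where "eq \<psi> \<longleftrightarrow> evt C Q \<cdot> (Idm C Q \<otimes>\<^sub>m \<psi>) \<cdot> front_swap P Q ?R
      = evt C R \<cdot> (\<phi> \<otimes>\<^sub>m Idm C ?R) \<cdot> Asc_inv P Q ?R" for \<psi>
  have eq_iff: "evt C Q \<cdot> (Idm C Q \<otimes>\<^sub>m \<psi>) \<cdot> Asc C Q P ?R \<cdot> (\<tau> P Q \<otimes>\<^sub>m Idm C ?R)
      = evt C R \<cdot> (\<phi> \<otimes>\<^sub>m Idm C ?R) \<longleftrightarrow> eq \<psi>" (is "?l = ?r \<longleftrightarrow> _")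
    if "\<psi> \<in> Hom C (P \<otimes>\<^sub>o ?R) (Q\<^sup>\<or>)" for \<psi>
  proof -
    note [simp] = HomD[OF that]
    have *: "eq \<psi> \<longleftrightarrow> ?l \<cdot> Asc_inv P Q ?R = ?r \<cdot> Asc_inv P Q ?R"
      by (simp add: eq_def front_swap_def)
    show ?thesis
    proof
      assume "?l = ?r" then show "eq \<psi>" unfolding * by (rule arg_cong)
    next
      assume "eq \<psi>" then show "?l = ?r" unfolding * by (rule iso_cancel_right) simp_all
    qed
  qed
  \<comment> \<open>The right side of \<open>eq\<close> precomposed with the isomorphism
    \<open>?i\<close> below, which starts with Q in the last place; on the left side this turns
    \<open>evt\<close> into \<open>ev\<close>.\<close>
  define \<chi> where "\<chi> = evt C R \<cdot> (\<phi> \<otimes>\<^sub>m Idm C ?R) \<cdot> Asc_inv P Q ?R \<cdot> front_swap Q P ?R \<cdot> \<tau> (P \<otimes>\<^sub>o ?R) Q"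
  have [simp]: "\<chi> \<in> Arr C" "Dom C \<chi> = (P \<otimes>\<^sub>o ?R) \<otimes>\<^sub>o Q" "Cod C \<chi> = \<I>" by (simp_all add: \<chi>_def)
  have eq_\<chi>: "eq \<psi> \<longleftrightarrow> ev C Q \<cdot> (\<psi> \<otimes>\<^sub>m Idm C Q) = \<chi>" if "\<psi> \<in> Hom C (P \<otimes>\<^sub>o ?R) (Q\<^sup>\<or>)" for \<psi>
  proof -
    note [simp] = HomD[OF that]
    let ?i = "front_swap Q P ?R \<cdot> \<tau> (P \<otimes>\<^sub>o ?R) Q"
    have "iso_arr C ?i" by (rule iso_comp) simp_all
    moreover have "(evt C Q \<cdot> (Idm C Q \<otimes>\<^sub>m \<psi>) \<cdot> front_swap P Q ?R) \<cdot> ?i = ev C Q \<cdot> (\<psi> \<otimes>\<^sub>m Idm C Q)"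
      by (simp flip: ev_Sym) (simp add: Sym_nat)
    moreover have "(evt C R \<cdot> (\<phi> \<otimes>\<^sub>m Idm C ?R) \<cdot> Asc_inv P Q ?R) \<cdot> ?i = \<chi>"
      by (simp add: \<chi>_def)
    moreover have "eq \<psi>" if "(evt C Q \<cdot> (Idm C Q \<otimes>\<^sub>m \<psi>) \<cdot> front_swap P Q ?R) \<cdot> ?i
        = (evt C R \<cdot> (\<phi> \<otimes>\<^sub>m Idm C ?R) \<cdot> Asc_inv P Q ?R) \<cdot> ?i"
      unfolding eq_def using that \<open>iso_arr C ?i\<close> by (rule iso_cancel_right) simp_all
    ultimately show ?thesis by (metis eq_def)
  qed
  have "\<exists>!\<psi>. \<psi> \<in> Hom C (P \<otimes>\<^sub>o ?R) (Q\<^sup>\<or>) \<and> ev C Q \<cdot> (\<psi> \<otimes>\<^sub>m Idm C Q) = \<chi>"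
    using curry_ex1[of \<chi> "P \<otimes>\<^sub>o ?R" Q \<I>] by (simp add: ev_def dual_def[of C Q])
  then have "\<exists>!\<psi>. \<psi> \<in> Hom C (P \<otimes>\<^sub>o ?R) (Q\<^sup>\<or>) \<and>
      evt C Q \<cdot> (Idm C Q \<otimes>\<^sub>m \<psi>) \<cdot> Asc C Q P ?R \<cdot> (\<tau> P Q \<otimes>\<^sub>m Idm C ?R) = evt C R \<cdot> (\<phi> \<otimes>\<^sub>m Idm C ?R)"
    using eq_iff eq_\<chi> by metis
  from theI'[OF this] have *: "imult C P Q R \<phi> \<in> Hom C (P \<otimes>\<^sub>o ?R) (Q\<^sup>\<or>)" "eq (imult C P Q R \<phi>)"
    using eq_iff by (auto simp: imult_def)
  from HomD[OF *(1)] *(2) show "imult C P Q R \<phi> \<in> Arr C" "Dom C (imult C P Q R \<phi>) = P \<otimes>\<^sub>o ?R"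
    "Cod C (imult C P Q R \<phi>) = Q\<^sup>\<or>"
    "evt C Q \<cdot> (Idm C Q \<otimes>\<^sub>m imult C P Q R \<phi>) \<cdot> front_swap P Q ?R
      = evt C R \<cdot> (\<phi> \<otimes>\<^sub>m Idm C ?R) \<cdot> Asc_inv P Q ?R"
    by (simp_all add: eq_def)
qed

lemma alpha_arr [simp]:
  assumes [simp]: "X \<in> Obj C" "Y \<in> Obj C"
  shows "alpha C X Y \<in> Arr C" "Dom C (alpha C X Y) = Y \<otimes>\<^sub>o X\<^sup>\<or>" "Cod C (alpha C X Y) = IHom C X Y"
    "Ev C X Y \<cdot> (alpha C X Y \<otimes>\<^sub>m Idm C X) = Run C Y \<cdot> (Idm C Y \<otimes>\<^sub>m ev C X) \<cdot> Asc C Y (X\<^sup>\<or>) X"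
  by (simp_all add: alpha_def)

text \<open>\<open>r\<close> and \<open>p\<close> are pairings \<open>R \<otimes> R* \<rightarrow> \<I>\<close> and \<open>Q \<otimes> Q* \<rightarrow> \<I>\<close> for which \<open>\<iota> : P \<otimes> R* \<rightarrow> Q*\<close>
  is an internal multiplication of \<open>\<phi> : P \<otimes> Q \<rightarrow> R\<close>.\<close>

lemma imult_flip:
  assumes adj: "p \<cdot> (Idm C Q \<otimes>\<^sub>m \<iota>) \<cdot> front_swap P Q R' = r \<cdot> (\<phi> \<otimes>\<^sub>m Idm C R') \<cdot> Asc_inv P Q R'"
    and [simp]: "\<phi> \<in> Arr C" "Dom C \<phi> = P \<otimes>\<^sub>o Q" "Cod C \<phi> = R"
    "\<iota> \<in> Arr C" "Dom C \<iota> = P \<otimes>\<^sub>o R'" "Cod C \<iota> = Q'"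
    "p \<in> Arr C" "Dom C p = Q \<otimes>\<^sub>o Q'" "Cod C p = \<I>" "r \<in> Arr C" "Dom C r = R \<otimes>\<^sub>o R'" "Cod C r = \<I>"
    "P \<in> Obj C" "Q \<in> Obj C" "R \<in> Obj C" "Q' \<in> Obj C" "R' \<in> Obj C"
  shows "p \<cdot> \<tau> Q' Q \<cdot> ((\<iota> \<cdot> \<tau> R' P) \<otimes>\<^sub>m Idm C Q) = r \<cdot> \<tau> R' R \<cdot> (Idm C R' \<otimes>\<^sub>m \<phi>) \<cdot> Asc C R' P Q"
proof -
  have "p \<cdot> \<tau> Q' Q \<cdot> ((\<iota> \<cdot> \<tau> R' P) \<otimes>\<^sub>m Idm C Q)
      = (p \<cdot> (Idm C Q \<otimes>\<^sub>m \<iota>) \<cdot> front_swap P Q R') \<cdot> front_swap Q P R' \<cdot> \<tau> (P \<otimes>\<^sub>o R') Q \<cdot> (\<tau> R' P \<otimes>\<^sub>m Idm C Q)"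
    by (simp add: Sym_nat)
  also have "\<dots> = (r \<cdot> (\<phi> \<otimes>\<^sub>m Idm C R') \<cdot> Asc_inv P Q R') \<cdot> front_swap Q P R'
      \<cdot> (Asc C Q P R' \<cdot> (\<tau> P Q \<otimes>\<^sub>m Idm C R') \<cdot> \<tau> R' (P \<otimes>\<^sub>o Q) \<cdot> Asc C R' P Q)"
    by (simp only: adj reversal assms)
  also have "\<dots> = r \<cdot> (\<phi> \<otimes>\<^sub>m Idm C R') \<cdot> \<tau> R' (P \<otimes>\<^sub>o Q) \<cdot> Asc C R' P Q"
    by (simp add: front_swap_def)
  also have "\<dots> = r \<cdot> \<tau> R' R \<cdot> (Idm C R' \<otimes>\<^sub>m \<phi>) \<cdot> Asc C R' P Q"
    using reassoc[OF Sym_nat[of "Idm C R'" \<phi> R' R], of "Asc C R' P Q"] by simp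
  finally show ?thesis .
qed

text \<open>The composite of \<open>p\<close> with \<iota> is computed twice: expressing \<iota> by
  \<delta> contracts Q with Q' and leaves \<open>r\<close>, while \<open>adj\<close> trades \<iota>
  for \<phi>. Where \<open>r\<close> is nondegenerate, contracting \<delta> with Q therefore gives
  \<phi> back up to \<tau>.\<close>

lemma imult_pairing:
  assumes adj: "p \<cdot> (Idm C Q \<otimes>\<^sub>m \<iota>) \<cdot> front_swap P Q R' = r \<cdot> (\<phi> \<otimes>\<^sub>m Idm C R') \<cdot> Asc_inv P Q R'"
    and \<delta>: "Run C Q' \<cdot> (Idm C Q' \<otimes>\<^sub>m r) \<cdot> Asc C Q' R R' \<cdot> (\<delta> \<otimes>\<^sub>m Idm C R') = \<iota>"
    and [simp]: "\<phi> \<in> Arr C" "Dom C \<phi> = P \<otimes>\<^sub>o Q" "Cod C \<phi> = R"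
    "\<delta> \<in> Arr C" "Dom C \<delta> = P" "Cod C \<delta> = Q' \<otimes>\<^sub>o R"
    "p \<in> Arr C" "Dom C p = Q \<otimes>\<^sub>o Q'" "Cod C p = \<I>" "r \<in> Arr C" "Dom C r = R \<otimes>\<^sub>o R'" "Cod C r = \<I>"
    "P \<in> Obj C" "Q \<in> Obj C" "R \<in> Obj C" "Q' \<in> Obj C" "R' \<in> Obj C"
  shows "r \<cdot> ((cap p Q Q' R \<cdot> (Idm C Q \<otimes>\<^sub>m \<delta>)) \<otimes>\<^sub>m Idm C R') = r \<cdot> ((\<phi> \<cdot> \<tau> Q P) \<otimes>\<^sub>m Idm C R')"
proof (rule iso_cancel_right[of _ "Asc_inv Q P R'"])
  have [simp]: "\<iota> \<in> Arr C" "Dom C \<iota> = P \<otimes>\<^sub>o R'" "Cod C \<iota> = Q'" by (simp_all flip: \<delta>)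
  have "p \<cdot> (Idm C Q \<otimes>\<^sub>m \<iota>)
     = (p \<cdot> (Idm C Q \<otimes>\<^sub>m Run C Q')) \<cdot> (Idm C Q \<otimes>\<^sub>m (Idm C Q' \<otimes>\<^sub>m r)) \<cdot> (Idm C Q \<otimes>\<^sub>m Asc C Q' R R')
         \<cdot> (Idm C Q \<otimes>\<^sub>m (\<delta> \<otimes>\<^sub>m Idm C R'))"
    by (simp flip: \<delta>)
  also have "\<dots> = cap p Q Q' \<I> \<cdot> (Idm C Q \<otimes>\<^sub>m (Idm C Q' \<otimes>\<^sub>m r)) \<cdot> (Idm C Q \<otimes>\<^sub>m Asc C Q' R R')
         \<cdot> (Idm C Q \<otimes>\<^sub>m (\<delta> \<otimes>\<^sub>m Idm C R'))"
    by (simp only: cap_Unit assms)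
  also have "\<dots> = r \<cdot> cap p Q Q' (R \<otimes>\<^sub>o R') \<cdot> (Idm C Q \<otimes>\<^sub>m Asc C Q' R R') \<cdot> (Idm C Q \<otimes>\<^sub>m (\<delta> \<otimes>\<^sub>m Idm C R'))"
    by (subst reassoc[OF cap_nat]) simp_all
  also have "\<dots> = r \<cdot> cap p Q Q' (R \<otimes>\<^sub>o R') \<cdot> (Idm C Q \<otimes>\<^sub>m Asc C Q' R R') \<cdot> Asc C Q (Q' \<otimes>\<^sub>o R) R'
         \<cdot> ((Idm C Q \<otimes>\<^sub>m \<delta>) \<otimes>\<^sub>m Idm C R') \<cdot> Asc_inv Q P R'"
  proof -
    have "Asc C Q (Q' \<otimes>\<^sub>o R) R' \<cdot> ((Idm C Q \<otimes>\<^sub>m \<delta>) \<otimes>\<^sub>m Idm C R') \<cdot> Asc_inv Q P R'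
        = Idm C Q \<otimes>\<^sub>m (\<delta> \<otimes>\<^sub>m Idm C R')"
      by (subst reassoc[OF Asc_nat]) simp_all
    then show ?thesis by simp
  qed
  also have "\<dots> = r \<cdot> (cap p Q Q' R \<otimes>\<^sub>m Idm C R') \<cdot> ((Idm C Q \<otimes>\<^sub>m \<delta>) \<otimes>\<^sub>m Idm C R') \<cdot> Asc_inv Q P R'"
    by (subst reassoc3[OF cap_tens]) simp_all
  finally have l: "p \<cdot> (Idm C Q \<otimes>\<^sub>m \<iota>) = (r \<cdot> ((cap p Q Q' R \<cdot> (Idm C Q \<otimes>\<^sub>m \<delta>)) \<otimes>\<^sub>m Idm C R')) \<cdot> Asc_inv Q P R'"
    by simp
  have "p \<cdot> (Idm C Q \<otimes>\<^sub>m \<iota>) = (p \<cdot> (Idm C Q \<otimes>\<^sub>m \<iota>) \<cdot> front_swap P Q R') \<cdot> front_swap Q P R'"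
    by simp
  also have "\<dots> = (r \<cdot> ((\<phi> \<cdot> \<tau> Q P) \<otimes>\<^sub>m Idm C R')) \<cdot> Asc_inv Q P R'"
    unfolding adj by (simp add: front_swap_def)
  finally show "(r \<cdot> ((cap p Q Q' R \<cdot> (Idm C Q \<otimes>\<^sub>m \<delta>)) \<otimes>\<^sub>m Idm C R')) \<cdot> Asc_inv Q P R'
     = (r \<cdot> ((\<phi> \<cdot> \<tau> Q P) \<otimes>\<^sub>m Idm C R')) \<cdot> Asc_inv Q P R'"
    using l by simp
qed simp_all

text \<open>\<open>alpha\<close> pairs the last two factors, \<open>cap\<close> the first two.
  \<open>reversal\<close> moves R past the pair, and \<open>Lun_Sym\<close> exchanges the unit
  constraints.\<close>

lemma cap_Sym:
  assumes [simp]: "p \<in> Arr C" "Dom C p = B \<otimes>\<^sub>o A" "Cod C p = \<I>" "A \<in> Obj C" "B \<in> Obj C" "R \<in> Obj C"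
  shows "Run C R \<cdot> (Idm C R \<otimes>\<^sub>m p) \<cdot> Asc C R B A \<cdot> (\<tau> B R \<otimes>\<^sub>m Idm C A)
       = cap (p \<cdot> \<tau> A B) A B R \<cdot> \<tau> (B \<otimes>\<^sub>o R) A"
proof (rule iso_cancel_right[of _ "\<tau> R B \<otimes>\<^sub>m Idm C A"])
  have "(cap (p \<cdot> \<tau> A B) A B R \<cdot> \<tau> (B \<otimes>\<^sub>o R) A) \<cdot> (\<tau> R B \<otimes>\<^sub>m Idm C A)
      = cap (p \<cdot> \<tau> A B) A B R \<cdot> Asc C A B R \<cdot> (\<tau> B A \<otimes>\<^sub>m Idm C R) \<cdot> \<tau> R (B \<otimes>\<^sub>o A) \<cdot> Asc C R B A"
    by (simp add: reversal)
  also have "\<dots> = Lun C R \<cdot> (p \<otimes>\<^sub>m Idm C R) \<cdot> \<tau> R (B \<otimes>\<^sub>o A) \<cdot> Asc C R B A"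
    by (simp add: cap_def)
  also have "\<dots> = Lun C R \<cdot> \<tau> R \<I> \<cdot> (Idm C R \<otimes>\<^sub>m p) \<cdot> Asc C R B A"
    using reassoc[OF Sym_nat[of "Idm C R" p R \<I>], of "Asc C R B A"] by simp
  also have "\<dots> = Run C R \<cdot> (Idm C R \<otimes>\<^sub>m p) \<cdot> Asc C R B A"
    by (simp add: reassoc[OF Lun_Sym])
  finally show "(Run C R \<cdot> (Idm C R \<otimes>\<^sub>m p) \<cdot> Asc C R B A \<cdot> (\<tau> B R \<otimes>\<^sub>m Idm C A)) \<cdot> (\<tau> R B \<otimes>\<^sub>m Idm C A)
      = (cap (p \<cdot> \<tau> A B) A B R \<cdot> \<tau> (B \<otimes>\<^sub>o R) A) \<cdot> (\<tau> R B \<otimes>\<^sub>m Idm C A)"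
    by simp
qed simp_all

end

section \<open>Casimir elements in rigid categories\<close>

context rigid_ACU_tensor_category
begin

lemma bidual_map_iso_simp [simp]: "X \<in> Obj C \<Longrightarrow> iso_arr C (bidual_map C X)"
  by (rule bidual_map_iso)

text \<open>Nondegeneracy of \<open>evt C X\<close> in its first argument: through
  \<open>bidual_map\<close> it becomes \<open>ev\<close> of the dual, where the universal property
  decides, and \<open>bidual_map\<close> cancels by rigidity.\<close>

lemma evt_inject:
  assumes "evt C X \<cdot> (f \<otimes>\<^sub>m Idm C (X\<^sup>\<or>)) = evt C X \<cdot> (g \<otimes>\<^sub>m Idm C (X\<^sup>\<or>))"
    and [simp]: "f \<in> Arr C" "g \<in> Arr C" "Dom C f = T" "Dom C g = T" "Cod C f = X" "Cod C g = X" "X \<in> Obj C"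
  shows "f = g"
proof -
  have "bidual_map C X \<cdot> f = bidual_map C X \<cdot> g"
  proof (rule ev_inject)
    have "ev C (X\<^sup>\<or>) \<cdot> ((bidual_map C X \<cdot> h) \<otimes>\<^sub>m Idm C (X\<^sup>\<or>)) = evt C X \<cdot> (h \<otimes>\<^sub>m Idm C (X\<^sup>\<or>))"
      if [simp]: "h \<in> Arr C" "Cod C h = X" for h
      using reassoc[OF bidual_map_arr(4), of X "h \<otimes>\<^sub>m Idm C (X\<^sup>\<or>)"] by simp
    then show "ev C (X\<^sup>\<or>) \<cdot> ((bidual_map C X \<cdot> f) \<otimes>\<^sub>m Idm C (X\<^sup>\<or>))
        = ev C (X\<^sup>\<or>) \<cdot> ((bidual_map C X \<cdot> g) \<otimes>\<^sub>m Idm C (X\<^sup>\<or>))"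
      using assms(1) by simp
  qed simp_all
  then show ?thesis by (rule iso_cancel_left) simp_all
qed

text \<open>\<open>\<alpha>\<close> factors through the canonical map
  \<open>hom(\<I>,Y) \<otimes> hom(X,\<I>) \<rightarrow> hom(\<I> \<otimes> X, Y \<otimes> \<I>)\<close>, via \<open>Y \<cong> hom(\<I>,Y)\<close>.\<close>

lemma alpha_iso [simp]:
  assumes [simp]: "X \<in> Obj C" "Y \<in> Obj C"
  shows "iso_arr C (alpha C X Y)"
proof -
  let ?H = "IHom C \<I> Y"
  define j where "j = curry_arr C Y \<I> Y (Run C Y)"
  have j [simp]: "j \<in> Arr C" "Dom C j = Y" "Cod C j = ?H" "Ev C \<I> Y \<cdot> (j \<otimes>\<^sub>m Idm C \<I>) = Run C Y"
    by (simp_all add: j_def)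
  have "iso_arr C j"
  proof (rule iso_arrI(1))
    let ?k = "Ev C \<I> Y \<cdot> Run_inv ?H"
    show "?k \<cdot> j = Idm C (Dom C j)"
      by (simp add: Run_inv_nat reassoc[OF j(4)])
    show "j \<cdot> ?k = Idm C (Cod C j)"
    proof (rule Ev_inject)
      have "Ev C \<I> Y \<cdot> ((j \<cdot> ?k) \<otimes>\<^sub>m Idm C \<I>) = Run C Y \<cdot> (?k \<otimes>\<^sub>m Idm C \<I>)"
        using reassoc[OF j(4), of "?k \<otimes>\<^sub>m Idm C \<I>"] by simp
      also have "\<dots> = Ev C \<I> Y \<cdot> (Idm C (Cod C j) \<otimes>\<^sub>m Idm C \<I>)"
        using Run_nat[of ?k Y] by simp
      finally show "Ev C \<I> Y \<cdot> ((j \<cdot> ?k) \<otimes>\<^sub>m Idm C \<I>) = Ev C \<I> Y \<cdot> (Idm C (Cod C j) \<otimes>\<^sub>m Idm C \<I>)" .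
    qed simp_all
  qed simp_all
  let ?K = "IHom C (\<I> \<otimes>\<^sub>o X) (Y \<otimes>\<^sub>o \<I>)"
  \<comment> \<open>\<open>h\<close> and \<open>h'\<close> are the mutually inverse transports
    between internal homs along the unit constraints of \<I> \<otimes> X and Y \<otimes>
    \<I>.\<close>
  define h where "h = curry_arr C ?K X Y (Run C Y \<cdot> Ev C (\<I> \<otimes>\<^sub>o X) (Y \<otimes>\<^sub>o \<I>) \<cdot> (Idm C ?K \<otimes>\<^sub>m Lun_inv X))"
  define h' where "h' = curry_arr C (IHom C X Y) (\<I> \<otimes>\<^sub>o X) (Y \<otimes>\<^sub>o \<I>)
      (Run_inv Y \<cdot> Ev C X Y \<cdot> (Idm C (IHom C X Y) \<otimes>\<^sub>m Lun C X))"
  have h [simp]: "h \<in> Arr C" "Dom C h = ?K" "Cod C h = IHom C X Y"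
    "Ev C X Y \<cdot> (h \<otimes>\<^sub>m Idm C X) = Run C Y \<cdot> Ev C (\<I> \<otimes>\<^sub>o X) (Y \<otimes>\<^sub>o \<I>) \<cdot> (Idm C ?K \<otimes>\<^sub>m Lun_inv X)"
    by (simp_all add: h_def)
  have h' [simp]: "h' \<in> Arr C" "Dom C h' = IHom C X Y" "Cod C h' = ?K"
    "Ev C (\<I> \<otimes>\<^sub>o X) (Y \<otimes>\<^sub>o \<I>) \<cdot> (h' \<otimes>\<^sub>m Idm C (\<I> \<otimes>\<^sub>o X))
      = Run_inv Y \<cdot> Ev C X Y \<cdot> (Idm C (IHom C X Y) \<otimes>\<^sub>m Lun C X)"
    by (simp_all add: h'_def)
  have Ev_h: "Ev C X Y \<cdot> ((h \<cdot> g) \<otimes>\<^sub>m Idm C X)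
      = Run C Y \<cdot> Ev C (\<I> \<otimes>\<^sub>o X) (Y \<otimes>\<^sub>o \<I>) \<cdot> (g \<otimes>\<^sub>m Lun_inv X)"
    if [simp]: "g \<in> Arr C" "Cod C g = ?K" for g
    using reassoc[OF h(4), of "g \<otimes>\<^sub>m Idm C X"] by simp
  have "iso_arr C h"
  proof (rule iso_arrI(1))
    show "h' \<cdot> h = Idm C (Dom C h)"
    proof (rule Ev_inject)
      have "Ev C (\<I> \<otimes>\<^sub>o X) (Y \<otimes>\<^sub>o \<I>) \<cdot> ((h' \<cdot> h) \<otimes>\<^sub>m Idm C (\<I> \<otimes>\<^sub>o X))
          = Run_inv Y \<cdot> (Ev C X Y \<cdot> (h \<otimes>\<^sub>m Idm C X)) \<cdot> (Idm C ?K \<otimes>\<^sub>m Lun C X)"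
        using reassoc[OF h'(4), of "h \<otimes>\<^sub>m Idm C (\<I> \<otimes>\<^sub>o X)"] by (simp del: h(4))
      then show "Ev C (\<I> \<otimes>\<^sub>o X) (Y \<otimes>\<^sub>o \<I>) \<cdot> ((h' \<cdot> h) \<otimes>\<^sub>m Idm C (\<I> \<otimes>\<^sub>o X))
          = Ev C (\<I> \<otimes>\<^sub>o X) (Y \<otimes>\<^sub>o \<I>) \<cdot> (Idm C (Dom C h) \<otimes>\<^sub>m Idm C (\<I> \<otimes>\<^sub>o X))"
        by simp
    qed simp_all
    show "h \<cdot> h' = Idm C (Cod C h)"
    proof (rule Ev_inject)
      have "Ev C X Y \<cdot> ((h \<cdot> h') \<otimes>\<^sub>m Idm C X)
          = Run C Y \<cdot> (Ev C (\<I> \<otimes>\<^sub>o X) (Y \<otimes>\<^sub>o \<I>) \<cdot> (h' \<otimes>\<^sub>m Idm C (\<I> \<otimes>\<^sub>o X))) \<cdot> (Idm C (IHom C X Y) \<otimes>\<^sub>m Lun_inv X)"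
        by (simp add: Ev_h del: h'(4))
      then show "Ev C X Y \<cdot> ((h \<cdot> h') \<otimes>\<^sub>m Idm C X) = Ev C X Y \<cdot> (Idm C (Cod C h) \<otimes>\<^sub>m Idm C X)"
        by simp
    qed simp_all
  qed simp_all
  let ?ev = "(Ev C \<I> Y \<otimes>\<^sub>m ev C X) \<cdot> mid_swap C ?H (X\<^sup>\<or>) \<I> X"
  define t where "t = curry_arr C (?H \<otimes>\<^sub>o X\<^sup>\<or>) (\<I> \<otimes>\<^sub>o X) (Y \<otimes>\<^sub>o \<I>) ?ev"
  \<comment> \<open>The dual of X is by definition the internal hom into \<I>, so rigidity for a
    list of two pairs applies to \<open>t\<close> literally.\<close>
  have "t = ihom_tens_map C [(\<I>, Y), (X, \<I>)]"
    by (simp add: t_def ihom_tens_map_def ihom_list_def dual_def ev_def)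
  then have "iso_arr C t"
    using ihom_tens_map_iso[of "[(\<I>, Y), (X, \<I>)]"] by simp
  have ms: "mid_swap C ?H (X\<^sup>\<or>) \<I> X \<in> Arr C"
    "Dom C (mid_swap C ?H (X\<^sup>\<or>) \<I> X) = (?H \<otimes>\<^sub>o X\<^sup>\<or>) \<otimes>\<^sub>o (\<I> \<otimes>\<^sub>o X)"
    "Cod C (mid_swap C ?H (X\<^sup>\<or>) \<I> X) = (?H \<otimes>\<^sub>o \<I>) \<otimes>\<^sub>o (X\<^sup>\<or> \<otimes>\<^sub>o X)"
    by (simp_all add: mid_swap_eq)
  have t [simp]: "t \<in> Arr C" "Dom C t = ?H \<otimes>\<^sub>o X\<^sup>\<or>" "Cod C t = ?K"
    "Ev C (\<I> \<otimes>\<^sub>o X) (Y \<otimes>\<^sub>o \<I>) \<cdot> (t \<otimes>\<^sub>m Idm C (\<I> \<otimes>\<^sub>o X)) = ?ev"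
    by (simp_all add: t_def ms)
  have "alpha C X Y = h \<cdot> t \<cdot> (j \<otimes>\<^sub>m Idm C (X\<^sup>\<or>))"
    unfolding alpha_def
  proof (rule curry_unique)
    have "Ev C X Y \<cdot> ((h \<cdot> t \<cdot> (j \<otimes>\<^sub>m Idm C (X\<^sup>\<or>))) \<otimes>\<^sub>m Idm C X)
        = Run C Y \<cdot> (Ev C (\<I> \<otimes>\<^sub>o X) (Y \<otimes>\<^sub>o \<I>) \<cdot> (t \<otimes>\<^sub>m Idm C (\<I> \<otimes>\<^sub>o X))) \<cdot> ((j \<otimes>\<^sub>m Idm C (X\<^sup>\<or>)) \<otimes>\<^sub>m Lun_inv X)"
      by (simp add: Ev_h del: t(4))
    also have "\<dots> = Run C Y \<cdot> (Ev C \<I> Y \<otimes>\<^sub>m ev C X) \<cdot> Asc_inv ?H \<I> (X\<^sup>\<or> \<otimes>\<^sub>o X)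
        \<cdot> (Idm C ?H \<otimes>\<^sub>m front_swap (X\<^sup>\<or>) \<I> X) \<cdot> Asc C ?H (X\<^sup>\<or>) (\<I> \<otimes>\<^sub>o X) \<cdot> ((j \<otimes>\<^sub>m Idm C (X\<^sup>\<or>)) \<otimes>\<^sub>m Lun_inv X)"
      by (simp add: ms) (simp add: mid_swap_eq)
    also have "\<dots> = Run C Y \<cdot> (Ev C \<I> Y \<otimes>\<^sub>m ev C X) \<cdot> Asc_inv ?H \<I> (X\<^sup>\<or> \<otimes>\<^sub>o X)
        \<cdot> (Idm C ?H \<otimes>\<^sub>m front_swap (X\<^sup>\<or>) \<I> X) \<cdot> (j \<otimes>\<^sub>m (Idm C (X\<^sup>\<or>) \<otimes>\<^sub>m Lun_inv X)) \<cdot> Asc C Y (X\<^sup>\<or>) X"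
      by (subst Asc_nat) simp_all
    \<comment> \<open>The middle swap built into \<open>ev_list\<close> only moves the unit here, so
      it reduces to a unit constraint.\<close>
    also have "\<dots> = Run C Y \<cdot> (Ev C \<I> Y \<otimes>\<^sub>m ev C X) \<cdot> Asc_inv ?H \<I> (X\<^sup>\<or> \<otimes>\<^sub>o X)
        \<cdot> (j \<otimes>\<^sub>m (Idm C \<I> \<otimes>\<^sub>m Idm C (X\<^sup>\<or> \<otimes>\<^sub>o X))) \<cdot> (Idm C Y \<otimes>\<^sub>m Lun_inv (X\<^sup>\<or> \<otimes>\<^sub>o X)) \<cdot> Asc C Y (X\<^sup>\<or>) X"
      by (simp add: front_swap_Unit)
    also have "\<dots> = Run C Y \<cdot> (Ev C \<I> Y \<otimes>\<^sub>m ev C X) \<cdot> ((j \<otimes>\<^sub>m Idm C \<I>) \<otimes>\<^sub>m Idm C (X\<^sup>\<or> \<otimes>\<^sub>o X))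
        \<cdot> Asc_inv Y \<I> (X\<^sup>\<or> \<otimes>\<^sub>o X) \<cdot> (Idm C Y \<otimes>\<^sub>m Lun_inv (X\<^sup>\<or> \<otimes>\<^sub>o X)) \<cdot> Asc C Y (X\<^sup>\<or>) X"
      by (subst reassoc[OF Asc_inv_nat]) simp_all
    also have "\<dots> = Run C Y \<cdot> (Idm C Y \<otimes>\<^sub>m ev C X) \<cdot> Asc C Y (X\<^sup>\<or>) X"
      by (simp add: reassoc[OF j(4)] flip: triangle_inv)
    finally show "Ev C X Y \<cdot> ((h \<cdot> t \<cdot> (j \<otimes>\<^sub>m Idm C (X\<^sup>\<or>))) \<otimes>\<^sub>m Idm C X)
        = Run C Y \<cdot> (Idm C Y \<otimes>\<^sub>m ev C X) \<cdot> Asc C Y (X\<^sup>\<or>) X" .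
  qed simp_all
  then show ?thesis
    using \<open>iso_arr C j\<close> \<open>iso_arr C h\<close> \<open>iso_arr C t\<close> by (simp add: iso_comp)
qed

section \<open>Transposes and Casimir elements\<close>

definition dual_transpose
  where "dual_transpose P Q R \<phi> = inv_arr C (alpha C Q R) \<cdot> curry_arr C P Q R \<phi>"

lemma
  assumes "\<phi> \<in> Arr C" "Dom C \<phi> = P \<otimes>\<^sub>o Q" "Cod C \<phi> = R" "P \<in> Obj C" "Q \<in> Obj C"
  shows dual_transpose_arr [simp]: "dual_transpose P Q R \<phi> \<in> Arr C" "Dom C (dual_transpose P Q R \<phi>) = P"
      "Cod C (dual_transpose P Q R \<phi>) = R \<otimes>\<^sub>o Q\<^sup>\<or>"
    and dual_transpose_ev: "Run C R \<cdot> (Idm C R \<otimes>\<^sub>m ev C Q) \<cdot> Asc C R (Q\<^sup>\<or>) Q \<cdot> (dual_transpose P Q R \<phi> \<otimes>\<^sub>m Idm C Q) = \<phi>"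
proof -
  have [simp]: "R \<in> Obj C" using Cod_Obj[OF assms(1)] assms(3) by simp
  note [simp] = assms
  show tr [simp]: "dual_transpose P Q R \<phi> \<in> Arr C" "Dom C (dual_transpose P Q R \<phi>) = P" "Cod C (dual_transpose P Q R \<phi>) = R \<otimes>\<^sub>o Q\<^sup>\<or>"
    by (simp_all add: dual_transpose_def)
  have "Run C R \<cdot> (Idm C R \<otimes>\<^sub>m ev C Q) \<cdot> Asc C R (Q\<^sup>\<or>) Q \<cdot> (dual_transpose P Q R \<phi> \<otimes>\<^sub>m Idm C Q)
      = Ev C Q R \<cdot> (alpha C Q R \<otimes>\<^sub>m Idm C Q) \<cdot> (dual_transpose P Q R \<phi> \<otimes>\<^sub>m Idm C Q)"
    by (subst reassoc[OF alpha_arr(4)]) simp_all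
  also have "\<dots> = \<phi>" by (simp add: dual_transpose_def)
  finally show "Run C R \<cdot> (Idm C R \<otimes>\<^sub>m ev C Q) \<cdot> Asc C R (Q\<^sup>\<or>) Q \<cdot> (dual_transpose P Q R \<phi> \<otimes>\<^sub>m Idm C Q) = \<phi>" .
qed

text \<open>\<open>alpha\<close> is invertible and \<open>Ev\<close> is universal, so a candidate
  for the transpose only has to be evaluated on Q; the inverse of \<open>alpha\<close> need not be
  known.\<close>

lemma dual_transpose_unique:
  assumes "Run C R \<cdot> (Idm C R \<otimes>\<^sub>m ev C Q) \<cdot> Asc C R (Q\<^sup>\<or>) Q \<cdot> (\<delta> \<otimes>\<^sub>m Idm C Q) = \<phi>"
    and [simp]: "\<delta> \<in> Arr C" "Dom C \<delta> = P" "Cod C \<delta> = R \<otimes>\<^sub>o Q\<^sup>\<or>" "Q \<in> Obj C" "R \<in> Obj C"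
  shows "dual_transpose P Q R \<phi> = \<delta>"
proof -
  have "curry_arr C P Q R \<phi> = alpha C Q R \<cdot> \<delta>"
  proof (rule curry_unique)
    show "Ev C Q R \<cdot> ((alpha C Q R \<cdot> \<delta>) \<otimes>\<^sub>m Idm C Q) = \<phi>"
      using reassoc[OF alpha_arr(4), of Q R "\<delta> \<otimes>\<^sub>m Idm C Q"] assms(1) by simp
  qed simp_all
  then show ?thesis by (simp add: dual_transpose_def)
qed

text \<open>The Casimir element is the transpose of the unit constraint. \<open>D_map\<close> and
  \<open>D_star\<close> are transposes too, so one evaluation rule,
  \<open>dual_transpose_ev\<close>, serves all three.\<close>

lemma casimir_dual_transpose: "casimir C X = dual_transpose \<I> X X (Lun C X)"
  by (simp add: casimir_def dual_transpose_def)

lemma casimir_arr [simp]: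
  assumes "X \<in> Obj C"
  shows "casimir C X \<in> Arr C" "Dom C (casimir C X) = \<I>" "Cod C (casimir C X) = X \<otimes>\<^sub>o X\<^sup>\<or>"
  using assms by (simp_all add: casimir_dual_transpose)

text \<open>One of the two snake identities. It is the evaluation rule for the Casimir element, with
  the unit constraint moved to the other side.\<close>

lemma casimir_zigzag:
  assumes [simp]: "X \<in> Obj C"
  shows "Run C X \<cdot> (Idm C X \<otimes>\<^sub>m ev C X) \<cdot> cup (casimir C X) X (X\<^sup>\<or>) X = Idm C X"
proof -
  have "Run C X \<cdot> (Idm C X \<otimes>\<^sub>m ev C X) \<cdot> Asc C X (X\<^sup>\<or>) X \<cdot> (casimir C X \<otimes>\<^sub>m Idm C X) = Lun C X"
    by (simp add: casimir_dual_transpose dual_transpose_ev)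
  then have "(Run C X \<cdot> (Idm C X \<otimes>\<^sub>m ev C X) \<cdot> Asc C X (X\<^sup>\<or>) X \<cdot> (casimir C X \<otimes>\<^sub>m Idm C X)) \<cdot> Lun_inv X
      = Lun C X \<cdot> Lun_inv X"
    by simp
  then show ?thesis by (simp add: cup_def)
qed

text \<open>The snake identity beside a further factor R. It recovers a map into X \<otimes> R from
  the contraction of its X leg, as \<open>D_star_eq\<close> requires.\<close>

lemma casimir_zigzag_tens:
  assumes [simp]: "X \<in> Obj C" "R \<in> Obj C"
  shows "(Idm C X \<otimes>\<^sub>m cap (ev C X) (X\<^sup>\<or>) X R) \<cdot> cup (casimir C X) X (X\<^sup>\<or>) (X \<otimes>\<^sub>o R) = Idm C (X \<otimes>\<^sub>o R)"
proof -
  let ?c = "cup (casimir C X) X (X\<^sup>\<or>) X" and ?R = "Idm C R"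
  have "(Idm C X \<otimes>\<^sub>m cap (ev C X) (X\<^sup>\<or>) X R) \<cdot> cup (casimir C X) X (X\<^sup>\<or>) (X \<otimes>\<^sub>o R)
     = (Idm C X \<otimes>\<^sub>m Lun C R) \<cdot> (Idm C X \<otimes>\<^sub>m (ev C X \<otimes>\<^sub>m ?R)) \<cdot> Asc C X (X\<^sup>\<or> \<otimes>\<^sub>o X) R \<cdot> (?c \<otimes>\<^sub>m ?R)"
    by (simp add: cap_def flip: cup_tens)
  also have "\<dots> = (Idm C X \<otimes>\<^sub>m Lun C R) \<cdot> Asc C X \<I> R \<cdot> ((Idm C X \<otimes>\<^sub>m ev C X) \<otimes>\<^sub>m ?R) \<cdot> (?c \<otimes>\<^sub>m ?R)"
    using reassoc[OF Asc_nat[of "Idm C X" "ev C X" ?R X \<I> R], of "?c \<otimes>\<^sub>m ?R"] by simp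
  also have "\<dots> = (Run C X \<cdot> (Idm C X \<otimes>\<^sub>m ev C X) \<cdot> ?c) \<otimes>\<^sub>m ?R"
    by (subst reassoc[OF triangle]) simp_all
  finally show ?thesis by (simp add: casimir_zigzag)
qed

text \<open>Rebracketing that brings the explicit formula for a transpose, tensored with U, into the
  form with \<open>cup\<close>.\<close>

lemma cup_tens_front:
  assumes [simp]: "\<phi> \<in> Arr C" "Dom C \<phi> = P \<otimes>\<^sub>o A" "Cod C \<phi> = R" "q \<in> Arr C" "Dom C q = \<I>" "Cod C q = A \<otimes>\<^sub>o B"
    "P \<in> Obj C" "A \<in> Obj C" "B \<in> Obj C" "U \<in> Obj C"
  shows "Asc C R B U \<cdot> (((\<phi> \<otimes>\<^sub>m Idm C B) \<cdot> Asc_inv P A B \<cdot> (Idm C P \<otimes>\<^sub>m q) \<cdot> Run_inv P) \<otimes>\<^sub>m Idm C U)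
     = (\<phi> \<otimes>\<^sub>m Idm C (B \<otimes>\<^sub>o U)) \<cdot> Asc_inv P A (B \<otimes>\<^sub>o U) \<cdot> (Idm C P \<otimes>\<^sub>m cup q A B U)"
proof -
  let ?U = "Idm C U"
  have [simp]: "R \<in> Obj C" using Cod_Obj[OF assms(1)] by simp
  have "Asc C R B U \<cdot> (((\<phi> \<otimes>\<^sub>m Idm C B) \<cdot> Asc_inv P A B \<cdot> (Idm C P \<otimes>\<^sub>m q) \<cdot> Run_inv P) \<otimes>\<^sub>m ?U)
      = Asc C R B U \<cdot> ((\<phi> \<otimes>\<^sub>m Idm C B) \<otimes>\<^sub>m ?U) \<cdot> (Asc_inv P A B \<otimes>\<^sub>m ?U)
         \<cdot> ((Idm C P \<otimes>\<^sub>m q) \<otimes>\<^sub>m ?U) \<cdot> (Run_inv P \<otimes>\<^sub>m ?U)"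
    by simp
  also have "\<dots> = (\<phi> \<otimes>\<^sub>m Idm C (B \<otimes>\<^sub>o U)) \<cdot> Asc C (P \<otimes>\<^sub>o A) B U \<cdot> (Asc_inv P A B \<otimes>\<^sub>m ?U)
         \<cdot> ((Idm C P \<otimes>\<^sub>m q) \<otimes>\<^sub>m ?U) \<cdot> (Run_inv P \<otimes>\<^sub>m ?U)"
    by (subst reassoc[OF Asc_nat]) simp_all
  also have "\<dots> = (\<phi> \<otimes>\<^sub>m Idm C (B \<otimes>\<^sub>o U)) \<cdot> (Asc_inv P A (B \<otimes>\<^sub>o U) \<cdot> (Idm C P \<otimes>\<^sub>m Asc C A B U)
         \<cdot> Asc C P (A \<otimes>\<^sub>o B) U) \<cdot> ((Idm C P \<otimes>\<^sub>m q) \<otimes>\<^sub>m ?U) \<cdot> (Run_inv P \<otimes>\<^sub>m ?U)"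
    by (subst reassoc[OF pentagon_inv[symmetric]]) simp_all
  also have "\<dots> = (\<phi> \<otimes>\<^sub>m Idm C (B \<otimes>\<^sub>o U)) \<cdot> Asc_inv P A (B \<otimes>\<^sub>o U) \<cdot> (Idm C P \<otimes>\<^sub>m Asc C A B U)
         \<cdot> Asc C P (A \<otimes>\<^sub>o B) U \<cdot> ((Idm C P \<otimes>\<^sub>m q) \<otimes>\<^sub>m ?U) \<cdot> (Run_inv P \<otimes>\<^sub>m ?U)"
    by simp
  also have "\<dots> = (\<phi> \<otimes>\<^sub>m Idm C (B \<otimes>\<^sub>o U)) \<cdot> Asc_inv P A (B \<otimes>\<^sub>o U) \<cdot> (Idm C P \<otimes>\<^sub>m Asc C A B U)
         \<cdot> (Idm C P \<otimes>\<^sub>m (q \<otimes>\<^sub>m ?U)) \<cdot> Asc C P \<I> U \<cdot> (Run_inv P \<otimes>\<^sub>m ?U)"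
    by (subst reassoc[OF Asc_nat]) simp_all
  also have "\<dots> = (\<phi> \<otimes>\<^sub>m Idm C (B \<otimes>\<^sub>o U)) \<cdot> Asc_inv P A (B \<otimes>\<^sub>o U) \<cdot> (Idm C P \<otimes>\<^sub>m cup q A B U)"
    by (simp add: triangle_inv cup_def)
  finally show ?thesis .
qed

text \<open>By uniqueness it is enough to evaluate the right side on Q, where the Casimir element
  meets \<open>ev C Q\<close> and the snake identity straightens the two.\<close>

lemma dual_transpose_eq:
  assumes [simp]: "\<phi> \<in> Arr C" "Dom C \<phi> = P \<otimes>\<^sub>o Q" "Cod C \<phi> = R" "P \<in> Obj C" "Q \<in> Obj C"
  shows "dual_transpose P Q R \<phi> = (\<phi> \<otimes>\<^sub>m Idm C (Q\<^sup>\<or>)) \<cdot> Asc_inv P Q (Q\<^sup>\<or>) \<cdot> (Idm C P \<otimes>\<^sub>m casimir C Q) \<cdot> Run_inv P"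
proof (rule dual_transpose_unique)
  show [simp]: "R \<in> Obj C" using Cod_Obj[OF assms(1)] by simp
  let ?c = "cup (casimir C Q) Q (Q\<^sup>\<or>) Q"
  have "Run C R \<cdot> (Idm C R \<otimes>\<^sub>m ev C Q) \<cdot> Asc C R (Q\<^sup>\<or>) Q
      \<cdot> (((\<phi> \<otimes>\<^sub>m Idm C (Q\<^sup>\<or>)) \<cdot> Asc_inv P Q (Q\<^sup>\<or>) \<cdot> (Idm C P \<otimes>\<^sub>m casimir C Q) \<cdot> Run_inv P) \<otimes>\<^sub>m Idm C Q)
      = Run C R \<cdot> (\<phi> \<otimes>\<^sub>m Idm C \<I>) \<cdot> ((Idm C P \<otimes>\<^sub>m Idm C Q) \<otimes>\<^sub>m ev C Q) \<cdot> Asc_inv P Q (Q\<^sup>\<or> \<otimes>\<^sub>o Q) \<cdot> (Idm C P \<otimes>\<^sub>m ?c)"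
    by (subst cup_tens_front) simp_all
  also have "\<dots> = Run C R \<cdot> (\<phi> \<otimes>\<^sub>m Idm C \<I>) \<cdot> Asc_inv P Q \<I> \<cdot> (Idm C P \<otimes>\<^sub>m (Idm C Q \<otimes>\<^sub>m ev C Q)) \<cdot> (Idm C P \<otimes>\<^sub>m ?c)"
    using reassoc[OF Asc_inv_nat[of "Idm C P" "Idm C Q" "ev C Q" P Q \<I>], of "Idm C P \<otimes>\<^sub>m ?c"] by simp
  also have "\<dots> = \<phi> \<cdot> Run C (P \<otimes>\<^sub>o Q) \<cdot> Asc_inv P Q \<I> \<cdot> (Idm C P \<otimes>\<^sub>m (Idm C Q \<otimes>\<^sub>m ev C Q)) \<cdot> (Idm C P \<otimes>\<^sub>m ?c)"
    by (subst reassoc[OF Run_nat]) simp_all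
  also have "\<dots> = \<phi> \<cdot> (Idm C P \<otimes>\<^sub>m (Run C Q \<cdot> (Idm C Q \<otimes>\<^sub>m ev C Q) \<cdot> ?c))"
    by (simp flip: Run_tens)
  also have "\<dots> = \<phi>" by (simp add: casimir_zigzag)
  finally show "Run C R \<cdot> (Idm C R \<otimes>\<^sub>m ev C Q) \<cdot> Asc C R (Q\<^sup>\<or>) Q
      \<cdot> (((\<phi> \<otimes>\<^sub>m Idm C (Q\<^sup>\<or>)) \<cdot> Asc_inv P Q (Q\<^sup>\<or>) \<cdot> (Idm C P \<otimes>\<^sub>m casimir C Q) \<cdot> Run_inv P) \<otimes>\<^sub>m Idm C Q) = \<phi>" .
qed simp_all

text \<open>The bidual maps built into \<open>imult_star\<close> turn \<open>evt\<close> of the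
  duals of Q and R into \<open>ev\<close> of Q and R. So \<open>imult_star\<close> obeys the
  adjunction of \<open>imult\<close> with \<open>ev\<close> in place of \<open>evt\<close>, and
  \<open>imult_flip\<close> and \<open>imult_pairing\<close> cover both.\<close>

lemma
  assumes "\<psi> \<in> Arr C" "Dom C \<psi> = P \<otimes>\<^sub>o Q\<^sup>\<or>" "Cod C \<psi> = R\<^sup>\<or>" "P \<in> Obj C" "Q \<in> Obj C" "R \<in> Obj C"
  shows imult_star_arr [simp]: "imult_star C P Q R \<psi> \<in> Arr C"
      "Dom C (imult_star C P Q R \<psi>) = P \<otimes>\<^sub>o R" "Cod C (imult_star C P Q R \<psi>) = Q"
    and ev_imult_star: "ev C Q \<cdot> (Idm C (Q\<^sup>\<or>) \<otimes>\<^sub>m imult_star C P Q R \<psi>) \<cdot> front_swap P (Q\<^sup>\<or>) R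
      = ev C R \<cdot> (\<psi> \<otimes>\<^sub>m Idm C R) \<cdot> Asc_inv P (Q\<^sup>\<or>) R"
proof -
  note [simp] = assms
  let ?\<iota> = "imult C P (Q\<^sup>\<or>) (R\<^sup>\<or>) \<psi>" and ?i = "bidual_map C"
  show [simp]: "imult_star C P Q R \<psi> \<in> Arr C" "Dom C (imult_star C P Q R \<psi>) = P \<otimes>\<^sub>o R"
    "Cod C (imult_star C P Q R \<psi>) = Q"
    by (simp_all add: imult_star_def)
  have "ev C Q \<cdot> (Idm C (Q\<^sup>\<or>) \<otimes>\<^sub>m imult_star C P Q R \<psi>) \<cdot> front_swap P (Q\<^sup>\<or>) R
     = evt C (Q\<^sup>\<or>) \<cdot> (Idm C (Q\<^sup>\<or>) \<otimes>\<^sub>m ?\<iota>) \<cdot> (Idm C (Q\<^sup>\<or>) \<otimes>\<^sub>m (Idm C P \<otimes>\<^sub>m ?i R)) \<cdot> front_swap P (Q\<^sup>\<or>) R"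
    by (simp add: imult_star_def flip: evt_bidual_map)
  also have "\<dots> = evt C (Q\<^sup>\<or>) \<cdot> (Idm C (Q\<^sup>\<or>) \<otimes>\<^sub>m ?\<iota>) \<cdot> front_swap P (Q\<^sup>\<or>) ((R\<^sup>\<or>)\<^sup>\<or>)
      \<cdot> (Idm C P \<otimes>\<^sub>m (Idm C (Q\<^sup>\<or>) \<otimes>\<^sub>m ?i R))"
    by (simp add: front_swap_nat)
  also have "\<dots> = (evt C (R\<^sup>\<or>) \<cdot> (\<psi> \<otimes>\<^sub>m Idm C ((R\<^sup>\<or>)\<^sup>\<or>)) \<cdot> Asc_inv P (Q\<^sup>\<or>) ((R\<^sup>\<or>)\<^sup>\<or>))
      \<cdot> (Idm C P \<otimes>\<^sub>m (Idm C (Q\<^sup>\<or>) \<otimes>\<^sub>m ?i R))"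
    by (rule reassoc3[OF evt_imult]) simp_all
  also have "\<dots> = evt C (R\<^sup>\<or>) \<cdot> (Idm C (R\<^sup>\<or>) \<otimes>\<^sub>m ?i R) \<cdot> (\<psi> \<otimes>\<^sub>m Idm C R) \<cdot> Asc_inv P (Q\<^sup>\<or>) R"
    by (simp add: Asc_inv_nat)
  also have "\<dots> = ev C R \<cdot> (\<psi> \<otimes>\<^sub>m Idm C R) \<cdot> Asc_inv P (Q\<^sup>\<or>) R"
    by (subst reassoc[OF evt_bidual_map]) simp_all
  finally show "ev C Q \<cdot> (Idm C (Q\<^sup>\<or>) \<otimes>\<^sub>m imult_star C P Q R \<psi>) \<cdot> front_swap P (Q\<^sup>\<or>) R
      = ev C R \<cdot> (\<psi> \<otimes>\<^sub>m Idm C R) \<cdot> Asc_inv P (Q\<^sup>\<or>) R" .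
qed

section \<open>The composites of the maps \<open>D\<close>\<close>

text \<open>In the notation of elements, \<open>contraction S X Y a d (s \<otimes> s*)\<close> is
  \<open>\<Sum>\<^sub>i \<langle>a(s,x\<^sub>i), d(x\<^sub>i*,s*)\<rangle>\<close> with \<open>\<Sum>\<^sub>i x\<^sub>i \<otimes> x\<^sub>i*\<close> the Casimir element of \<open>X\<close>.\<close>

definition contraction
  where "contraction S X Y a d = evt C Y \<cdot> (a \<otimes>\<^sub>m d) \<cdot> Asc_inv S X (X\<^sup>\<or> \<otimes>\<^sub>o S\<^sup>\<or>)
    \<cdot> (Idm C S \<otimes>\<^sub>m cup (casimir C X) X (X\<^sup>\<or>) (S\<^sup>\<or>))"

lemma
  assumes "a \<in> Arr C" "Dom C a = S \<otimes>\<^sub>o X" "Cod C a = Y" "S \<in> Obj C" "X \<in> Obj C" "Y \<in> Obj C"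
  shows D_map_arr [simp]: "D_map C S X Y a \<in> Arr C" "Dom C (D_map C S X Y a) = S"
    "Cod C (D_map C S X Y a) = X\<^sup>\<or> \<otimes>\<^sub>o (Y\<^sup>\<or>)\<^sup>\<or>"
    and D_map_ev: "Run C (X\<^sup>\<or>) \<cdot> (Idm C (X\<^sup>\<or>) \<otimes>\<^sub>m ev C (Y\<^sup>\<or>)) \<cdot> Asc C (X\<^sup>\<or>) ((Y\<^sup>\<or>)\<^sup>\<or>) (Y\<^sup>\<or>)
      \<cdot> (D_map C S X Y a \<otimes>\<^sub>m Idm C (Y\<^sup>\<or>)) = imult C S X Y a"
  using assms dual_transpose_arr[of "imult C S X Y a" S "Y\<^sup>\<or>" "X\<^sup>\<or>"]
    dual_transpose_ev[of "imult C S X Y a" S "Y\<^sup>\<or>" "X\<^sup>\<or>"]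
  by (simp_all add: D_map_def flip: dual_transpose_def)

lemma
  assumes "d \<in> Arr C" "Dom C d = T \<otimes>\<^sub>o S\<^sup>\<or>" "Cod C d = Y\<^sup>\<or>" "T \<in> Obj C" "S \<in> Obj C" "Y \<in> Obj C"
  shows D_star_arr [simp]: "D_star C T S Y d \<in> Arr C" "Dom C (D_star C T S Y d) = T"
    "Cod C (D_star C T S Y d) = S \<otimes>\<^sub>o Y\<^sup>\<or>"
    and D_star_ev: "Run C S \<cdot> (Idm C S \<otimes>\<^sub>m ev C Y) \<cdot> Asc C S (Y\<^sup>\<or>) Y \<cdot> (D_star C T S Y d \<otimes>\<^sub>m Idm C Y)
      = imult_star C T S Y d"
  using assms dual_transpose_arr[of "imult_star C T S Y d" T Y S]
    dual_transpose_ev[of "imult_star C T S Y d" T Y S]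
  by (simp_all add: D_star_def flip: dual_transpose_def)

text \<open>By \<open>imult_pairing\<close>, passing to the internal multiplication and then
  contracting with X gives back \<open>a\<close>. Hence \<open>D_map\<close> is the plain transpose
  of \<open>a\<close> up to \<tau> and the bidual map.\<close>

lemma D_map_eq:
  assumes [simp]: "a \<in> Arr C" "Dom C a = S \<otimes>\<^sub>o X" "Cod C a = Y" "S \<in> Obj C" "X \<in> Obj C" "Y \<in> Obj C"
  shows "D_map C S X Y a = (Idm C (X\<^sup>\<or>) \<otimes>\<^sub>m bidual_map C Y) \<cdot> \<tau> Y (X\<^sup>\<or>) \<cdot> dual_transpose S X Y a"
proof -
  \<comment> \<open>Stripping off the bidual map turns \<open>ev\<close> of the dual of Y into
    \<open>evt C Y\<close>, the pairing for which \<open>evt_imult\<close> holds.\<close>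
  define \<delta> where "\<delta> = (Idm C (X\<^sup>\<or>) \<otimes>\<^sub>m inv_arr C (bidual_map C Y)) \<cdot> D_map C S X Y a"
  have \<delta> [simp]: "\<delta> \<in> Arr C" "Dom C \<delta> = S" "Cod C \<delta> = X\<^sup>\<or> \<otimes>\<^sub>o Y"
    by (simp_all add: \<delta>_def)
  have D: "D_map C S X Y a = (Idm C (X\<^sup>\<or>) \<otimes>\<^sub>m bidual_map C Y) \<cdot> \<delta>"
    by (simp add: \<delta>_def)
  have "Run C (X\<^sup>\<or>) \<cdot> (Idm C (X\<^sup>\<or>) \<otimes>\<^sub>m evt C Y) \<cdot> Asc C (X\<^sup>\<or>) Y (Y\<^sup>\<or>) \<cdot> (\<delta> \<otimes>\<^sub>m Idm C (Y\<^sup>\<or>))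
      = Run C (X\<^sup>\<or>) \<cdot> (Idm C (X\<^sup>\<or>) \<otimes>\<^sub>m ev C (Y\<^sup>\<or>)) \<cdot> (Idm C (X\<^sup>\<or>) \<otimes>\<^sub>m (bidual_map C Y \<otimes>\<^sub>m Idm C (Y\<^sup>\<or>)))
          \<cdot> Asc C (X\<^sup>\<or>) Y (Y\<^sup>\<or>) \<cdot> (\<delta> \<otimes>\<^sub>m Idm C (Y\<^sup>\<or>))"
    by simp
  also have "\<dots> = Run C (X\<^sup>\<or>) \<cdot> (Idm C (X\<^sup>\<or>) \<otimes>\<^sub>m ev C (Y\<^sup>\<or>)) \<cdot> Asc C (X\<^sup>\<or>) ((Y\<^sup>\<or>)\<^sup>\<or>) (Y\<^sup>\<or>)
          \<cdot> ((Idm C (X\<^sup>\<or>) \<otimes>\<^sub>m bidual_map C Y) \<otimes>\<^sub>m Idm C (Y\<^sup>\<or>)) \<cdot> (\<delta> \<otimes>\<^sub>m Idm C (Y\<^sup>\<or>))"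
    by (subst reassoc[OF Asc_nat]) simp_all
  also have "\<dots> = imult C S X Y a"
    using D_map_ev[of a S X Y] by (simp add: D)
  finally have \<delta>_ev: "Run C (X\<^sup>\<or>) \<cdot> (Idm C (X\<^sup>\<or>) \<otimes>\<^sub>m evt C Y) \<cdot> Asc C (X\<^sup>\<or>) Y (Y\<^sup>\<or>) \<cdot> (\<delta> \<otimes>\<^sub>m Idm C (Y\<^sup>\<or>))
      = imult C S X Y a" .
  have "evt C Y \<cdot> ((cap (evt C X) X (X\<^sup>\<or>) Y \<cdot> (Idm C X \<otimes>\<^sub>m \<delta>)) \<otimes>\<^sub>m Idm C (Y\<^sup>\<or>))
      = evt C Y \<cdot> ((a \<cdot> \<tau> X S) \<otimes>\<^sub>m Idm C (Y\<^sup>\<or>))"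
    by (rule imult_pairing[OF evt_imult \<delta>_ev]) simp_all
  then have cap: "cap (evt C X) X (X\<^sup>\<or>) Y \<cdot> (Idm C X \<otimes>\<^sub>m \<delta>) = a \<cdot> \<tau> X S"
    by (rule evt_inject) simp_all
  have "dual_transpose S X Y a = \<tau> (X\<^sup>\<or>) Y \<cdot> \<delta>"
  proof (rule dual_transpose_unique)
    have "Run C Y \<cdot> (Idm C Y \<otimes>\<^sub>m ev C X) \<cdot> Asc C Y (X\<^sup>\<or>) X \<cdot> ((\<tau> (X\<^sup>\<or>) Y \<cdot> \<delta>) \<otimes>\<^sub>m Idm C X)
        = (Run C Y \<cdot> (Idm C Y \<otimes>\<^sub>m ev C X) \<cdot> Asc C Y (X\<^sup>\<or>) X \<cdot> (\<tau> (X\<^sup>\<or>) Y \<otimes>\<^sub>m Idm C X)) \<cdot> (\<delta> \<otimes>\<^sub>m Idm C X)"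
      by simp
    also have "\<dots> = (cap (evt C X) X (X\<^sup>\<or>) Y \<cdot> \<tau> (X\<^sup>\<or> \<otimes>\<^sub>o Y) X) \<cdot> (\<delta> \<otimes>\<^sub>m Idm C X)"
      by (subst cap_Sym) (simp_all add: evt_def)
    also have "\<dots> = cap (evt C X) X (X\<^sup>\<or>) Y \<cdot> (Idm C X \<otimes>\<^sub>m \<delta>) \<cdot> \<tau> S X"
      by (simp add: Sym_nat)
    also have "\<dots> = a"
      by (simp add: reassoc[OF cap])
    finally show "Run C Y \<cdot> (Idm C Y \<otimes>\<^sub>m ev C X) \<cdot> Asc C Y (X\<^sup>\<or>) X \<cdot> ((\<tau> (X\<^sup>\<or>) Y \<cdot> \<delta>) \<otimes>\<^sub>m Idm C X) = a" .
  qed simp_all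
  then show ?thesis by (simp add: D)
qed

lemma D_star_eq:
  assumes [simp]: "d \<in> Arr C" "Dom C d = T \<otimes>\<^sub>o S\<^sup>\<or>" "Cod C d = Y\<^sup>\<or>" "T \<in> Obj C" "S \<in> Obj C" "Y \<in> Obj C"
  shows "D_star C T S Y d = (Idm C S \<otimes>\<^sub>m (d \<cdot> \<tau> (S\<^sup>\<or>) T)) \<cdot> cup (casimir C S) S (S\<^sup>\<or>) T"
proof -
  let ?D = "D_star C T S Y d"
  have "ev C Y \<cdot> ((cap (ev C S) (S\<^sup>\<or>) S (Y\<^sup>\<or>) \<cdot> (Idm C (S\<^sup>\<or>) \<otimes>\<^sub>m ?D)) \<otimes>\<^sub>m Idm C Y)
      = ev C Y \<cdot> ((d \<cdot> \<tau> (S\<^sup>\<or>) T) \<otimes>\<^sub>m Idm C Y)"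
    by (rule imult_pairing[OF ev_imult_star D_star_ev]) simp_all
  then have cap: "cap (ev C S) (S\<^sup>\<or>) S (Y\<^sup>\<or>) \<cdot> (Idm C (S\<^sup>\<or>) \<otimes>\<^sub>m ?D) = d \<cdot> \<tau> (S\<^sup>\<or>) T"
    by (rule ev_inject) simp_all
  \<comment> \<open>The contraction of the S leg of \<open>?D\<close> has just been found; the snake
    identity recovers \<open>?D\<close> from it.\<close>
  have "?D = (Idm C S \<otimes>\<^sub>m cap (ev C S) (S\<^sup>\<or>) S (Y\<^sup>\<or>)) \<cdot> cup (casimir C S) S (S\<^sup>\<or>) (S \<otimes>\<^sub>o Y\<^sup>\<or>) \<cdot> ?D"
    by (simp add: reassoc[OF casimir_zigzag_tens])
  also have "\<dots> = (Idm C S \<otimes>\<^sub>m (d \<cdot> \<tau> (S\<^sup>\<or>) T)) \<cdot> cup (casimir C S) S (S\<^sup>\<or>) T"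
    by (simp add: cup_nat cap)
  finally show ?thesis .
qed

text \<open>The bidual map of \<open>D_map_eq\<close> cancels against \<open>evt\<close> of the dual
  of Y and leaves \<open>ev C Y\<close>; evaluating \<open>D_star\<close> on Y then gives back
  \<open>imult_star\<close>.\<close>

lemma D_composite_eq:
  assumes [simp]: "a \<in> Arr C" "Dom C a = S \<otimes>\<^sub>o X" "Cod C a = Y"
    "d \<in> Arr C" "Dom C d = X\<^sup>\<or> \<otimes>\<^sub>o S\<^sup>\<or>" "Cod C d = Y\<^sup>\<or>" "S \<in> Obj C" "X \<in> Obj C" "Y \<in> Obj C"
  shows "Run C S \<cdot> (Idm C S \<otimes>\<^sub>m evt C (Y\<^sup>\<or>)) \<cdot> Asc C S (Y\<^sup>\<or>) ((Y\<^sup>\<or>)\<^sup>\<or>)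
      \<cdot> (D_star C (X\<^sup>\<or>) S Y d \<otimes>\<^sub>m Idm C ((Y\<^sup>\<or>)\<^sup>\<or>)) \<cdot> D_map C S X Y a
    = imult_star C (X\<^sup>\<or>) S Y d \<cdot> \<tau> Y (X\<^sup>\<or>) \<cdot> dual_transpose S X Y a" (is "?l = _")
proof -
  let ?D = "D_star C (X\<^sup>\<or>) S Y d" and ?t = "\<tau> Y (X\<^sup>\<or>) \<cdot> dual_transpose S X Y a"
  have "?l = Run C S \<cdot> (Idm C S \<otimes>\<^sub>m evt C (Y\<^sup>\<or>)) \<cdot> Asc C S (Y\<^sup>\<or>) ((Y\<^sup>\<or>)\<^sup>\<or>)
      \<cdot> ((Idm C S \<otimes>\<^sub>m Idm C (Y\<^sup>\<or>)) \<otimes>\<^sub>m bidual_map C Y) \<cdot> (?D \<otimes>\<^sub>m Idm C Y) \<cdot> ?t"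
    by (simp add: D_map_eq)
  also have "\<dots> = Run C S \<cdot> (Idm C S \<otimes>\<^sub>m evt C (Y\<^sup>\<or>)) \<cdot> (Idm C S \<otimes>\<^sub>m (Idm C (Y\<^sup>\<or>) \<otimes>\<^sub>m bidual_map C Y))
      \<cdot> Asc C S (Y\<^sup>\<or>) Y \<cdot> (?D \<otimes>\<^sub>m Idm C Y) \<cdot> ?t"
    by (subst reassoc[OF Asc_nat]) simp_all
  also have "\<dots> = (Run C S \<cdot> (Idm C S \<otimes>\<^sub>m ev C Y) \<cdot> Asc C S (Y\<^sup>\<or>) Y \<cdot> (?D \<otimes>\<^sub>m Idm C Y)) \<cdot> ?t"
    by (simp add: evt_bidual_map)
  also have "\<dots> = imult_star C (X\<^sup>\<or>) S Y d \<cdot> ?t"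
    by (subst D_star_ev) simp_all
  finally show ?thesis .
qed

text \<open>After pairing with the dual of S, \<open>imult_flip\<close> trades
  \<open>imult_star\<close> for \<open>d\<close>, and the transpose of \<open>a\<close> contributes
  the Casimir element of X.\<close>

lemma evt_D_composite:
  assumes [simp]: "a \<in> Arr C" "Dom C a = S \<otimes>\<^sub>o X" "Cod C a = Y"
    "d \<in> Arr C" "Dom C d = X\<^sup>\<or> \<otimes>\<^sub>o S\<^sup>\<or>" "Cod C d = Y\<^sup>\<or>" "S \<in> Obj C" "X \<in> Obj C" "Y \<in> Obj C"
  shows "evt C S \<cdot> ((imult_star C (X\<^sup>\<or>) S Y d \<cdot> \<tau> Y (X\<^sup>\<or>) \<cdot> dual_transpose S X Y a) \<otimes>\<^sub>m Idm C (S\<^sup>\<or>))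
     = contraction S X Y a d"
proof -
  have "evt C S \<cdot> ((imult_star C (X\<^sup>\<or>) S Y d \<cdot> \<tau> Y (X\<^sup>\<or>) \<cdot> dual_transpose S X Y a) \<otimes>\<^sub>m Idm C (S\<^sup>\<or>))
     = (ev C S \<cdot> \<tau> S (S\<^sup>\<or>) \<cdot> ((imult_star C (X\<^sup>\<or>) S Y d \<cdot> \<tau> Y (X\<^sup>\<or>)) \<otimes>\<^sub>m Idm C (S\<^sup>\<or>)))
         \<cdot> (dual_transpose S X Y a \<otimes>\<^sub>m Idm C (S\<^sup>\<or>))"
    by (simp add: evt_def)
  also have "\<dots> = (ev C Y \<cdot> \<tau> Y (Y\<^sup>\<or>) \<cdot> (Idm C Y \<otimes>\<^sub>m d) \<cdot> Asc C Y (X\<^sup>\<or>) (S\<^sup>\<or>))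
         \<cdot> (dual_transpose S X Y a \<otimes>\<^sub>m Idm C (S\<^sup>\<or>))"
    by (subst imult_flip[where R = "Y\<^sup>\<or>", OF ev_imult_star]) simp_all
  also have "\<dots> = evt C Y \<cdot> (Idm C Y \<otimes>\<^sub>m d) \<cdot> Asc C Y (X\<^sup>\<or>) (S\<^sup>\<or>) \<cdot> (dual_transpose S X Y a \<otimes>\<^sub>m Idm C (S\<^sup>\<or>))"
    by (simp add: evt_def)
  also have "\<dots> = contraction S X Y a d"
    unfolding dual_transpose_eq[of a S X Y, simplified] contraction_def by (subst cup_tens_front) simp_all
  finally show ?thesis .
qed

text \<open>Here evaluating \<open>D_map\<close> gives back \<open>imult\<close>, which
  \<open>evt_imult\<close> trades for \<open>b\<close>, while the Casimir element of X comes from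
  \<open>D_star_eq\<close>. Both structure maps appear transposed for this reason.\<close>

lemma evt_dual_D_composite:
  assumes [simp]: "b \<in> Arr C" "Dom C b = X \<otimes>\<^sub>o S" "Cod C b = Y"
    "c \<in> Arr C" "Dom C c = S\<^sup>\<or> \<otimes>\<^sub>o X\<^sup>\<or>" "Cod C c = Y\<^sup>\<or>" "S \<in> Obj C" "X \<in> Obj C" "Y \<in> Obj C"
  shows "evt C S \<cdot> (Idm C S \<otimes>\<^sub>m (Run C (S\<^sup>\<or>) \<cdot> (Idm C (S\<^sup>\<or>) \<otimes>\<^sub>m ev C (Y\<^sup>\<or>)) \<cdot> Asc C (S\<^sup>\<or>) ((Y\<^sup>\<or>)\<^sup>\<or>) (Y\<^sup>\<or>)
      \<cdot> (D_map C X S Y b \<otimes>\<^sub>m Idm C (Y\<^sup>\<or>)) \<cdot> D_star C (S\<^sup>\<or>) X Y c))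
    = contraction S X Y (b \<cdot> \<tau> S X) (c \<cdot> \<tau> (X\<^sup>\<or>) (S\<^sup>\<or>))"
proof -
  let ?\<iota> = "imult C X S Y b" and ?D = "D_star C (S\<^sup>\<or>) X Y c" and ?c = "cup (casimir C X) X (X\<^sup>\<or>) (S\<^sup>\<or>)"
  let ?c\<tau> = "c \<cdot> \<tau> (X\<^sup>\<or>) (S\<^sup>\<or>)"
  have "Run C (S\<^sup>\<or>) \<cdot> (Idm C (S\<^sup>\<or>) \<otimes>\<^sub>m ev C (Y\<^sup>\<or>)) \<cdot> Asc C (S\<^sup>\<or>) ((Y\<^sup>\<or>)\<^sup>\<or>) (Y\<^sup>\<or>)
      \<cdot> (D_map C X S Y b \<otimes>\<^sub>m Idm C (Y\<^sup>\<or>)) \<cdot> ?D = (Run C (S\<^sup>\<or>) \<cdot> (Idm C (S\<^sup>\<or>) \<otimes>\<^sub>m ev C (Y\<^sup>\<or>)) \<cdot> Asc C (S\<^sup>\<or>) ((Y\<^sup>\<or>)\<^sup>\<or>) (Y\<^sup>\<or>)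
      \<cdot> (D_map C X S Y b \<otimes>\<^sub>m Idm C (Y\<^sup>\<or>))) \<cdot> ?D"
    by simp
  moreover have "\<dots> = ?\<iota> \<cdot> ?D"
    by (subst D_map_ev) simp_all
  moreover have "evt C S \<cdot> (Idm C S \<otimes>\<^sub>m (?\<iota> \<cdot> ?D))
     = (evt C S \<cdot> (Idm C S \<otimes>\<^sub>m ?\<iota>) \<cdot> front_swap X S (Y\<^sup>\<or>)) \<cdot> front_swap S X (Y\<^sup>\<or>) \<cdot> (Idm C S \<otimes>\<^sub>m ?D)"
    by simp
  moreover have "\<dots> = evt C Y \<cdot> (b \<otimes>\<^sub>m Idm C (Y\<^sup>\<or>)) \<cdot> Asc_inv X S (Y\<^sup>\<or>) \<cdot> front_swap S X (Y\<^sup>\<or>) \<cdot> (Idm C S \<otimes>\<^sub>m ?D)"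
    by (subst evt_imult) simp_all
  moreover have "\<dots> = evt C Y \<cdot> ((b \<cdot> \<tau> S X) \<otimes>\<^sub>m Idm C (Y\<^sup>\<or>)) \<cdot> Asc_inv S X (Y\<^sup>\<or>)
      \<cdot> (Idm C S \<otimes>\<^sub>m (Idm C X \<otimes>\<^sub>m ?c\<tau>)) \<cdot> (Idm C S \<otimes>\<^sub>m ?c)"
    by (simp add: front_swap_def D_star_eq)
  moreover have "\<dots> = contraction S X Y (b \<cdot> \<tau> S X) ?c\<tau>"
    unfolding contraction_def by (subst reassoc[OF Asc_inv_nat]) simp_all
  ultimately show ?thesis by metis
qed

section \<open>Contractions of the two sides of (Com) and (Cas)\<close>

lemma bracket_contraction:
  assumes [simp]: "a \<in> Arr C" "Dom C a = S \<otimes>\<^sub>o X" "Cod C a = Y"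
    "c \<in> Arr C" "Dom C c = S\<^sup>\<or> \<otimes>\<^sub>o X\<^sup>\<or>" "Cod C c = Y\<^sup>\<or>" "S \<in> Obj C" "X \<in> Obj C" "Y \<in> Obj C"
  shows "evt C Y \<cdot> bracket_map C S X a c \<cdot> (Idm C (S \<otimes>\<^sub>o S\<^sup>\<or>) \<otimes>\<^sub>m casimir C X) \<cdot> Run_inv (S \<otimes>\<^sub>o S\<^sup>\<or>)
    = contraction S X Y a (c \<cdot> \<tau> (X\<^sup>\<or>) (S\<^sup>\<or>))"
proof -
  let ?S = "S\<^sup>\<or>" and ?X = "X\<^sup>\<or>" and ?C = "casimir C X"
  let ?c = "cup ?C X ?X ?S"
  have "evt C Y \<cdot> bracket_map C S X a c \<cdot> (Idm C (S \<otimes>\<^sub>o ?S) \<otimes>\<^sub>m ?C) \<cdot> Run_inv (S \<otimes>\<^sub>o ?S)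
     = evt C Y \<cdot> (a \<otimes>\<^sub>m c) \<cdot> Asc_inv S X (?S \<otimes>\<^sub>o ?X) \<cdot> (Idm C S \<otimes>\<^sub>m front_swap ?S X ?X)
         \<cdot> Asc C S ?S (X \<otimes>\<^sub>o ?X) \<cdot> ((Idm C S \<otimes>\<^sub>m Idm C ?S) \<otimes>\<^sub>m ?C) \<cdot> Run_inv (S \<otimes>\<^sub>o ?S)"
    by (simp add: bracket_map_def mid_swap_eq)
  also have "\<dots> = evt C Y \<cdot> (a \<otimes>\<^sub>m c) \<cdot> Asc_inv S X (?S \<otimes>\<^sub>o ?X) \<cdot> (Idm C S \<otimes>\<^sub>m front_swap ?S X ?X)
         \<cdot> (Idm C S \<otimes>\<^sub>m (Idm C ?S \<otimes>\<^sub>m ?C)) \<cdot> Asc C S ?S \<I> \<cdot> Run_inv (S \<otimes>\<^sub>o ?S)"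
    by (subst reassoc[OF Asc_nat]) simp_all
  also have "\<dots> = evt C Y \<cdot> (a \<otimes>\<^sub>m c) \<cdot> Asc_inv S X (?S \<otimes>\<^sub>o ?X)
         \<cdot> (Idm C S \<otimes>\<^sub>m (front_swap ?S X ?X \<cdot> (Idm C ?S \<otimes>\<^sub>m ?C) \<cdot> Run_inv ?S))"
    by (simp add: Run_inv_tens)
  \<comment> \<open>Read backwards, \<open>cup_slide\<close> pulls the dual of S through the Casimir
    element of X; this produces the transposition composed with \<open>c\<close>.\<close>
  also have "\<dots> = evt C Y \<cdot> (a \<otimes>\<^sub>m c) \<cdot> Asc_inv S X (?S \<otimes>\<^sub>o ?X)
         \<cdot> (Idm C S \<otimes>\<^sub>m (Idm C X \<otimes>\<^sub>m \<tau> ?X ?S)) \<cdot> (Idm C S \<otimes>\<^sub>m ?c)"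
    by (simp flip: cup_slide)
  also have "\<dots> = contraction S X Y a (c \<cdot> \<tau> ?X ?S)"
    unfolding contraction_def by (subst reassoc[OF Asc_inv_nat]) simp_all
  finally show ?thesis .
qed

text \<open>The transposition of [S] and [X] meets a newly created Casimir element, so by naturality
  it reduces to a unit constraint. Only S still has to cross the pair, which transposes
  \<open>b\<close> and leaves \<open>d\<close> as it is.\<close>

lemma bracket_Sym_contraction:
  assumes [simp]: "b \<in> Arr C" "Dom C b = X \<otimes>\<^sub>o S" "Cod C b = Y"
    "d \<in> Arr C" "Dom C d = X\<^sup>\<or> \<otimes>\<^sub>o S\<^sup>\<or>" "Cod C d = Y\<^sup>\<or>" "S \<in> Obj C" "X \<in> Obj C" "Y \<in> Obj C"
  shows "evt C Y \<cdot> bracket_map C X S b d \<cdot> \<tau> (S \<otimes>\<^sub>o S\<^sup>\<or>) (X \<otimes>\<^sub>o X\<^sup>\<or>)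
      \<cdot> (Idm C (S \<otimes>\<^sub>o S\<^sup>\<or>) \<otimes>\<^sub>m casimir C X) \<cdot> Run_inv (S \<otimes>\<^sub>o S\<^sup>\<or>)
    = contraction S X Y (b \<cdot> \<tau> S X) d"
proof -
  let ?S = "S\<^sup>\<or>" and ?X = "X\<^sup>\<or>" and ?C = "casimir C X"
  let ?B = "S \<otimes>\<^sub>o ?S"
  have "evt C Y \<cdot> bracket_map C X S b d \<cdot> \<tau> ?B (X \<otimes>\<^sub>o ?X) \<cdot> (Idm C ?B \<otimes>\<^sub>m ?C) \<cdot> Run_inv ?B
     = evt C Y \<cdot> (b \<otimes>\<^sub>m d) \<cdot> Asc_inv X S (?X \<otimes>\<^sub>o ?S) \<cdot> (Idm C X \<otimes>\<^sub>m front_swap ?X S ?S)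
         \<cdot> Asc C X ?X ?B \<cdot> \<tau> ?B (X \<otimes>\<^sub>o ?X) \<cdot> (Idm C ?B \<otimes>\<^sub>m ?C) \<cdot> Run_inv ?B"
    by (simp add: bracket_map_def mid_swap_eq)
  also have "\<dots> = evt C Y \<cdot> (b \<otimes>\<^sub>m d) \<cdot> Asc_inv X S (?X \<otimes>\<^sub>o ?S) \<cdot> (Idm C X \<otimes>\<^sub>m front_swap ?X S ?S)
         \<cdot> Asc C X ?X ?B \<cdot> (?C \<otimes>\<^sub>m Idm C ?B) \<cdot> \<tau> ?B \<I> \<cdot> Run_inv ?B"
    by (subst reassoc[OF Sym_nat]) simp_all
  also have "\<dots> = evt C Y \<cdot> (b \<otimes>\<^sub>m d) \<cdot> Asc_inv X S (?X \<otimes>\<^sub>o ?S) \<cdot> (Idm C X \<otimes>\<^sub>m front_swap ?X S ?S)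
         \<cdot> cup ?C X ?X ?B"
    by (simp add: Sym_Run_inv cup_def)
  also have "\<dots> = evt C Y \<cdot> (b \<otimes>\<^sub>m d) \<cdot> Asc_inv X S (?X \<otimes>\<^sub>o ?S) \<cdot> front_swap S X (?X \<otimes>\<^sub>o ?S)
         \<cdot> (Idm C S \<otimes>\<^sub>m cup ?C X ?X ?S)"
    by (simp flip: cup_slide_tens)
  also have "\<dots> = contraction S X Y (b \<cdot> \<tau> S X) d"
    by (simp add: front_swap_def contraction_def)
  finally show ?thesis .
qed

text \<open>The right side of \<open>Cas\<close> combines \<open>imult\<close> with the Casimir
  element of Y, whereas \<open>dual_transpose_eq\<close> uses that of S. \<open>imult_flip\<close>
  and the snake identity for Y show that both give the transpose of \<open>b\<close>.\<close>

lemma dual_transpose_imult: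
  assumes [simp]: "b \<in> Arr C" "Dom C b = X \<otimes>\<^sub>o S" "Cod C b = Y" "S \<in> Obj C" "X \<in> Obj C" "Y \<in> Obj C"
  shows "dual_transpose X S Y b = (Idm C Y \<otimes>\<^sub>m imult C X S Y b) \<cdot> front_swap X Y (Y\<^sup>\<or>) \<cdot> (Idm C X \<otimes>\<^sub>m casimir C Y) \<cdot> Run_inv X"
proof (rule dual_transpose_unique)
  let ?\<iota> = "imult C X S Y b \<cdot> \<tau> (Y\<^sup>\<or>) X" and ?c = "\<lambda>R. cup (casimir C Y) Y (Y\<^sup>\<or>) R"
  have eq: "(Idm C Y \<otimes>\<^sub>m imult C X S Y b) \<cdot> front_swap X Y (Y\<^sup>\<or>) \<cdot> (Idm C X \<otimes>\<^sub>m casimir C Y) \<cdot> Run_inv X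
     = (Idm C Y \<otimes>\<^sub>m ?\<iota>) \<cdot> ?c X"
    by (simp flip: cup_slide)
  have flip: "ev C S \<cdot> (?\<iota> \<otimes>\<^sub>m Idm C S) = ev C Y \<cdot> (Idm C (Y\<^sup>\<or>) \<otimes>\<^sub>m b) \<cdot> Asc C (Y\<^sup>\<or>) X S"
    using imult_flip[where R = Y, OF evt_imult[of b X S Y]] by (simp add: reassoc[OF ev_Sym])
  have "Run C Y \<cdot> (Idm C Y \<otimes>\<^sub>m ev C S) \<cdot> Asc C Y (S\<^sup>\<or>) S \<cdot> (((Idm C Y \<otimes>\<^sub>m ?\<iota>) \<cdot> ?c X) \<otimes>\<^sub>m Idm C S)
     = Run C Y \<cdot> (Idm C Y \<otimes>\<^sub>m ev C S) \<cdot> Asc C Y (S\<^sup>\<or>) S \<cdot> ((Idm C Y \<otimes>\<^sub>m ?\<iota>) \<otimes>\<^sub>m Idm C S) \<cdot> (?c X \<otimes>\<^sub>m Idm C S)"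
    by simp
  also have "\<dots> = Run C Y \<cdot> (Idm C Y \<otimes>\<^sub>m ev C S) \<cdot> (Idm C Y \<otimes>\<^sub>m (?\<iota> \<otimes>\<^sub>m Idm C S)) \<cdot> Asc C Y (Y\<^sup>\<or> \<otimes>\<^sub>o X) S \<cdot> (?c X \<otimes>\<^sub>m Idm C S)"
    by (subst reassoc[OF Asc_nat]) simp_all
  also have "\<dots> = Run C Y \<cdot> (Idm C Y \<otimes>\<^sub>m (ev C S \<cdot> (?\<iota> \<otimes>\<^sub>m Idm C S))) \<cdot> Asc C Y (Y\<^sup>\<or> \<otimes>\<^sub>o X) S \<cdot> (?c X \<otimes>\<^sub>m Idm C S)"
    by simp
  also have "\<dots> = Run C Y \<cdot> (Idm C Y \<otimes>\<^sub>m (ev C Y \<cdot> (Idm C (Y\<^sup>\<or>) \<otimes>\<^sub>m b))) \<cdot> (Idm C Y \<otimes>\<^sub>m Asc C (Y\<^sup>\<or>) X S)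
      \<cdot> Asc C Y (Y\<^sup>\<or> \<otimes>\<^sub>o X) S \<cdot> (?c X \<otimes>\<^sub>m Idm C S)"
    unfolding flip by simp
  also have "\<dots> = Run C Y \<cdot> (Idm C Y \<otimes>\<^sub>m ev C Y) \<cdot> (Idm C Y \<otimes>\<^sub>m (Idm C (Y\<^sup>\<or>) \<otimes>\<^sub>m b)) \<cdot> ?c (X \<otimes>\<^sub>o S)"
    by (simp add: cup_tens)
  also have "\<dots> = (Run C Y \<cdot> (Idm C Y \<otimes>\<^sub>m ev C Y) \<cdot> ?c Y) \<cdot> b"
    by (simp add: cup_nat)
  also have "\<dots> = b"
    by (subst casimir_zigzag) simp_all
  finally show "Run C Y \<cdot> (Idm C Y \<otimes>\<^sub>m ev C S) \<cdot> Asc C Y (S\<^sup>\<or>) S \<cdot> (((Idm C Y \<otimes>\<^sub>m imult C X S Y b)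
      \<cdot> front_swap X Y (Y\<^sup>\<or>) \<cdot> (Idm C X \<otimes>\<^sub>m casimir C Y) \<cdot> Run_inv X) \<otimes>\<^sub>m Idm C S) = b"
    unfolding eq .
qed simp_all

text \<open>The transpose creates its Casimir pair to the right of S; \<open>reversal\<close> moves
  the pair to the left of S and exchanges its legs.\<close>

lemma Sym_dual_transpose:
  assumes [simp]: "b \<in> Arr C" "Dom C b = X \<otimes>\<^sub>o S" "Cod C b = Y" "S \<in> Obj C" "X \<in> Obj C" "Y \<in> Obj C"
  shows "\<tau> Y (X\<^sup>\<or>) \<cdot> dual_transpose S X Y (b \<cdot> \<tau> S X)
    = (Idm C (X\<^sup>\<or>) \<otimes>\<^sub>m b) \<cdot> cup (\<tau> X (X\<^sup>\<or>) \<cdot> casimir C X) (X\<^sup>\<or>) X S"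
proof -
  let ?X = "X\<^sup>\<or>" and ?C = "casimir C X"
  have "\<tau> Y ?X \<cdot> dual_transpose S X Y (b \<cdot> \<tau> S X)
      = \<tau> Y ?X \<cdot> (b \<otimes>\<^sub>m Idm C ?X) \<cdot> (\<tau> S X \<otimes>\<^sub>m Idm C ?X) \<cdot> Asc_inv S X ?X \<cdot> (Idm C S \<otimes>\<^sub>m ?C) \<cdot> Run_inv S"
    by (simp add: dual_transpose_eq)
  also have "\<dots> = (Idm C ?X \<otimes>\<^sub>m b) \<cdot> \<tau> (X \<otimes>\<^sub>o S) ?X \<cdot> (\<tau> S X \<otimes>\<^sub>m Idm C ?X) \<cdot> Asc_inv S X ?X
      \<cdot> (Idm C S \<otimes>\<^sub>m ?C) \<cdot> Run_inv S"
    by (subst reassoc[OF Sym_nat]) simp_all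
  also have "\<dots> = (Idm C ?X \<otimes>\<^sub>m b) \<cdot> (\<tau> (X \<otimes>\<^sub>o S) ?X \<cdot> (\<tau> S X \<otimes>\<^sub>m Idm C ?X)) \<cdot> Asc_inv S X ?X
      \<cdot> (Idm C S \<otimes>\<^sub>m ?C) \<cdot> Run_inv S"
    by simp
  also have "\<dots> = (Idm C ?X \<otimes>\<^sub>m b) \<cdot> (Asc C ?X X S \<cdot> (\<tau> X ?X \<otimes>\<^sub>m Idm C S) \<cdot> \<tau> S (X \<otimes>\<^sub>o ?X) \<cdot> Asc C S X ?X)
      \<cdot> Asc_inv S X ?X \<cdot> (Idm C S \<otimes>\<^sub>m ?C) \<cdot> Run_inv S"
    by (subst reversal) simp_all
  also have "\<dots> = (Idm C ?X \<otimes>\<^sub>m b) \<cdot> Asc C ?X X S \<cdot> (\<tau> X ?X \<otimes>\<^sub>m Idm C S) \<cdot> \<tau> S (X \<otimes>\<^sub>o ?X)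
      \<cdot> (Idm C S \<otimes>\<^sub>m ?C) \<cdot> Run_inv S"
    by simp
  also have "\<dots> = (Idm C ?X \<otimes>\<^sub>m b) \<cdot> Asc C ?X X S \<cdot> (\<tau> X ?X \<otimes>\<^sub>m Idm C S) \<cdot> (?C \<otimes>\<^sub>m Idm C S) \<cdot> \<tau> S \<I> \<cdot> Run_inv S"
    by (subst reassoc[OF Sym_nat]) simp_all
  also have "\<dots> = (Idm C ?X \<otimes>\<^sub>m b) \<cdot> cup (\<tau> X ?X \<cdot> ?C) ?X X S"
    by (simp add: Sym_Run_inv cup_def)
  finally show ?thesis .
qed

text \<open>The right side of \<open>Cas\<close> turns out to be the Casimir element of S with the
  composite of \<open>evt_D_composite\<close>, taken for \<open>b \<cdot> \<tau> S X\<close> and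
  \<open>d\<close>, acting on its first leg.\<close>

lemma casimir_D_composite:
  assumes [simp]: "b \<in> Arr C" "Dom C b = X \<otimes>\<^sub>o S" "Cod C b = Y"
    "d \<in> Arr C" "Dom C d = X\<^sup>\<or> \<otimes>\<^sub>o S\<^sup>\<or>" "Cod C d = Y\<^sup>\<or>" "S \<in> Obj C" "X \<in> Obj C" "Y \<in> Obj C"
  shows "(imult_star C (X\<^sup>\<or>) S Y d \<otimes>\<^sub>m imult C X S Y b) \<cdot> first_to_third C X (X\<^sup>\<or>) Y (Y\<^sup>\<or>)
      \<cdot> (casimir C X \<otimes>\<^sub>m casimir C Y) \<cdot> Lun_inv \<I>
    = ((imult_star C (X\<^sup>\<or>) S Y d \<cdot> \<tau> Y (X\<^sup>\<or>) \<cdot> dual_transpose S X Y (b \<cdot> \<tau> S X)) \<otimes>\<^sub>m Idm C (S\<^sup>\<or>)) \<cdot> casimir C S"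
    (is "?l = ?r")
proof -
  let ?S = "S\<^sup>\<or>" and ?X = "X\<^sup>\<or>" and ?Y = "Y\<^sup>\<or>" and ?\<iota> = "imult C X S Y b"
  let ?q = "\<tau> X ?X \<cdot> casimir C X" and ?s = "imult_star C (X\<^sup>\<or>) S Y d"
  \<comment> \<open>The common form of both sides: the transposed Casimir element of X with the
    transpose of \<open>b\<close> on its second leg. The right side reaches it by
    \<open>dual_transpose_eq\<close>, the left by \<open>dual_transpose_imult\<close>.\<close>
  let ?m = "(?s \<otimes>\<^sub>m Idm C ?S) \<cdot> Asc_inv ?X Y ?S \<cdot> (Idm C ?X \<otimes>\<^sub>m dual_transpose X S Y b) \<cdot> ?q"
  have "?r = (?s \<otimes>\<^sub>m Idm C ?S) \<cdot> ((Idm C ?X \<otimes>\<^sub>m b) \<otimes>\<^sub>m Idm C ?S) \<cdot> (cup ?q ?X X S \<otimes>\<^sub>m Idm C ?S) \<cdot> casimir C S"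
    by (simp add: Sym_dual_transpose)
  also have "\<dots> = (?s \<otimes>\<^sub>m Idm C ?S) \<cdot> ((Idm C ?X \<otimes>\<^sub>m b) \<otimes>\<^sub>m Idm C ?S) \<cdot> Asc_inv ?X (X \<otimes>\<^sub>o S) ?S
      \<cdot> (Idm C ?X \<otimes>\<^sub>m Asc_inv X S ?S) \<cdot> ((Idm C ?X \<otimes>\<^sub>m Asc C X S ?S) \<cdot> Asc C ?X (X \<otimes>\<^sub>o S) ?S \<cdot> (cup ?q ?X X S \<otimes>\<^sub>m Idm C ?S)) \<cdot> casimir C S"
    by simp
  also have "\<dots> = (?s \<otimes>\<^sub>m Idm C ?S) \<cdot> ((Idm C ?X \<otimes>\<^sub>m b) \<otimes>\<^sub>m Idm C ?S) \<cdot> Asc_inv ?X (X \<otimes>\<^sub>o S) ?S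
      \<cdot> (Idm C ?X \<otimes>\<^sub>m Asc_inv X S ?S) \<cdot> cup ?q ?X X (S \<otimes>\<^sub>o ?S) \<cdot> casimir C S"
    by (subst cup_tens) simp_all
  also have "\<dots> = (?s \<otimes>\<^sub>m Idm C ?S) \<cdot> ((Idm C ?X \<otimes>\<^sub>m b) \<otimes>\<^sub>m Idm C ?S) \<cdot> Asc_inv ?X (X \<otimes>\<^sub>o S) ?S
      \<cdot> (Idm C ?X \<otimes>\<^sub>m (Asc_inv X S ?S \<cdot> (Idm C X \<otimes>\<^sub>m casimir C S) \<cdot> Run_inv X)) \<cdot> ?q"
    by (simp add: cup_nat cup_Unit)
  also have "\<dots> = (?s \<otimes>\<^sub>m Idm C ?S) \<cdot> Asc_inv ?X Y ?S \<cdot> (Idm C ?X \<otimes>\<^sub>m (b \<otimes>\<^sub>m Idm C ?S))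
      \<cdot> (Idm C ?X \<otimes>\<^sub>m (Asc_inv X S ?S \<cdot> (Idm C X \<otimes>\<^sub>m casimir C S) \<cdot> Run_inv X)) \<cdot> ?q"
    by (subst reassoc[OF Asc_inv_nat]) simp_all
  also have "\<dots> = ?m"
    by (simp add: dual_transpose_eq)
  finally have r: "?r = ?m" .
  have cc: "Asc C ?X X (Y \<otimes>\<^sub>o ?Y) \<cdot> (?q \<otimes>\<^sub>m casimir C Y) \<cdot> Lun_inv \<I>
      = (Idm C ?X \<otimes>\<^sub>m ((Idm C X \<otimes>\<^sub>m casimir C Y) \<cdot> Run_inv X)) \<cdot> ?q"
  proof -
    have "Asc C ?X X (Y \<otimes>\<^sub>o ?Y) \<cdot> (?q \<otimes>\<^sub>m casimir C Y) \<cdot> Lun_inv \<I>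
        = Asc C ?X X (Y \<otimes>\<^sub>o ?Y) \<cdot> ((Idm C ?X \<otimes>\<^sub>m Idm C X) \<otimes>\<^sub>m casimir C Y) \<cdot> Run_inv (?X \<otimes>\<^sub>o X) \<cdot> ?q"
      by (simp add: Run_inv_nat Lun_Unit)
    also have "\<dots> = (Idm C ?X \<otimes>\<^sub>m (Idm C X \<otimes>\<^sub>m casimir C Y)) \<cdot> Asc C ?X X \<I> \<cdot> Run_inv (?X \<otimes>\<^sub>o X) \<cdot> ?q"
      by (subst reassoc[OF Asc_nat]) simp_all
    finally show ?thesis by (simp add: reassoc[OF Run_inv_tens])
  qed
  have "?l = (?s \<otimes>\<^sub>m Idm C ?S) \<cdot> ((Idm C ?X \<otimes>\<^sub>m Idm C Y) \<otimes>\<^sub>m ?\<iota>) \<cdot> Asc_inv ?X Y (X \<otimes>\<^sub>o ?Y)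
      \<cdot> (Idm C ?X \<otimes>\<^sub>m front_swap X Y ?Y) \<cdot> (Asc C ?X X (Y \<otimes>\<^sub>o ?Y) \<cdot> (?q \<otimes>\<^sub>m casimir C Y) \<cdot> Lun_inv \<I>)"
    by (simp add: first_to_third_eq)
  also have "\<dots> = (?s \<otimes>\<^sub>m Idm C ?S) \<cdot> Asc_inv ?X Y ?S \<cdot> (Idm C ?X \<otimes>\<^sub>m (Idm C Y \<otimes>\<^sub>m ?\<iota>))
      \<cdot> (Idm C ?X \<otimes>\<^sub>m front_swap X Y ?Y) \<cdot> (Asc C ?X X (Y \<otimes>\<^sub>o ?Y) \<cdot> (?q \<otimes>\<^sub>m casimir C Y) \<cdot> Lun_inv \<I>)"
    by (subst reassoc[OF Asc_inv_nat]) simp_all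
  also have "\<dots> = ?m"
    unfolding cc by (simp add: dual_transpose_imult)
  finally show ?thesis using r by simp
qed

section \<open>Cancellation and scalars\<close>

lemma casimir_inject:
  assumes "(f \<otimes>\<^sub>m Idm C (S\<^sup>\<or>)) \<cdot> casimir C S = (g \<otimes>\<^sub>m Idm C (S\<^sup>\<or>)) \<cdot> casimir C S"
    and "f \<in> Hom C S S" "g \<in> Hom C S S" and [simp]: "S \<in> Obj C"
  shows "f = g"
proof -
  \<comment> \<open>\<open>?k\<close> bends the second leg of the Casimir element back with
    \<open>ev C S\<close>, so the snake identity returns the map on the first leg.\<close>
  let ?k = "\<lambda>h. Run C S \<cdot> (Idm C S \<otimes>\<^sub>m ev C S) \<cdot> Asc C S (S\<^sup>\<or>) S \<cdot> (((h \<otimes>\<^sub>m Idm C (S\<^sup>\<or>)) \<cdot> casimir C S) \<otimes>\<^sub>m Idm C S) \<cdot> Lun_inv S"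
  have "?k h = h" if "h \<in> Hom C S S" for h
  proof -
    note [simp] = HomD[OF that]
    have "?k h = Run C S \<cdot> (Idm C S \<otimes>\<^sub>m ev C S) \<cdot> Asc C S (S\<^sup>\<or>) S \<cdot> ((h \<otimes>\<^sub>m Idm C (S\<^sup>\<or>)) \<otimes>\<^sub>m Idm C S)
        \<cdot> (casimir C S \<otimes>\<^sub>m Idm C S) \<cdot> Lun_inv S"
      by simp
    also have "\<dots> = Run C S \<cdot> (Idm C S \<otimes>\<^sub>m ev C S) \<cdot> (h \<otimes>\<^sub>m (Idm C (S\<^sup>\<or>) \<otimes>\<^sub>m Idm C S)) \<cdot> cup (casimir C S) S (S\<^sup>\<or>) S"
      by (subst reassoc[OF Asc_nat]) (simp_all add: cup_def)
    also have "\<dots> = Run C S \<cdot> (h \<otimes>\<^sub>m Idm C \<I>) \<cdot> (Idm C S \<otimes>\<^sub>m ev C S) \<cdot> cup (casimir C S) S (S\<^sup>\<or>) S"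
      by simp
    also have "\<dots> = h \<cdot> Run C S \<cdot> (Idm C S \<otimes>\<^sub>m ev C S) \<cdot> cup (casimir C S) S (S\<^sup>\<or>) S"
      by (subst reassoc[OF Run_nat]) simp_all
    finally show ?thesis by (simp add: casimir_zigzag)
  qed
  then show ?thesis using assms(1-3) by metis
qed

lemma evt_inject_right:
  assumes "evt C X \<cdot> (Idm C X \<otimes>\<^sub>m f) = evt C X \<cdot> (Idm C X \<otimes>\<^sub>m g)"
    and [simp]: "f \<in> Arr C" "g \<in> Arr C" "Dom C f = T" "Dom C g = T" "Cod C f = X\<^sup>\<or>" "Cod C g = X\<^sup>\<or>"
    "X \<in> Obj C"
  shows "f = g"
proof (rule ev_inject)
  have [simp]: "T \<in> Obj C" using Dom_Obj[OF assms(2)] by simp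
  have "ev C X \<cdot> (h \<otimes>\<^sub>m Idm C X) = (evt C X \<cdot> (Idm C X \<otimes>\<^sub>m h)) \<cdot> \<tau> T X"
    if [simp]: "h \<in> Arr C" "Dom C h = T" "Cod C h = X\<^sup>\<or>" for h
    by (simp add: Sym_nat flip: ev_Sym)
  then show "ev C X \<cdot> (f \<otimes>\<^sub>m Idm C X) = ev C X \<cdot> (g \<otimes>\<^sub>m Idm C X)"
    by (simp only: assms)
qed simp_all

text \<open>The pairing ends in \<I>, so by naturality a scalar on either leg can be collected
  there.\<close>

lemma evt_unit_act:
  assumes [simp]: "l \<in> Arr C" "Dom C l = \<I>" "Cod C l = \<I>" "X \<in> Obj C"
  shows "f \<in> Arr C \<Longrightarrow> Cod C f = X \<Longrightarrow>
      evt C X \<cdot> ((unit_act C l X \<cdot> f) \<otimes>\<^sub>m Idm C (X\<^sup>\<or>)) = unit_act C l \<I> \<cdot> evt C X \<cdot> (f \<otimes>\<^sub>m Idm C (X\<^sup>\<or>))"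
    and "g \<in> Arr C \<Longrightarrow> Cod C g = X\<^sup>\<or> \<Longrightarrow>
      evt C X \<cdot> (Idm C X \<otimes>\<^sub>m (unit_act C l (X\<^sup>\<or>) \<cdot> g)) = unit_act C l \<I> \<cdot> evt C X \<cdot> (Idm C X \<otimes>\<^sub>m g)"
proof -
  have nat: "unit_act C l \<I> \<cdot> evt C X \<cdot> h = evt C X \<cdot> unit_act C l (X \<otimes>\<^sub>o X\<^sup>\<or>) \<cdot> h"
    if [simp]: "h \<in> Arr C" "Cod C h = X \<otimes>\<^sub>o X\<^sup>\<or>" for h
    using reassoc[OF unit_act_nat[of l "evt C X" "X \<otimes>\<^sub>o X\<^sup>\<or>" \<I>], of h] by simp
  show "f \<in> Arr C \<Longrightarrow> Cod C f = X \<Longrightarrow>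
      evt C X \<cdot> ((unit_act C l X \<cdot> f) \<otimes>\<^sub>m Idm C (X\<^sup>\<or>)) = unit_act C l \<I> \<cdot> evt C X \<cdot> (f \<otimes>\<^sub>m Idm C (X\<^sup>\<or>))"
    by (simp add: nat flip: unit_act_tens_left)
  show "g \<in> Arr C \<Longrightarrow> Cod C g = X\<^sup>\<or> \<Longrightarrow>
      evt C X \<cdot> (Idm C X \<otimes>\<^sub>m (unit_act C l (X\<^sup>\<or>) \<cdot> g)) = unit_act C l \<I> \<cdot> evt C X \<cdot> (Idm C X \<otimes>\<^sub>m g)"
    by (simp add: nat flip: unit_act_tens_right)
qed

lemma contraction_unit_act:
  assumes [simp]: "l \<in> Arr C" "Dom C l = \<I>" "Cod C l = \<I>" "a \<in> Arr C" "Dom C a = S \<otimes>\<^sub>o X" "Cod C a = Y"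
    "d \<in> Arr C" "Dom C d = X\<^sup>\<or> \<otimes>\<^sub>o S\<^sup>\<or>" "Cod C d = Y\<^sup>\<or>" "S \<in> Obj C" "X \<in> Obj C" "Y \<in> Obj C"
  shows "contraction S X Y (unit_act C l Y \<cdot> a) d = unit_act C l \<I> \<cdot> contraction S X Y a d"
    and "contraction S X Y a (unit_act C l (Y\<^sup>\<or>) \<cdot> d) = unit_act C l \<I> \<cdot> contraction S X Y a d"
proof -
  let ?k = "(a \<otimes>\<^sub>m d) \<cdot> Asc_inv S X (X\<^sup>\<or> \<otimes>\<^sub>o S\<^sup>\<or>) \<cdot> (Idm C S \<otimes>\<^sub>m cup (casimir C X) X (X\<^sup>\<or>) (S\<^sup>\<or>))"
  have "contraction S X Y (unit_act C l Y \<cdot> a) d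
      = evt C Y \<cdot> (unit_act C l Y \<otimes>\<^sub>m Idm C (Y\<^sup>\<or>)) \<cdot> ?k"
    by (simp add: contraction_def)
  also have "\<dots> = (unit_act C l \<I> \<cdot> evt C Y) \<cdot> ?k"
    by (rule reassoc) (simp_all add: unit_act_tens_left unit_act_nat[where X = "Y \<otimes>\<^sub>o Y\<^sup>\<or>"])
  finally show "contraction S X Y (unit_act C l Y \<cdot> a) d = unit_act C l \<I> \<cdot> contraction S X Y a d"
    by (simp add: contraction_def)
  have "contraction S X Y a (unit_act C l (Y\<^sup>\<or>) \<cdot> d)
      = evt C Y \<cdot> (Idm C Y \<otimes>\<^sub>m unit_act C l (Y\<^sup>\<or>)) \<cdot> ?k"
    by (simp add: contraction_def)
  also have "\<dots> = (unit_act C l \<I> \<cdot> evt C Y) \<cdot> ?k"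
    by (rule reassoc) (simp_all add: unit_act_tens_right unit_act_nat[where X = "Y \<otimes>\<^sub>o Y\<^sup>\<or>"])
  finally show "contraction S X Y a (unit_act C l (Y\<^sup>\<or>) \<cdot> d) = unit_act C l \<I> \<cdot> contraction S X Y a d"
    by (simp add: contraction_def)
qed

lemma contraction_arr [simp]:
  assumes "a \<in> Arr C" "Dom C a = S \<otimes>\<^sub>o X" "Cod C a = Y"
    "d \<in> Arr C" "Dom C d = X\<^sup>\<or> \<otimes>\<^sub>o S\<^sup>\<or>" "Cod C d = Y\<^sup>\<or>" "S \<in> Obj C" "X \<in> Obj C" "Y \<in> Obj C"
  shows "contraction S X Y a d \<in> Arr C" "Dom C (contraction S X Y a d) = S \<otimes>\<^sub>o S\<^sup>\<or>"
    "Cod C (contraction S X Y a d) = \<I>"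
  using assms by (simp_all add: contraction_def)

text \<open>\<open>casimir_inject\<close> removes the Casimir element of S from (Cas): the operator
  attached to \<open>b \<cdot> \<tau> S X\<close> and \<open>d\<close> is the scalar \<mu>. Pairing
  it with the dual of S gives the contraction.\<close>

lemma Cas_contraction:
  assumes cas: "Cas C S X Y b d \<mu>"
    and [simp]: "\<mu> \<in> Arr C" "Dom C \<mu> = \<I>" "Cod C \<mu> = \<I>" "b \<in> Arr C" "Dom C b = X \<otimes>\<^sub>o S" "Cod C b = Y"
    "d \<in> Arr C" "Dom C d = X\<^sup>\<or> \<otimes>\<^sub>o S\<^sup>\<or>" "Cod C d = Y\<^sup>\<or>" "S \<in> Obj C" "X \<in> Obj C" "Y \<in> Obj C"
  shows "contraction S X Y (b \<cdot> \<tau> S X) d = unit_act C \<mu> \<I> \<cdot> evt C S"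
proof -
  let ?F = "imult_star C (X\<^sup>\<or>) S Y d \<cdot> \<tau> Y (X\<^sup>\<or>) \<cdot> dual_transpose S X Y (b \<cdot> \<tau> S X)"
  have "(?F \<otimes>\<^sub>m Idm C (S\<^sup>\<or>)) \<cdot> casimir C S = (unit_act C \<mu> S \<otimes>\<^sub>m Idm C (S\<^sup>\<or>)) \<cdot> casimir C S"
    using cas unfolding Cas_def by (simp only: casimir_D_composite assms(2-)) (simp add: scal_def unit_act_tens_left)
  then have F: "?F = unit_act C \<mu> S"
    by (rule casimir_inject) (simp_all add: Hom_def)
  have "contraction S X Y (b \<cdot> \<tau> S X) d = evt C S \<cdot> (?F \<otimes>\<^sub>m Idm C (S\<^sup>\<or>))"
    by (rule evt_D_composite[symmetric]) simp_all
  also have "\<dots> = unit_act C \<mu> \<I> \<cdot> evt C S"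
    unfolding F using evt_unit_act(1)[of \<mu> S "Idm C S"] by simp
  finally show ?thesis .
qed

text \<open>The bracketed law is applied to the Casimir element of X in [X] and closed with
  \<open>evt C Y\<close>; this contracts along X and Y at once.\<close>

lemma Com_contraction:
  assumes com: "Com C (bracket C S) (bracket C X) (bracket_map C S X a c) (bracket_map C X S b d) l"
    and [simp]: "l \<in> Arr C" "Dom C l = \<I>" "Cod C l = \<I>"
    "a \<in> Arr C" "Dom C a = S \<otimes>\<^sub>o X" "Cod C a = Y" "b \<in> Arr C" "Dom C b = X \<otimes>\<^sub>o S" "Cod C b = Y"
    "c \<in> Arr C" "Dom C c = S\<^sup>\<or> \<otimes>\<^sub>o X\<^sup>\<or>" "Cod C c = Y\<^sup>\<or>" "d \<in> Arr C" "Dom C d = X\<^sup>\<or> \<otimes>\<^sub>o S\<^sup>\<or>" "Cod C d = Y\<^sup>\<or>"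
    "S \<in> Obj C" "X \<in> Obj C" "Y \<in> Obj C"
  shows "contraction S X Y (b \<cdot> \<tau> S X) d = unit_act C l \<I> \<cdot> contraction S X Y a (c \<cdot> \<tau> (X\<^sup>\<or>) (S\<^sup>\<or>))"
proof -
  let ?B = "S \<otimes>\<^sub>o S\<^sup>\<or>" and ?K = "bracket_map C S X a c" and ?L = "bracket_map C X S b d"
  let ?c = "(Idm C ?B \<otimes>\<^sub>m casimir C X) \<cdot> Run_inv ?B"
  have [simp]: "?K \<in> Arr C" "Dom C ?K = ?B \<otimes>\<^sub>o (X \<otimes>\<^sub>o X\<^sup>\<or>)" "Cod C ?K = Y \<otimes>\<^sub>o Y\<^sup>\<or>"
    "?L \<in> Arr C" "Dom C ?L = (X \<otimes>\<^sub>o X\<^sup>\<or>) \<otimes>\<^sub>o ?B" "Cod C ?L = Y \<otimes>\<^sub>o Y\<^sup>\<or>"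
    by (simp_all add: bracket_map_def mid_swap_eq)
  have com': "?L \<cdot> \<tau> ?B (X \<otimes>\<^sub>o X\<^sup>\<or>) = unit_act C l (Y \<otimes>\<^sub>o Y\<^sup>\<or>) \<cdot> ?K"
    using com by (simp add: Com_def bracket_def scal_def)
  have "contraction S X Y (b \<cdot> \<tau> S X) d = evt C Y \<cdot> ?L \<cdot> \<tau> ?B (X \<otimes>\<^sub>o X\<^sup>\<or>) \<cdot> ?c"
    by (rule bracket_Sym_contraction[symmetric]) simp_all
  also have "\<dots> = evt C Y \<cdot> unit_act C l (Y \<otimes>\<^sub>o Y\<^sup>\<or>) \<cdot> ?K \<cdot> ?c"
    by (subst reassoc[OF com']) simp_all
  also have "\<dots> = (unit_act C l \<I> \<cdot> evt C Y) \<cdot> ?K \<cdot> ?c"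
    by (rule reassoc) (simp_all add: unit_act_nat[where X = "Y \<otimes>\<^sub>o Y\<^sup>\<or>"])
  also have "\<dots> = unit_act C l \<I> \<cdot> evt C Y \<cdot> ?K \<cdot> ?c" by simp
  also have "\<dots> = unit_act C l \<I> \<cdot> contraction S X Y a (c \<cdot> \<tau> (X\<^sup>\<or>) (S\<^sup>\<or>))"
    by (subst bracket_contraction) simp_all
  finally show ?thesis .
qed

text \<open>The second form inverts \<tau> and not the scalar, so \<open>l\<close> stays on the side
  of \<phi>.\<close>

lemma Com_unit_act:
  assumes "Com C P Q \<phi> \<phi>' l"
    and [simp]: "l \<in> Arr C" "Dom C l = \<I>" "Cod C l = \<I>" "\<phi> \<in> Arr C" "Dom C \<phi> = P \<otimes>\<^sub>o Q" "Cod C \<phi> = R"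
    "\<phi>' \<in> Arr C" "Dom C \<phi>' = Q \<otimes>\<^sub>o P" "Cod C \<phi>' = R" "P \<in> Obj C" "Q \<in> Obj C" "R \<in> Obj C"
  shows "\<phi>' \<cdot> \<tau> P Q = unit_act C l R \<cdot> \<phi>" "\<phi>' = unit_act C l R \<cdot> \<phi> \<cdot> \<tau> Q P"
proof -
  show *: "\<phi>' \<cdot> \<tau> P Q = unit_act C l R \<cdot> \<phi>" using assms(1) by (simp add: Com_def scal_def)
  have "\<phi>' = (\<phi>' \<cdot> \<tau> P Q) \<cdot> \<tau> Q P" by simp
  then show "\<phi>' = unit_act C l R \<cdot> \<phi> \<cdot> \<tau> Q P" unfolding * by simp
qed

text \<open>Commutativity of the scalars is the naturality of one action with respect to the
  other.\<close>

lemma unit_act_commute: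
  assumes [simp]: "l \<in> Arr C" "Dom C l = \<I>" "Cod C l = \<I>" "m \<in> Arr C" "Dom C m = \<I>" "Cod C m = \<I>"
    "f \<in> Arr C" "Cod C f = X" "X \<in> Obj C"
  shows "unit_act C l X \<cdot> unit_act C m X \<cdot> f = unit_act C m X \<cdot> unit_act C l X \<cdot> f"
  using reassoc[OF unit_act_nat[of l "unit_act C m X" X X], of f] by simp

text \<open>By \<open>evt_inject\<close>, F is determined by the contraction of \<open>a\<close> and
  \<open>d\<close>. The equation \<open>key\<close> controls \<open>a\<close> with the transposed
  \<open>c\<close> instead, and (Com) for the dual pair exchanges the second argument in one
  direction or the other.\<close>

lemma D_composite_scalar:
  assumes cas: "Cas C S X Y b d \<mu>"
    and com: "Com C (bracket C S) (bracket C X) (bracket_map C S X a c) (bracket_map C X S b d) l"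
    and hom: "a \<in> Hom C (S \<otimes>\<^sub>o X) Y" "b \<in> Hom C (X \<otimes>\<^sub>o S) Y"
      "c \<in> Hom C (S\<^sup>\<or> \<otimes>\<^sub>o X\<^sup>\<or>) (Y\<^sup>\<or>)" "d \<in> Hom C (X\<^sup>\<or> \<otimes>\<^sub>o S\<^sup>\<or>) (Y\<^sup>\<or>)"
      "\<mu> \<in> Hom C \<I> \<I>" "l \<in> Hom C \<I> \<I>" "k \<in> Hom C \<I> \<I>"
    and [simp]: "S \<in> Obj C" "X \<in> Obj C" "Y \<in> Obj C"
    and F: "F = Run C S \<cdot> (Idm C S \<otimes>\<^sub>m evt C (Y\<^sup>\<or>)) \<cdot> Asc C S (Y\<^sup>\<or>) ((Y\<^sup>\<or>)\<^sup>\<or>)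
      \<cdot> (D_star C (X\<^sup>\<or>) S Y d \<otimes>\<^sub>m Idm C ((Y\<^sup>\<or>)\<^sup>\<or>)) \<cdot> D_map C S X Y a"
  shows "Com C (X\<^sup>\<or>) (S\<^sup>\<or>) d c k \<Longrightarrow> (l \<cdot> k) \<odot> F = \<mu> \<odot> Idm C S"
    and "Com C (S\<^sup>\<or>) (X\<^sup>\<or>) c d k \<Longrightarrow> l \<odot> F = (\<mu> \<cdot> k) \<odot> Idm C S"
proof -
  note [simp] = hom[THEN HomD(1)] hom[THEN HomD(2)] hom[THEN HomD(3)]
  let ?W = "contraction S X Y" and ?u = "unit_act C"
  have F': "F = imult_star C (X\<^sup>\<or>) S Y d \<cdot> \<tau> Y (X\<^sup>\<or>) \<cdot> dual_transpose S X Y a"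
    unfolding F by (rule D_composite_eq) simp_all
  have [simp]: "F \<in> Arr C" "Dom C F = S" "Cod C F = S" by (simp_all add: F')
  have evt_F: "evt C S \<cdot> (F \<otimes>\<^sub>m Idm C (S\<^sup>\<or>)) = ?W a d"
    unfolding F' by (rule evt_D_composite) simp_all
  \<comment> \<open>(Cas) and the bracketed (Com) both compute the contraction of
    \<open>b \<cdot> \<tau> S X\<close> with \<open>d\<close>; equating the two results eliminates
    \<open>b\<close> and \<open>d\<close>.\<close>
  have key: "?u l \<I> \<cdot> ?W a (c \<cdot> \<tau> (X\<^sup>\<or>) (S\<^sup>\<or>)) = ?u \<mu> \<I> \<cdot> evt C S"
    using Cas_contraction[OF cas] Com_contraction[OF com, of Y] by simp
  show "(l \<cdot> k) \<odot> F = \<mu> \<odot> Idm C S" if "Com C (X\<^sup>\<or>) (S\<^sup>\<or>) d c k"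
  proof -
    have "evt C S \<cdot> ((?u (l \<cdot> k) S \<cdot> F) \<otimes>\<^sub>m Idm C (S\<^sup>\<or>)) = ?u l \<I> \<cdot> ?u k \<I> \<cdot> ?W a d"
      by (subst evt_unit_act) (simp_all add: evt_F unit_act_comp)
    also have "\<dots> = ?u l \<I> \<cdot> ?W a (c \<cdot> \<tau> (X\<^sup>\<or>) (S\<^sup>\<or>))"
      using Com_unit_act(1)[OF that, of "Y\<^sup>\<or>"] by (simp add: contraction_unit_act)
    also have "\<dots> = evt C S \<cdot> ((?u \<mu> S \<cdot> Idm C S) \<otimes>\<^sub>m Idm C (S\<^sup>\<or>))"
      unfolding key by (subst evt_unit_act) simp_all
    finally have "?u (l \<cdot> k) S \<cdot> F = ?u \<mu> S \<cdot> Idm C S"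
      by (rule evt_inject) simp_all
    then show ?thesis by (simp add: scal_def)
  qed
  show "l \<odot> F = (\<mu> \<cdot> k) \<odot> Idm C S" if "Com C (S\<^sup>\<or>) (X\<^sup>\<or>) c d k"
  proof -
    \<comment> \<open>Here (Com) is solved for \<open>d\<close>, so \<open>k\<close> joins \<mu>
      instead of \<open>l\<close>.\<close>
    have "?W a d = ?u k \<I> \<cdot> ?W a (c \<cdot> \<tau> (X\<^sup>\<or>) (S\<^sup>\<or>))"
      by (subst Com_unit_act(2)[OF that, of "Y\<^sup>\<or>"]) (simp_all add: contraction_unit_act)
    then have "evt C S \<cdot> ((?u l S \<cdot> F) \<otimes>\<^sub>m Idm C (S\<^sup>\<or>)) = ?u l \<I> \<cdot> ?u k \<I> \<cdot> ?W a (c \<cdot> \<tau> (X\<^sup>\<or>) (S\<^sup>\<or>))"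
      by (subst evt_unit_act) (simp_all add: evt_F)
    also have "\<dots> = ?u k \<I> \<cdot> ?u \<mu> \<I> \<cdot> evt C S"
      by (subst unit_act_commute) (simp_all add: key)
    also have "\<dots> = evt C S \<cdot> ((?u (\<mu> \<cdot> k) S \<cdot> Idm C S) \<otimes>\<^sub>m Idm C (S\<^sup>\<or>))"
      by (subst evt_unit_act) (simp_all add: unit_act_comp unit_act_commute[of k \<mu>])
    finally have "?u l S \<cdot> F = ?u (\<mu> \<cdot> k) S \<cdot> Idm C S"
      by (rule evt_inject) simp_all
    then show ?thesis by (simp add: scal_def)
  qed
qed

text \<open>The operator G of the exchanged (B) rests on the same equation \<open>key\<close>; this
  time (Com) for S and X exchanges the first argument, and the unknown sits on the dual leg of the
  pairing.\<close>

lemma dual_D_composite_scalar: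
  assumes cas: "Cas C S X Y b d \<mu>"
    and com: "Com C (bracket C S) (bracket C X) (bracket_map C S X a c) (bracket_map C X S b d) l"
    and hom: "a \<in> Hom C (S \<otimes>\<^sub>o X) Y" "b \<in> Hom C (X \<otimes>\<^sub>o S) Y"
      "c \<in> Hom C (S\<^sup>\<or> \<otimes>\<^sub>o X\<^sup>\<or>) (Y\<^sup>\<or>)" "d \<in> Hom C (X\<^sup>\<or> \<otimes>\<^sub>o S\<^sup>\<or>) (Y\<^sup>\<or>)"
      "\<mu> \<in> Hom C \<I> \<I>" "l \<in> Hom C \<I> \<I>" "k \<in> Hom C \<I> \<I>"
    and [simp]: "S \<in> Obj C" "X \<in> Obj C" "Y \<in> Obj C"
    and G: "G = Run C (S\<^sup>\<or>) \<cdot> (Idm C (S\<^sup>\<or>) \<otimes>\<^sub>m ev C (Y\<^sup>\<or>)) \<cdot> Asc C (S\<^sup>\<or>) ((Y\<^sup>\<or>)\<^sup>\<or>) (Y\<^sup>\<or>)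
      \<cdot> (D_map C X S Y b \<otimes>\<^sub>m Idm C (Y\<^sup>\<or>)) \<cdot> D_star C (S\<^sup>\<or>) X Y c"
  shows "Com C X S b a k \<Longrightarrow> (l \<cdot> k) \<odot> G = \<mu> \<odot> Idm C (S\<^sup>\<or>)"
    and "Com C S X a b k \<Longrightarrow> l \<odot> G = (\<mu> \<cdot> k) \<odot> Idm C (S\<^sup>\<or>)"
proof -
  note [simp] = hom[THEN HomD(1)] hom[THEN HomD(2)] hom[THEN HomD(3)]
  let ?W = "contraction S X Y" and ?u = "unit_act C" and ?c = "c \<cdot> \<tau> (X\<^sup>\<or>) (S\<^sup>\<or>)"
  have [simp]: "G \<in> Arr C" "Dom C G = S\<^sup>\<or>" "Cod C G = S\<^sup>\<or>" by (simp_all add: G)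
  have evt_G: "evt C S \<cdot> (Idm C S \<otimes>\<^sub>m G) = ?W (b \<cdot> \<tau> S X) ?c"
    unfolding G by (rule evt_dual_D_composite) simp_all
  have key: "?u l \<I> \<cdot> ?W a ?c = ?u \<mu> \<I> \<cdot> evt C S"
    using Cas_contraction[OF cas] Com_contraction[OF com, of Y] by simp
  show "(l \<cdot> k) \<odot> G = \<mu> \<odot> Idm C (S\<^sup>\<or>)" if "Com C X S b a k"
  proof -
    have "?W a ?c = ?u k \<I> \<cdot> ?W (b \<cdot> \<tau> S X) ?c"
      by (subst Com_unit_act(2)[OF that, of Y]) (simp_all add: contraction_unit_act)
    then have "evt C S \<cdot> (Idm C S \<otimes>\<^sub>m (?u (l \<cdot> k) (S\<^sup>\<or>) \<cdot> G)) = ?u l \<I> \<cdot> ?W a ?c"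
      by (subst evt_unit_act) (simp_all add: evt_G unit_act_comp)
    also have "\<dots> = evt C S \<cdot> (Idm C S \<otimes>\<^sub>m (?u \<mu> (S\<^sup>\<or>) \<cdot> Idm C (S\<^sup>\<or>)))"
      unfolding key by (subst evt_unit_act) simp_all
    finally have "?u (l \<cdot> k) (S\<^sup>\<or>) \<cdot> G = ?u \<mu> (S\<^sup>\<or>) \<cdot> Idm C (S\<^sup>\<or>)"
      by (rule evt_inject_right) simp_all
    then show ?thesis by (simp add: scal_def)
  qed
  show "l \<odot> G = (\<mu> \<cdot> k) \<odot> Idm C (S\<^sup>\<or>)" if "Com C S X a b k"
  proof -
    have "evt C S \<cdot> (Idm C S \<otimes>\<^sub>m (?u l (S\<^sup>\<or>) \<cdot> G)) = ?u l \<I> \<cdot> ?u k \<I> \<cdot> ?W a ?c"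
      using Com_unit_act(1)[OF that, of Y] by (subst evt_unit_act) (simp_all add: evt_G contraction_unit_act)
    also have "\<dots> = ?u k \<I> \<cdot> ?u \<mu> \<I> \<cdot> evt C S"
      by (subst unit_act_commute) (simp_all add: key)
    also have "\<dots> = evt C S \<cdot> (Idm C S \<otimes>\<^sub>m (?u (\<mu> \<cdot> k) (S\<^sup>\<or>) \<cdot> Idm C (S\<^sup>\<or>)))"
      by (subst evt_unit_act) (simp_all add: unit_act_comp unit_act_commute[of k \<mu>])
    finally have "?u l (S\<^sup>\<or>) \<cdot> G = ?u (\<mu> \<cdot> k) (S\<^sup>\<or>) \<cdot> Idm C (S\<^sup>\<or>)"
      by (rule evt_inject_right) simp_all
    then show ?thesis by (simp add: scal_def)
  qed
qed

end

theorem theorem3p5: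
  fixes C :: "('o, 'a) tensor_cat" (structure)
    and S X Y :: 'o
    and \<phi>_SX \<phi>_XS \<phi>_SvXv \<phi>_XvSv :: 'a
    and \<mu>_SX \<mu>_XS l_SX l_XS l_SvXv l_XvSv l_bSbX l_bXbS :: 'a
  assumes "rigid_ACU_tensor_category C"
    and "S \<in> Obj C" and "X \<in> Obj C" and "Y \<in> Obj C"
    and "\<phi>_SX \<in> Hom C (S \<otimes>\<^sub>o X) Y"
    and "\<phi>_XS \<in> Hom C (X \<otimes>\<^sub>o S) Y"
    and "\<phi>_SvXv \<in> Hom C (S\<^sup>\<or> \<otimes>\<^sub>o X\<^sup>\<or>) (Y\<^sup>\<or>)"
    and "\<phi>_XvSv \<in> Hom C (X\<^sup>\<or> \<otimes>\<^sub>o S\<^sup>\<or>) (Y\<^sup>\<or>)"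
    and "{\<mu>_SX, \<mu>_XS, l_SX, l_XS, l_SvXv, l_XvSv, l_bSbX, l_bXbS} \<subseteq> Hom C \<I> \<I>"
  shows
    "let
       D_SXv = D_map C S X Y \<phi>_SX;
       D_XSv = D_map C X S Y \<phi>_XS;
       D_SvX = D_star C (S\<^sup>\<or>) X Y \<phi>_SvXv;
       D_XvS = D_star C (X\<^sup>\<or>) S Y \<phi>_XvSv;
       Cas_SX = Cas C S X Y \<phi>_XS \<phi>_XvSv \<mu>_SX;
       Cas_XS = Cas C X S Y \<phi>_SX \<phi>_SvXv \<mu>_XS;
       Com_SX = Com C S X \<phi>_SX \<phi>_XS l_SX;
       Com_XS = Com C X S \<phi>_XS \<phi>_SX l_XS;
       Com_SvXv = Com C (S\<^sup>\<or>) (X\<^sup>\<or>) \<phi>_SvXv \<phi>_XvSv l_SvXv;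
       Com_XvSv = Com C (X\<^sup>\<or>) (S\<^sup>\<or>) \<phi>_XvSv \<phi>_SvXv l_XvSv;
       \<phi>_bSbX = bracket_map C S X \<phi>_SX \<phi>_SvXv;
       \<phi>_bXbS = bracket_map C X S \<phi>_XS \<phi>_XvSv;
       Com_bSbX = Com C (bracket C S) (bracket C X) \<phi>_bSbX \<phi>_bXbS l_bSbX;
       Com_bXbS = Com C (bracket C X) (bracket C S) \<phi>_bXbS \<phi>_bSbX l_bXbS
     in
       \<comment> \<open>(A)\<close>
       (Cas_SX \<and> Com_bSbX \<longrightarrow>
         (let F = Run C S \<cdot> (Idm C S \<otimes>\<^sub>m evt C (Y\<^sup>\<or>)) \<cdot> Asc C S (Y\<^sup>\<or>) ((Y\<^sup>\<or>)\<^sup>\<or>)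
                  \<cdot> (D_XvS \<otimes>\<^sub>m Idm C ((Y\<^sup>\<or>)\<^sup>\<or>)) \<cdot> D_SXv
          in (Com_XvSv \<longrightarrow> (l_bSbX \<cdot> l_XvSv) \<odot> F = \<mu>_SX \<odot> Idm C S)
           \<and> (Com_SvXv \<longrightarrow> l_bSbX \<odot> F = (\<mu>_SX \<cdot> l_SvXv) \<odot> Idm C S)))
     \<and>
       \<comment> \<open>(B)\<close>
       (Cas_XS \<and> Com_bXbS \<longrightarrow>
         (let G = Run C (X\<^sup>\<or>) \<cdot> (Idm C (X\<^sup>\<or>) \<otimes>\<^sub>m ev C (Y\<^sup>\<or>)) \<cdot> Asc C (X\<^sup>\<or>) ((Y\<^sup>\<or>)\<^sup>\<or>) (Y\<^sup>\<or>)
                  \<cdot> (D_SXv \<otimes>\<^sub>m Idm C (Y\<^sup>\<or>)) \<cdot> D_XvS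
          in (Com_SX \<longrightarrow> (l_bXbS \<cdot> l_SX) \<odot> G = \<mu>_XS \<odot> Idm C (X\<^sup>\<or>))
           \<and> (Com_XS \<longrightarrow> l_bXbS \<odot> G = (\<mu>_XS \<cdot> l_XS) \<odot> Idm C (X\<^sup>\<or>))))
     \<and>
       \<comment> \<open>(A) with S and X exchanged\<close>
       (Cas_XS \<and> Com_bXbS \<longrightarrow>
         (let F' = Run C X \<cdot> (Idm C X \<otimes>\<^sub>m evt C (Y\<^sup>\<or>)) \<cdot> Asc C X (Y\<^sup>\<or>) ((Y\<^sup>\<or>)\<^sup>\<or>)
                   \<cdot> (D_SvX \<otimes>\<^sub>m Idm C ((Y\<^sup>\<or>)\<^sup>\<or>)) \<cdot> D_XSv
          in (Com_SvXv \<longrightarrow> (l_bXbS \<cdot> l_SvXv) \<odot> F' = \<mu>_XS \<odot> Idm C X)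
           \<and> (Com_XvSv \<longrightarrow> l_bXbS \<odot> F' = (\<mu>_XS \<cdot> l_XvSv) \<odot> Idm C X)))
     \<and>
       \<comment> \<open>(B) with S and X exchanged\<close>
       (Cas_SX \<and> Com_bSbX \<longrightarrow>
         (let G' = Run C (S\<^sup>\<or>) \<cdot> (Idm C (S\<^sup>\<or>) \<otimes>\<^sub>m ev C (Y\<^sup>\<or>)) \<cdot> Asc C (S\<^sup>\<or>) ((Y\<^sup>\<or>)\<^sup>\<or>) (Y\<^sup>\<or>)
                   \<cdot> (D_XSv \<otimes>\<^sub>m Idm C (Y\<^sup>\<or>)) \<cdot> D_SvX
          in (Com_XS \<longrightarrow> (l_bSbX \<cdot> l_XS) \<odot> G' = \<mu>_SX \<odot> Idm C (S\<^sup>\<or>))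
           \<and> (Com_SX \<longrightarrow> l_bSbX \<odot> G' = (\<mu>_SX \<cdot> l_SX) \<odot> Idm C (S\<^sup>\<or>))))"
proof -
  interpret rigid_ACU_tensor_category C by fact
  from assms(9) have hom: "\<mu>_SX \<in> Hom C \<I> \<I>" "\<mu>_XS \<in> Hom C \<I> \<I>" "l_SX \<in> Hom C \<I> \<I>" "l_XS \<in> Hom C \<I> \<I>"
    "l_SvXv \<in> Hom C \<I> \<I>" "l_XvSv \<in> Hom C \<I> \<I>" "l_bSbX \<in> Hom C \<I> \<I>" "l_bXbS \<in> Hom C \<I> \<I>"
    by simp_all
  \<comment> \<open>\<open>SX\<close> covers (A) and the exchanged (B), which share their (Cas) and
    bracketed (Com); \<open>XS\<close>, with S and X exchanged, covers (B) and the exchanged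
    (A).\<close>
  note SX = D_composite_scalar[OF _ _ assms(5-8) hom(1,7) _ assms(2-4) refl]
    dual_D_composite_scalar[OF _ _ assms(5-8) hom(1,7) _ assms(2-4) refl]
  note XS = D_composite_scalar[OF _ _ assms(6,5,8,7) hom(2,8) _ assms(3,2,4) refl]
    dual_D_composite_scalar[OF _ _ assms(6,5,8,7) hom(2,8) _ assms(3,2,4) refl]
  show ?thesis
    unfolding Let_def
    by (intro conjI impI; elim conjE; (rule SX XS; (assumption | rule hom)))
qed

end
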